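(* Let $r\ge 1$, let $C$ be an $r\times r$ matrix with non-negative integer entries (not necessarily symmetric), and let $\overline T$ be the $\mathbb{Q}(q^{1/2})$-linear (continuous) operator on $\mathbb{Q}(q^{1/2})[[x_1,\dots,x_r]]$ given by $\overline T(x^\alpha)=q^{\alpha^t C\alpha}x^\alpha$ for $\alpha\in\mathbb{N}^r$. Let $a_\alpha\in\mathbb{N}[q]$ be given for all $\alpha\in\mathbb{N}^r\setminus\{0\}$, and let $b_\alpha\in\mathbb{Q}(q^{1/2})$, $\alpha\in\mathbb{N}^r\setminus\{0\}$, be such that $$\operatorname{Exp}\left(\frac{\sum_{\alpha\ne 0} b_\alpha(q)\, x^\alpha}{q-1}\right)=\overline T\,\operatorname{Exp}\left(\frac{\sum_{\alpha\ne 0} a_\alpha(q)\, x^\alpha}{q-1}\right).$$ Then $b_\alpha\in\mathbb{N}[q]$ for all $\alpha\in\mathbb{N}^r\setminus\{0\}$.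
   Context: $\mathbb{N}=\{0,1,2,\dots\}$, and $q^{1/2}$ is a formal variable. For $\alpha=(\alpha_1,\dots,\alpha_r)\in\mathbb{N}^r$, $x^\alpha=\prod_i x_i^{\alpha_i}$. $\mathbb{N}[q]$ denotes polynomials in $q$ with non-negative integer coefficients. The algebra $R=\mathbb{Q}(q^{1/2})[[x_1,\dots,x_r]]$ carries its usual commutative multiplication; $R^+$ is its maximal ideal (series with zero constant term). The Adams operations are $\psi_n(f(q^{1/2},x_1,\dots,x_r))=f(q^{n/2},x_1^n,\dots,x_r^n)$ for $n\ge 1$. The plethystic exponential $\operatorname{Exp}:R^+\to 1+R^+$ is $$\operatorname{Exp}(f)=\exp\Big(\sum_{n\ge1}\tfrac1n\psi_n(f)\Big);$$ it is a bijection, so the $b_\alpha$ are uniquely determined by the $a_\alpha$ and $C$. *)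

theory Defs
  imports
    "HOL-Analysis.Finite_Cartesian_Product"
    "HOL-Computational_Algebra.Polynomial_Factorial"
    "HOL-Library.Poly_Mapping"
begin

section \<open>The field \<open>\<rat>(q\<^sup>1\<^sup>/\<^sup>2)\<close>\<close>

text \<open>The indeterminate of the underlying polynomial ring is \<open>q\<^sup>1\<^sup>/\<^sup>2\<close>, not \<open>q\<close>.\<close>

type_synonym qfield = "rat poly fract"

definition qhalf :: qfield where
  "qhalf = to_fract [:0, 1:]"

definition q :: qfield where
  "q = qhalf ^ 2"

definition nat_polys_q :: "qfield set" (\<open>\<nat>[q]\<close>) where
  "\<nat>[q] = range (\<lambda>p :: nat poly. poly (map_poly of_nat p) q)"

lemma pcompose_monom_neq_0:
  fixes b :: "rat poly"
  assumes "n \<noteq> 0" "b \<noteq> 0"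
  shows "pcompose b (monom 1 n) \<noteq> 0"
proof
  assume "pcompose b (monom 1 n) = 0"
  moreover have "degree (monom (1::rat) n) > 0"
    using assms by (simp add: degree_monom_eq)
  ultimately show False using pcompose_eq_0 assms by blast
qed

text \<open>The substitution \<open>q\<^sup>1\<^sup>/\<^sup>2 \<mapsto> q\<^sup>n\<^sup>/\<^sup>2\<close>; meaningful for \<open>n \<ge> 1\<close>, where by
  \<open>adams_scalar_Fract\<close> the result does not depend on the chosen representative.\<close>

definition adams_scalar :: "nat \<Rightarrow> qfield \<Rightarrow> qfield" where
  "adams_scalar n x =
     (THE y. \<exists>a b. b \<noteq> 0 \<and> x = Fract a b \<and>
        y = Fract (pcompose a (monom 1 n)) (pcompose b (monom 1 n)))"

lemma adams_scalar_Fract: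
  assumes n: "n \<ge> 1" and b: "b \<noteq> 0"
  shows "adams_scalar n (Fract a b) =
           Fract (pcompose a (monom 1 n)) (pcompose b (monom 1 n))"
  unfolding adams_scalar_def
proof (rule the_equality)
  fix y assume "\<exists>c d. d \<noteq> 0 \<and> Fract a b = Fract c d \<and>
    y = Fract (pcompose c (monom 1 n)) (pcompose d (monom 1 n))"
  then obtain c d where d: "d \<noteq> 0" and eq: "Fract a b = Fract c d"
    and y: "y = Fract (pcompose c (monom 1 n)) (pcompose d (monom 1 n))" by blast
  have "a * d = c * b" using eq b d by (simp add: eq_fract)
  hence "pcompose (a * d) (monom 1 n) = pcompose (c * b) (monom 1 n)" by simp
  thus "y = Fract (pcompose a (monom 1 n)) (pcompose b (monom 1 n))"
    using n pcompose_monom_neq_0[of n b] pcompose_monom_neq_0[of n d] b d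
    by (simp add: y eq_fract pcompose_mult)
qed (use b in blast)

lemma of_nat_fract: "of_nat n = Fract (of_nat n) (1 :: 'a::idom)"
  by (induction n) (auto simp: Zero_fract_def One_fract_def)

instance fract :: ("{idom, ring_char_0}") field_char_0
  by standard (auto simp: inj_def of_nat_fract eq_fract)


section \<open>Formal power series in the variables \<open>x\<^sub>i\<close>, \<open>i :: 'r\<close>\<close>

abbreviation (input) lookup where "lookup \<equiv> Poly_Mapping.lookup"
abbreviation (input) keys where "keys \<equiv> Poly_Mapping.keys"

text \<open>The exponents are finitely supported functions, so that the product makes sense for every
  index type; for a finite type \<open>'r\<close> with \<open>r\<close> elements, \<open>'r \<Rightarrow>\<^sub>0 nat\<close> is all of \<open>\<nat>\<^sup>r\<close>.\<close>

typedef ('r, 'k) mpseries = "UNIV :: (('r \<Rightarrow>\<^sub>0 nat) \<Rightarrow> 'k) set"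
  morphisms mcoeff Abs_mpseries ..

setup_lifting type_definition_mpseries

declare Abs_mpseries_inverse [OF UNIV_I, simp]

lemma mpseries_eqI: "(\<And>\<alpha>. mcoeff f \<alpha> = mcoeff g \<alpha>) \<Longrightarrow> f = g"
  by (simp add: mcoeff_inject[symmetric] fun_eq_iff)

definition splits :: "('r \<Rightarrow>\<^sub>0 nat) \<Rightarrow> (('r \<Rightarrow>\<^sub>0 nat) \<times> ('r \<Rightarrow>\<^sub>0 nat)) set" where
  "splits \<alpha> = {(\<beta>, \<gamma>). \<beta> + \<gamma> = \<alpha>}"

lemma splits_iff [simp]: "(\<beta>, \<gamma>) \<in> splits \<alpha> \<longleftrightarrow> \<beta> + \<gamma> = \<alpha>"
  by (simp add: splits_def)

lemma finite_splits [simp, intro]: "finite (splits \<alpha>)"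
proof -
  let ?B = "{\<beta> :: 'a \<Rightarrow>\<^sub>0 nat. \<forall>i. lookup \<beta> i \<le> lookup \<alpha> i}"
  let ?H = "{h. \<forall>i. (i \<in> keys \<alpha> \<longrightarrow> h i \<in> {..Max (lookup \<alpha> ` keys \<alpha>)})
                     \<and> (i \<notin> keys \<alpha> \<longrightarrow> h i = 0)}"
  have "lookup ` ?B \<subseteq> ?H"
  proof clarsimp
    fix \<beta> :: "'a \<Rightarrow>\<^sub>0 nat" and i
    assume le: "\<forall>i. lookup \<beta> i \<le> lookup \<alpha> i"
    have "lookup \<beta> i \<le> Max (lookup \<alpha> ` keys \<alpha>)" if "i \<in> keys \<alpha>"
      using that le by (intro order.trans[OF le[rule_format] Max_ge]) auto
    moreover have "lookup \<beta> i = 0" if "i \<notin> keys \<alpha>"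
      using that le[rule_format, of i] by (simp add: in_keys_iff)
    ultimately show "(i \<in> keys \<alpha> \<longrightarrow> lookup \<beta> i \<le> Max (lookup \<alpha> ` keys \<alpha>))
        \<and> (i \<notin> keys \<alpha> \<longrightarrow> lookup \<beta> i = 0)" by blast
  qed
  moreover have "finite ?H" by (rule finite_set_of_finite_funs) auto
  ultimately have "finite (lookup ` ?B)" by (rule finite_subset)
  hence "finite ?B"
    by (rule finite_imageD) (simp add: inj_on_def lookup_inject)
  hence "finite (?B \<times> ?B)" by simp
  moreover have "splits \<alpha> \<subseteq> ?B \<times> ?B"
    by (auto simp: lookup_add)
  ultimately show ?thesis by (rule rev_finite_subset)
qed

instantiation mpseries :: (type, comm_ring_1) comm_ring_1
begin

lift_definition zero_mpseries :: "('a, 'b) mpseries" is "\<lambda>_. 0" .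
lift_definition one_mpseries :: "('a, 'b) mpseries" is "\<lambda>\<alpha>. if \<alpha> = 0 then 1 else 0" .
lift_definition plus_mpseries :: "('a, 'b) mpseries \<Rightarrow> ('a, 'b) mpseries \<Rightarrow> ('a, 'b) mpseries"
  is "\<lambda>f g \<alpha>. f \<alpha> + g \<alpha>" .
lift_definition minus_mpseries :: "('a, 'b) mpseries \<Rightarrow> ('a, 'b) mpseries \<Rightarrow> ('a, 'b) mpseries"
  is "\<lambda>f g \<alpha>. f \<alpha> - g \<alpha>" .
lift_definition uminus_mpseries :: "('a, 'b) mpseries \<Rightarrow> ('a, 'b) mpseries"
  is "\<lambda>f \<alpha>. - f \<alpha>" .
lift_definition times_mpseries :: "('a, 'b) mpseries \<Rightarrow> ('a, 'b) mpseries \<Rightarrow> ('a, 'b) mpseries"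
  is "\<lambda>f g \<alpha>. \<Sum>(\<beta>, \<gamma>)\<in>splits \<alpha>. f \<beta> * g \<gamma>" .

instance
proof
  fix a b c :: "('a, 'b) mpseries"
  show "a * b * c = a * (b * c)"
  proof (transfer, rule ext)
    fix f g h :: "('a \<Rightarrow>\<^sub>0 nat) \<Rightarrow> 'b" and \<alpha>
    have "(\<Sum>(\<beta>, \<gamma>)\<in>splits \<alpha>. (\<Sum>(\<beta>', \<gamma>')\<in>splits \<beta>. f \<beta>' * g \<gamma>') * h \<gamma>)
        = (\<Sum>p\<in>splits \<alpha>. \<Sum>p'\<in>splits (fst p). f (fst p') * g (snd p') * h (snd p))"
      by (simp add: case_prod_unfold sum_distrib_right)
    also have "\<dots> = (\<Sum>(p, p')\<in>Sigma (splits \<alpha>) (\<lambda>p. splits (fst p)).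
                       f (fst p') * g (snd p') * h (snd p))"
      by (rule sum.Sigma) auto
    also have "\<dots> = (\<Sum>(p, p')\<in>Sigma (splits \<alpha>) (\<lambda>p. splits (snd p)).
                       f (fst p) * (g (fst p') * h (snd p')))"
      by (rule sum.reindex_bij_witness
            [where i = "\<lambda>(p, p'). ((fst p + fst p', snd p'), (fst p, fst p'))"
               and j = "\<lambda>(p, p'). ((fst p', snd p' + snd p), (snd p', snd p))"])
         (auto simp: add.assoc mult.assoc)
    also have "\<dots> = (\<Sum>p\<in>splits \<alpha>. \<Sum>p'\<in>splits (snd p).
                       f (fst p) * (g (fst p') * h (snd p')))"
      by (rule sum.Sigma[symmetric]) auto
    also have "\<dots> = (\<Sum>(\<beta>, \<gamma>)\<in>splits \<alpha>. f \<beta> * (\<Sum>(\<beta>', \<gamma>')\<in>splits \<gamma>. g \<beta>' * h \<gamma>'))"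
      by (simp add: case_prod_unfold sum_distrib_left)
    finally show "(\<Sum>(\<beta>, \<gamma>)\<in>splits \<alpha>. (\<Sum>(\<beta>', \<gamma>')\<in>splits \<beta>. f \<beta>' * g \<gamma>') * h \<gamma>)
        = (\<Sum>(\<beta>, \<gamma>)\<in>splits \<alpha>. f \<beta> * (\<Sum>(\<beta>', \<gamma>')\<in>splits \<gamma>. g \<beta>' * h \<gamma>'))" .
  qed
  show "a * b = b * a"
  proof (transfer, rule ext)
    fix f g :: "('a \<Rightarrow>\<^sub>0 nat) \<Rightarrow> 'b" and \<alpha>
    show "(\<Sum>(\<beta>, \<gamma>)\<in>splits \<alpha>. f \<beta> * g \<gamma>) = (\<Sum>(\<beta>, \<gamma>)\<in>splits \<alpha>. g \<beta> * f \<gamma>)"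
      by (rule sum.reindex_bij_witness[where i = prod.swap and j = prod.swap])
         (auto simp: mult.commute add.commute)
  qed
  show "1 * a = a"
  proof (transfer, rule ext)
    fix f :: "('a \<Rightarrow>\<^sub>0 nat) \<Rightarrow> 'b" and \<alpha>
    have "(\<Sum>(\<beta>, \<gamma>)\<in>splits \<alpha>. (if \<beta> = 0 then 1 else 0) * f \<gamma>)
        = (\<Sum>(\<beta>, \<gamma>)\<in>{(0 :: 'a \<Rightarrow>\<^sub>0 nat, \<alpha>)}. (if \<beta> = 0 then 1 else 0) * f \<gamma>)"
      by (rule sum.mono_neutral_right) (auto split: if_splits)
    thus "(\<Sum>(\<beta>, \<gamma>)\<in>splits \<alpha>. (if \<beta> = 0 then 1 else 0) * f \<gamma>) = f \<alpha>" by simp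
  qed
  show "(a + b) * c = a * c + b * c"
    by (transfer, rule ext)
       (simp add: case_prod_unfold distrib_right sum.distrib)
  show "(0 :: ('a, 'b) mpseries) \<noteq> 1"
    by (transfer, auto simp: fun_eq_iff)
  show "a + b + c = a + (b + c)"
    by (rule mpseries_eqI) (simp add: plus_mpseries.rep_eq add.assoc)
  show "a + b = b + a"
    by (rule mpseries_eqI) (simp add: plus_mpseries.rep_eq add.commute)
  show "0 + a = a"
    by (rule mpseries_eqI) (simp add: plus_mpseries.rep_eq zero_mpseries.rep_eq)
  show "- a + a = 0"
    by (rule mpseries_eqI)
       (simp add: plus_mpseries.rep_eq uminus_mpseries.rep_eq zero_mpseries.rep_eq)
  show "a - b = a + - b"
    by (rule mpseries_eqI)
       (simp add: plus_mpseries.rep_eq minus_mpseries.rep_eq uminus_mpseries.rep_eq)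
qed

end

lift_definition mscale :: "'k::comm_ring_1 \<Rightarrow> ('r, 'k) mpseries \<Rightarrow> ('r, 'k) mpseries"
  is "\<lambda>c f \<alpha>. c * f \<alpha>" .

text \<open>The series \<open>\<Sum>\<^bsub>\<alpha> \<noteq> 0\<^esub> a\<^sub>\<alpha> x\<^sup>\<alpha>\<close>; the value of \<open>a\<close> at \<open>0\<close> is ignored.\<close>

definition series_without_const :: "(('r \<Rightarrow>\<^sub>0 nat) \<Rightarrow> 'k::comm_ring_1) \<Rightarrow> ('r, 'k) mpseries" where
  "series_without_const a = Abs_mpseries (\<lambda>\<alpha>. if \<alpha> = 0 then 0 else a \<alpha>)"

text \<open>Infinite sums are taken coefficientwise; they are meaningful when each coefficient receives
  only finitely many nonzero contributions (for \<open>msum\<close> as used in \<open>mexp\<close> and \<open>Exp\<close>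
  below, see \<open>finite_support_mexp\<close> and \<open>finite_support_psi\<close>).\<close>

lift_definition msum :: "(nat \<Rightarrow> ('r, 'k::comm_ring_1) mpseries) \<Rightarrow> ('r, 'k) mpseries"
  is "\<lambda>F \<alpha>. Sum_any (\<lambda>n. F n \<alpha>)" .

definition mexp :: "('r, 'k::field_char_0) mpseries \<Rightarrow> ('r, 'k) mpseries" where
  "mexp g = msum (\<lambda>k. mscale (1 / fact k) (g ^ k))"


section \<open>Adams operations and the plethystic exponential\<close>

text \<open>The coefficient of \<open>x\<^sup>\<alpha>\<close> in \<open>\<psi>\<^sub>n f\<close> comes from the exponent \<open>\<alpha>/n\<close>; cf. \<open>mcoeff_psi\<close> below.\<close>

definition psi :: "nat \<Rightarrow> ('r, qfield) mpseries \<Rightarrow> ('r, qfield) mpseries" where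
  "psi n f = Abs_mpseries (\<lambda>\<alpha>.
     if \<forall>i. n dvd lookup \<alpha> i
     then adams_scalar n (mcoeff f (Poly_Mapping.map (\<lambda>k. k div n) \<alpha>)) else 0)"

definition Exp :: "('r, qfield) mpseries \<Rightarrow> ('r, qfield) mpseries" where
  "Exp f = mexp (msum (\<lambda>m. mscale (1 / of_nat (Suc m)) (psi (Suc m) f)))"

lemma mcoeff_psi:
  assumes "n \<ge> 1"
  shows "mcoeff (psi n f) (Poly_Mapping.map (\<lambda>k. n * k) \<beta>) = adams_scalar n (mcoeff f \<beta>)"
proof -
  have "Poly_Mapping.map (\<lambda>k. k div n) (Poly_Mapping.map (\<lambda>k. n * k) \<beta>) = \<beta>"
    using assms by (intro poly_mapping_eqI) (simp add: Poly_Mapping.map.rep_eq when_def)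
  moreover have "\<forall>i. n dvd lookup (Poly_Mapping.map (\<lambda>k. n * k) \<beta>) i"
    by (simp add: Poly_Mapping.map.rep_eq when_def)
  ultimately show ?thesis by (simp add: psi_def)
qed

lemma adams_scalar_0 [simp]: "n \<ge> 1 \<Longrightarrow> adams_scalar n 0 = 0"
  using adams_scalar_Fract[of n 1 0] by (simp add: fract_collapse)

lemma finite_support_psi:
  assumes "mcoeff f 0 = 0"
  shows "finite {m. mcoeff (mscale (1 / of_nat (Suc m)) (psi (Suc m) f)) \<alpha> \<noteq> 0}"
proof (cases "\<alpha> = 0")
  case True
  have "Poly_Mapping.map (\<lambda>k. k div n) (0 :: 'a \<Rightarrow>\<^sub>0 nat) = 0" for n
    by (intro poly_mapping_eqI) (simp add: Poly_Mapping.map.rep_eq)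
  with True assms show ?thesis by (simp add: mscale.rep_eq psi_def)
next
  case False
  then obtain i where i: "lookup \<alpha> i \<noteq> 0"
    by (metis lookup_zero poly_mapping_eqI)
  have "{m. mcoeff (mscale (1 / of_nat (Suc m)) (psi (Suc m) f)) \<alpha> \<noteq> 0} \<subseteq> {..lookup \<alpha> i}"
  proof
    fix m assume "m \<in> {m. mcoeff (mscale (1 / of_nat (Suc m)) (psi (Suc m) f)) \<alpha> \<noteq> 0}"
    hence "Suc m dvd lookup \<alpha> i" by (auto simp: mscale.rep_eq psi_def split: if_splits)
    with i have "Suc m \<le> lookup \<alpha> i" by (intro dvd_imp_le) auto
    thus "m \<in> {..lookup \<alpha> i}" by simp
  qed
  thus ?thesis by (rule finite_subset) simp
qed

lemma mcoeff_power_eq_0: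
  fixes g :: "('r, 'k::comm_ring_1) mpseries"
  assumes "mcoeff g 0 = 0" "(\<Sum>i\<in>keys \<alpha>. lookup \<alpha> i) < k"
  shows "mcoeff (g ^ k) \<alpha> = 0"
  using assms(2)
proof (induction k arbitrary: \<alpha>)
  case (Suc k)
  have "mcoeff g \<beta> * mcoeff (g ^ k) \<gamma> = 0" if "\<beta> + \<gamma> = \<alpha>" for \<beta> \<gamma>
  proof (cases "\<beta> = 0")
    case False
    have wt: "(\<Sum>i\<in>keys \<delta>. lookup \<delta> i) = (\<Sum>i\<in>keys \<beta> \<union> keys \<gamma>. lookup \<delta> i)"
      if "keys \<delta> \<subseteq> keys \<beta> \<union> keys \<gamma>" for \<delta> :: "'r \<Rightarrow>\<^sub>0 nat"
      using that by (intro sum.mono_neutral_left) (auto simp: in_keys_iff)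
    have "(\<Sum>i\<in>keys \<alpha>. lookup \<alpha> i) = (\<Sum>i\<in>keys \<beta>. lookup \<beta> i) + (\<Sum>i\<in>keys \<gamma>. lookup \<gamma> i)"
      using wt[of \<alpha>] wt[of \<beta>] wt[of \<gamma>] that keys_add[of \<beta> \<gamma>]
      by (auto simp: lookup_add sum.distrib)
    moreover obtain i where "i \<in> keys \<beta>" using False
      by (auto simp flip: keys_eq_empty)
    hence "(\<Sum>i\<in>keys \<beta>. lookup \<beta> i) > 0"
      by (intro sum_pos) (auto simp: in_keys_iff)
    ultimately have "mcoeff (g ^ k) \<gamma> = 0" using Suc.prems by (intro Suc.IH) auto
    thus ?thesis by simp
  qed (use assms(1) in simp)
  hence "(\<Sum>(\<beta>, \<gamma>)\<in>splits \<alpha>. mcoeff g \<beta> * mcoeff (g ^ k) \<gamma>) = 0"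
    by (intro sum.neutral) auto
  thus ?case by (simp add: times_mpseries.rep_eq)
qed simp

lemma finite_support_mexp:
  fixes g :: "('r, 'k::field_char_0) mpseries"
  assumes "mcoeff g 0 = 0"
  shows "finite {k. mcoeff (mscale (1 / fact k) (g ^ k)) \<alpha> \<noteq> 0}"
proof (rule finite_subset)
  show "{k. mcoeff (mscale (1 / fact k) (g ^ k)) \<alpha> \<noteq> 0} \<subseteq> {..\<Sum>i\<in>keys \<alpha>. lookup \<alpha> i}"
  proof
    fix k assume "k \<in> {k. mcoeff (mscale (1 / fact k) (g ^ k)) \<alpha> \<noteq> 0}"
    hence "mcoeff (g ^ k) \<alpha> \<noteq> 0" by (auto simp: mscale.rep_eq)
    hence "\<not> (\<Sum>i\<in>keys \<alpha>. lookup \<alpha> i) < k" using mcoeff_power_eq_0[OF assms] by blast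
    thus "k \<in> {..\<Sum>i\<in>keys \<alpha>. lookup \<alpha> i}" by simp
  qed
qed (rule finite_atMost)


section \<open>The operator \<open>x\<^sup>\<alpha> \<mapsto> q\<^bsup>\<alpha>\<^sup>t C \<alpha>\<^esup> x\<^sup>\<alpha>\<close>\<close>

definition quad_form :: "nat ^ 'r ^ 'r \<Rightarrow> ('r::finite \<Rightarrow>\<^sub>0 nat) \<Rightarrow> nat" where
  "quad_form C \<alpha> = (\<Sum>i\<in>UNIV. \<Sum>j\<in>UNIV. lookup \<alpha> i * C $ i $ j * lookup \<alpha> j)"

text \<open>The linear operator is continuous for the product topology on coefficients, hence acts
  coefficientwise.\<close>

definition Tbar :: "nat ^ 'r ^ 'r \<Rightarrow> ('r::finite, qfield) mpseries \<Rightarrow> ('r, qfield) mpseries" where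
  "Tbar C f = Abs_mpseries (\<lambda>\<alpha>. q ^ quad_form C \<alpha> * mcoeff f \<alpha>)"

end

theory Submission
  imports Defs "HOL-Library.List_Lexorder" "HOL-Library.Product_Lexorder" "HOL-Library.Multiset" "HOL-Computational_Algebra.Formal_Laurent_Series" "HOL-Library.Countable" "HOL-Library.Function_Algebras"
begin

text \<open>Expanded in powers of \<open>q\<^sup>-\<^sup>1\<close>, the series \<open>a\<^sub>\<alpha>/(q - 1)\<close> counts letters \<open>(v, e)\<close>, where the colours \<open>v\<close> of
  weight \<open>\<alpha>\<close> are the monomials of \<open>a\<^sub>\<alpha>\<close> and \<open>e\<close> is an exponent; its plethystic exponential counts
  multisets of letters, which index a basis of the symmetric polynomials in coloured variables. The
  twist by the quadratic form is the degree shift that makes the shuffle product with kernel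
  \<open>\<Prod> (x\<^sub>i - x\<^sub>j)\<^sup>m\<close> graded, \<open>m\<close> being the polarised form. Leading words of products are
  maximal shuffles, so this algebra is free over generators indexed by Lyndon words, and
  \<open>b\<^sub>\<alpha>/(q - 1)\<close> counts these words. A degree raising derivation acts injectively on the
  generators modulo decomposables, whence \<open>b\<^sub>\<alpha>\<close> has nonnegative coefficients in powers of \<open>q\<^sup>-\<^sup>1\<close>.

  For polynomiality, the quotient of \<open>Exp (f / (q - 1))\<close> at \<open>q\<^sup>v x\<close> and at \<open>x\<close> is the exponential of a
  series without denominators. Comparing these quotients for \<open>a\<close> and \<open>b\<close> shows recursively that
  \<open>(1 + q + \<dots> + q\<^sup>l\<^sup>-\<^sup>1) b\<^sub>\<alpha>\<close> with \<open>l = \<alpha>\<^sub>i\<close> is a polynomial, and nonnegativity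
  rules out cancellation.\<close>

section \<open>Lyndon words and shuffles\<close>

text \<open>A product is a sum over all splittings of the labels, so several splittings may
  contribute to one leading monomial, and they could cancel. Two facts exclude this. The lowest
  monomial of the kernel raises the exponent at a label by exactly the shift that the other factor
  adds to its letter, so a splitting produces a shuffle of the two words. The sign of that monomial
  depends on the words alone, so the contributions are equal and add up in characteristic 0.

  The derivation acts injectively because it has a partner: multiplication by the sum of the
  variables and translation of all variables have the number of variables as commutator, and grades
  are bounded below.

  Neither half suffices alone. Positivity still allows infinitely many powers of the inverse of
  \<open>q\<close>, while dilating one variable controls \<open>b \<alpha>\<close> only up to a
  q-integer and with rational coefficients.

  The polarised form has the even diagonal \<open>2 * quad_form C\<close> also when \<open>C\<close>
  is not symmetric; this makes the kernel symmetric in two variables of the same colour.\<close>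

definition lyndon :: "'a::linorder list \<Rightarrow> bool" where
  "lyndon w \<longleftrightarrow> w \<noteq> [] \<and> (\<forall>u v. w = u @ v \<longrightarrow> v \<noteq> [] \<longrightarrow> w \<le> v)"

text \<open>The factorizations of Chen, Fox and Lyndon: by \<open>lyndon_seq_exists\<close> and
  \<open>lyndon_seq_concat_inj\<close> every word is \<open>concat ls\<close> for exactly one such
  \<open>ls\<close>.\<close>

definition lyndon_seq :: "'a::linorder list list \<Rightarrow> bool" where
  "lyndon_seq ls \<longleftrightarrow> sorted_wrt (\<ge>) ls \<and> (\<forall>l\<in>set ls. lyndon l)"

lemma le_append: "(u :: 'a::linorder list) \<le> u @ v"
  by (induction u) auto

lemma le_append_right: "(u :: 'a::linorder list) \<le> v \<Longrightarrow> u \<le> v @ w"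
  using le_append order.trans by blast

lemma append_le_append_iff [simp]: "(u :: 'a::linorder list) @ v \<le> u @ w \<longleftrightarrow> v \<le> w"
  by (induction u) auto

lemma append_less_append_iff [simp]: "(u :: 'a::linorder list) @ v < u @ w \<longleftrightarrow> v < w"
  by (induction u) auto

lemma less_imp_append_less_or_prefix:
  "(u :: 'a::linorder list) < v \<Longrightarrow> u @ w < v \<or> (\<exists>t. v = u @ t \<and> t \<noteq> [])"
proof (induction u arbitrary: v)
  case (Cons a u)
  then show ?case by (cases v) auto
qed auto

text \<open>A suffix that begins inside a factor \<open>l\<close> starts with a nonempty suffix of
  \<open>l\<close>, which is at least \<open>l\<close> and hence at least the last factor. So the
  last factor is the least nonempty suffix of the whole word, which is what determines it.\<close>

lemma lyndon_seq_last_le_suffix: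
  assumes "lyndon_seq ls" "concat ls = t @ s" "s \<noteq> []"
  shows "last ls \<le> s"
  using assms
proof (induction ls arbitrary: t)
  case (Cons l ls)
  have lyn: "lyndon l" and ls: "lyndon_seq ls"
    using Cons.prems(1) by (auto simp: lyndon_seq_def)
  have last: "last (l # ls) \<le> l"
    using Cons.prems(1) by (auto simp: lyndon_seq_def)
  from Cons.prems(2) obtain us where
    us: "l = t @ us \<and> us @ concat ls = s \<or> l @ us = t \<and> concat ls = us @ s"
    by (auto simp: append_eq_append_conv2)
  show ?case
  proof (cases "l @ us = t \<and> concat ls = us @ s")
    case True
    with Cons.IH[OF ls, of us] Cons.prems(3) show ?thesis by (cases "ls = []") auto
  next
    case False
    with us have us: "l = t @ us" "s = us @ concat ls" by auto
    show ?thesis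
    proof (cases "us = []")
      case True
      with Cons.IH[OF ls, of "[]"] us Cons.prems(3) show ?thesis by (cases "ls = []") auto
    next
      case False
      hence "l \<le> us" using lyn us by (auto simp: lyndon_def)
      thus ?thesis using last us le_append_right order.trans by blast
    qed
  qed
qed simp

lemma lyndon_seq_snoc:
  "lyndon_seq (ls @ [l]) \<longleftrightarrow> lyndon_seq ls \<and> lyndon l \<and> (\<forall>x\<in>set ls. l \<le> x)"
  by (auto simp: lyndon_seq_def sorted_wrt_append)

text \<open>Both last factors are the least nonempty suffix of the common word, so they agree and
  can be stripped.\<close>

lemma lyndon_seq_concat_inj:
  assumes "lyndon_seq ls" "lyndon_seq ls'" "concat ls = concat ls'"
  shows "ls = ls'"
  using assms
proof (induction ls arbitrary: ls' rule: rev_induct)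
  case Nil
  then show ?case by (cases ls' rule: rev_cases) (auto simp: lyndon_seq_snoc lyndon_def)
next
  case (snoc l ls)
  have l: "l \<noteq> []" using snoc.prems by (auto simp: lyndon_seq_snoc lyndon_def)
  then obtain ks k where ks: "ls' = ks @ [k]"
    using snoc.prems(3) by (cases ls' rule: rev_cases) auto
  have k: "k \<noteq> []" using snoc.prems ks by (auto simp: lyndon_seq_snoc lyndon_def)
  have "last (ls @ [l]) \<le> k"
    using snoc.prems ks k by (intro lyndon_seq_last_le_suffix[where t = "concat ks"]) auto
  moreover have "last ls' \<le> l"
    using snoc.prems ks l by (intro lyndon_seq_last_le_suffix[where t = "concat ls"]) auto
  ultimately have "l = k" using ks by simp
  with snoc ks show ?case by (auto simp: lyndon_seq_snoc)
qed

text \<open>The least nonempty suffix is Lyndon, because its suffixes are again suffixes of the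
  word. It becomes the last factor and the remaining prefix is factorized recursively.\<close>

lemma lyndon_seq_exists: "\<exists>ls. lyndon_seq ls \<and> concat ls = w"
proof (induction "length w" arbitrary: w rule: less_induct)
  case less
  show ?case
  proof (cases "w = []")
    case True
    thus ?thesis by (intro exI[of _ "[]"]) (auto simp: lyndon_seq_def)
  next
    case False
    define X where "X = {s. s \<noteq> [] \<and> (\<exists>t. w = t @ s)}"
    have "X \<subseteq> (\<lambda>n. drop n w) ` {..length w}"
    proof
      fix s assume "s \<in> X"
      then obtain t where "w = t @ s" by (auto simp: X_def)
      thus "s \<in> (\<lambda>n. drop n w) ` {..length w}" by (intro image_eqI[of _ _ "length t"]) auto
    qed
    hence fin: "finite X" by (rule finite_subset) simp
    have "w \<in> X" using False by (auto simp: X_def)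
    hence "Min X \<in> X" using fin by (intro Min_in) auto
    define l where "l = Min X"
    have "l \<in> X" using \<open>Min X \<in> X\<close> by (simp add: l_def)
    then obtain V where V: "w = V @ l" "l \<noteq> []" by (auto simp: X_def)
    have min: "l \<le> s" if "w = t @ s" "s \<noteq> []" for s t
      unfolding l_def using that fin by (intro Min_le) (auto simp: X_def)
    have lyn: "lyndon l"
      unfolding lyndon_def
    proof (intro conjI allI impI)
      fix u v assume "l = u @ v" "v \<noteq> []"
      thus "l \<le> v" using V by (intro min[of "V @ u"]) auto
    qed (use V in auto)
    from less[of V] V obtain ls where ls: "lyndon_seq ls" "concat ls = V" by auto
    have "l \<le> x" if "x \<in> set ls" for x
    proof -
      have ne: "ls \<noteq> []" using that by auto
      \<comment> \<open>Otherwise minimality of \<open>l\<close> against the suffix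
        \<open>last ls @ l\<close> forces \<open>last ls\<close> to be a proper prefix of
        \<open>l\<close>; cancelling it makes \<open>l\<close> equal to its own proper suffix
        \<open>t\<close>.\<close>
      have "l \<le> last ls"
      proof (rule ccontr)
        assume "\<not> l \<le> last ls"
        hence less: "last ls < l" by simp
        have "w = concat (butlast ls) @ (last ls @ l)"
          using V ls ne by (metis append_assoc append_butlast_last_id concat.simps concat_append append_Nil2)
        hence *: "l \<le> last ls @ l" using V by (intro min[of "concat (butlast ls)"]) auto
        from less_imp_append_less_or_prefix[OF less, of l] * obtain t where
          t: "l = last ls @ t" "t \<noteq> []" by auto
        have "l \<le> t" using lyn t by (auto simp: lyndon_def)
        moreover have "t \<le> l" using * t by (metis append_le_append_iff)
        ultimately have "l = t" by simp
        moreover have "lyndon (last ls)" using ls ne by (auto simp: lyndon_seq_def)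
        ultimately show False using t by (auto simp: lyndon_def)
      qed
      moreover have "last ls \<le> x"
        using ls(1) that ne unfolding lyndon_seq_def
        by (cases ls rule: rev_cases) (auto simp: sorted_wrt_append)
      ultimately show ?thesis by simp
    qed
    hence "lyndon_seq (ls @ [l])" using ls lyn by (auto simp: lyndon_seq_snoc)
    thus ?thesis using V ls by (intro exI[of _ "ls @ [l]"]) auto
  qed
qed

lemma shuffles_nonempty: "shuffles u v \<noteq> {}"
  using splice_in_shuffles by blast

text \<open>Letters should be drawn first from the word whose remaining part is larger.\<close>

lemma shuffles_prefix_exchange:
  assumes "v \<le> u" "w \<in> shuffles (p @ u) v"
  shows "\<exists>w'\<in>shuffles u (p @ v). (w :: 'a::linorder list) \<le> w'"
  using assms
proof (induction w arbitrary: p u v)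
  case (Cons z zs)
  show ?case
  proof (cases p)
    case (Cons c p')
    from Cons.prems(2) \<open>p = c # p'\<close>
    consider "z = c" "zs \<in> shuffles (p' @ u) v"
      | v' where "v = z # v'" "zs \<in> shuffles (p @ u) v'"
      by (cases v) (auto simp: Cons_in_shuffles_iff)
    thus ?thesis
    proof cases
      case 1
      from Cons.IH[OF Cons.prems(1) 1(2)] obtain w' where "w' \<in> shuffles u (p' @ v)" "zs \<le> w'"
        by auto
      thus ?thesis using 1 \<open>p = c # p'\<close>
        by (intro bexI[of _ "c # w'"]) (auto simp: Cons_in_shuffles_iff)
    next
      case 2
      with Cons.prems(1) obtain d u' where u: "u = d # u'" by (cases u) auto
      \<comment> \<open>If both remainders start with the drawn letter, it may be drawn from
        \<open>u\<close> instead, which lengthens the prefix \<open>p\<close> by one letter.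
        Otherwise \<open>u\<close> starts with a larger letter, and taking that letter first already
        decides the comparison.\<close>
      show ?thesis
      proof (cases "d = z")
        case True
        with 2 Cons.prems(1) u have "v' \<le> u'" by simp
        moreover have "zs \<in> shuffles ((p @ [z]) @ u') v'" using 2 u True by simp
        ultimately obtain w' where "w' \<in> shuffles u' ((p @ [z]) @ v')" "zs \<le> w'"
          using Cons.IH by blast
        thus ?thesis using 2 u True
          by (intro bexI[of _ "z # w'"]) (auto simp: Cons_in_shuffles_iff)
      next
        case False
        with 2 Cons.prems(1) u have "z < d" by auto
        moreover obtain w' where "w' \<in> shuffles u' (p @ v)" using shuffles_nonempty by blast
        ultimately show ?thesis using u
          by (intro bexI[of _ "d # w'"]) (auto simp: Cons_in_shuffles_iff)
      qed
    qed
  qed (use Cons.prems in auto)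
qed auto

text \<open>Placing \<open>W\<close> at the end is optimal when no nonempty suffix of
  \<open>s\<close> is smaller than \<open>W\<close>. If a shuffle begins with a letter of
  \<open>W\<close> that also begins \<open>s\<close>, \<open>shuffles_prefix_exchange\<close> trades
  it for one that takes this letter from \<open>s\<close>.\<close>

lemma shuffles_le_append:
  assumes "\<And>t s'. s = t @ s' \<Longrightarrow> s' \<noteq> [] \<Longrightarrow> W \<le> s'" "w \<in> shuffles s W"
  shows "(w :: 'a::linorder list) \<le> s @ W"
  using assms
proof (induction s arbitrary: w)
  case (Cons a s)
  have IH: "x \<le> s @ W" if "x \<in> shuffles s W" for x
    using Cons.IH[OF _ that] Cons.prems(1)[of "a # t" for t] by simp
  from Cons.prems(2) consider zs where "w = a # zs" "zs \<in> shuffles s W"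
    | b W' zs where "W = b # W'" "w = b # zs" "zs \<in> shuffles (a # s) W'"
    by (auto elim: shufflesE)
  thus ?case
  proof cases
    case 1
    thus ?thesis using IH by simp
  next
    case 2
    have le: "W \<le> a # s" using Cons.prems(1)[of "[]"] by simp
    show ?thesis
    proof (cases "a = b")
      case True
      with 2 le have "W' \<le> s" by simp
      with shuffles_prefix_exchange[of W' s zs "[a]"] 2 True obtain x
        where "x \<in> shuffles s W" "zs \<le> x" by auto
      with IH[of x] show ?thesis using 2 True by auto
    qed (use 2 le in auto)
  qed
qed auto

text \<open>All nonempty suffixes of the earlier part are at least its last factor, hence at least
  \<open>l\<close>. This is the maximality that \<open>lead_star\<close> requires when a generator
  is appended to a product.\<close>

lemma lyndon_seq_shuffles_le:
  assumes "lyndon_seq (ls @ [l])" "w \<in> shuffles (concat ls) l"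
  shows "w \<le> concat ls @ l"
proof (rule shuffles_le_append[OF _ assms(2)])
  fix t s assume s: "concat ls = t @ s" "s \<noteq> []"
  have "last ls \<le> s"
    using assms(1) s by (intro lyndon_seq_last_le_suffix) (auto simp: lyndon_seq_snoc)
  moreover have "l \<le> last ls"
    using assms(1) s by (cases "ls = []") (auto simp: lyndon_seq_snoc)
  ultimately show "l \<le> s" by simp
qed

text \<open>Equal lengths ensure that no comparison is decided by a word that ends early. The
  equality clause later identifies which terms can attain a leading word.\<close>

lemma shuffles_mono:
  assumes "w1 \<in> shuffles u1 v1" "u1 \<le> u" "v1 \<le> v" "length u1 = length u" "length v1 = length v"
  shows "\<exists>w\<in>shuffles u v. (w1 :: 'a::linorder list) \<le> w \<and> (w1 = w \<longrightarrow> u1 = u \<and> v1 = v)"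
  using assms
proof (induction w1 arbitrary: u1 v1 u v)
  case (Cons z zs)
  from Cons.prems(1) consider u1' where "u1 = z # u1'" "zs \<in> shuffles u1' v1"
    | v1' where "v1 = z # v1'" "zs \<in> shuffles u1 v1'"
    by (cases u1; cases v1) (auto simp: Cons_in_shuffles_iff)
  thus ?case
  proof cases
    case 1
    with Cons.prems obtain a u' where u: "u = a # u'" by (cases u) auto
    show ?thesis
    proof (cases "a = z")
      case True
      with Cons.IH[of u1' v1 u' v] 1 u Cons.prems obtain w where
        "w \<in> shuffles u' v" "zs \<le> w" "zs = w \<longrightarrow> u1' = u' \<and> v1 = v" by auto
      thus ?thesis using 1 u True by (intro bexI[of _ "z # w"]) (auto simp: Cons_in_shuffles_iff)
    next
      case False
      with Cons.prems 1 u have "z < a" by auto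
      moreover obtain w' where "w' \<in> shuffles u' v" using shuffles_nonempty by blast
      ultimately show ?thesis using u
        by (intro bexI[of _ "a # w'"]) (auto simp: Cons_in_shuffles_iff)
    qed
  next
    case 2
    with Cons.prems obtain a v' where v: "v = a # v'" by (cases v) auto
    show ?thesis
    proof (cases "a = z")
      case True
      with Cons.IH[of u1 v1' u v'] 2 v Cons.prems obtain w where
        "w \<in> shuffles u v'" "zs \<le> w" "zs = w \<longrightarrow> u1 = u \<and> v1' = v'" by auto
      thus ?thesis using 2 v True by (intro bexI[of _ "z # w"]) (auto simp: Cons_in_shuffles_iff)
    next
      case False
      with Cons.prems 2 v have "z < a" by auto
      moreover obtain w' where "w' \<in> shuffles u v'" using shuffles_nonempty by blast
      ultimately show ?thesis using v
        by (intro bexI[of _ "a # w'"]) (auto simp: Cons_in_shuffles_iff)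
    qed
  qed
qed auto

lemma map_in_shuffles:
  "map h xs \<in> shuffles (map h (filter P xs)) (map h (filter (\<lambda>x. \<not> P x) xs))"
  by (induction xs) (auto simp: Cons_in_shuffles_iff)

section \<open>Power series in labelled variables\<close>

lemma mcoeff_times: "mcoeff (f * g) \<alpha> = (\<Sum>(\<beta>, \<gamma>)\<in>splits \<alpha>. mcoeff f \<beta> * mcoeff g \<gamma>)"
  by (rule times_mpseries.rep_eq[THEN fun_cong])

lemma mcoeff_add [simp]: "mcoeff (f + g) \<alpha> = mcoeff f \<alpha> + mcoeff g \<alpha>"
  by (simp add: plus_mpseries.rep_eq)

lemma mcoeff_diff [simp]: "mcoeff (f - g) \<alpha> = mcoeff f \<alpha> - mcoeff g \<alpha>"
  by (simp add: minus_mpseries.rep_eq)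

lemma mcoeff_zero [simp]: "mcoeff 0 \<alpha> = 0"
  by (simp add: zero_mpseries.rep_eq)

lemma mcoeff_one: "mcoeff 1 \<alpha> = (if \<alpha> = 0 then 1 else 0)"
  by (simp add: one_mpseries.rep_eq)

lemma mcoeff_scale [simp]: "mcoeff (mscale c f) \<alpha> = c * mcoeff f \<alpha>"
  by (simp add: mscale.rep_eq)

lemma mcoeff_sum: "mcoeff (\<Sum>x\<in>X. f x) \<alpha> = (\<Sum>x\<in>X. mcoeff (f x) \<alpha>)"
  by (induction X rule: infinite_finite_induct) auto

lemma mcoeff_times_nonzero:
  assumes "mcoeff (f * g) \<alpha> \<noteq> 0"
  obtains \<beta> \<gamma> where "\<beta> + \<gamma> = \<alpha>" "mcoeff f \<beta> \<noteq> 0" "mcoeff g \<gamma> \<noteq> 0"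
proof -
  have "\<exists>x\<in>splits \<alpha>. (case x of (\<beta>, \<gamma>) \<Rightarrow> mcoeff f \<beta> * mcoeff g \<gamma>) \<noteq> 0"
    using assms unfolding mcoeff_times by (meson sum.neutral)
  then obtain \<beta> \<gamma> where *: "\<beta> + \<gamma> = \<alpha>" "mcoeff f \<beta> * mcoeff g \<gamma> \<noteq> 0" by auto
  hence "mcoeff f \<beta> \<noteq> 0" "mcoeff g \<gamma> \<noteq> 0" by auto
  thus ?thesis using that * by blast
qed

definition mvar :: "'r \<Rightarrow> ('r, 'k::comm_ring_1) mpseries" where
  "mvar a = Abs_mpseries (\<lambda>e. if e = Poly_Mapping.single a 1 then 1 else 0)"

lemma mcoeff_mvar: "mcoeff (mvar a) e = (if e = Poly_Mapping.single a 1 then 1 else 0)"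
  by (simp add: mvar_def)

lemma mcoeff_mvar_times:
  fixes p :: "('a, 'k::comm_ring_1) mpseries"
  shows "mcoeff (mvar a * p) e =
     (if lookup e a = 0 then 0 else mcoeff p (e - Poly_Mapping.single a 1))"
proof (cases "lookup e a = 0")
  case True
  have "mcoeff (mvar a) \<beta> * mcoeff p \<gamma> = 0" if "\<beta> + \<gamma> = e" for \<beta> \<gamma>
    using that True by (auto simp: mcoeff_mvar lookup_add)
  thus ?thesis using True by (auto simp: mcoeff_times intro!: sum.neutral)
next
  case False
  let ?d = "Poly_Mapping.single a 1 :: 'a \<Rightarrow>\<^sub>0 nat"
  have e: "?d + (e - ?d) = e"
    using False by (intro poly_mapping_eqI) (auto simp: lookup_add lookup_minus lookup_single when_def)
  have "mcoeff (mvar a * p) e = (\<Sum>(\<beta>, \<gamma>)\<in>{(?d, e - ?d)}. mcoeff (mvar a) \<beta> * mcoeff p \<gamma>)"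
    unfolding mcoeff_times using e
    by (intro sum.mono_neutral_right) (auto simp: mcoeff_mvar split: if_splits)
  thus ?thesis using False by (simp add: mcoeff_mvar)
qed

lemma mvar_times_cancel:
  fixes p r :: "('a, 'k::comm_ring_1) mpseries"
  assumes "mvar a * p = mvar a * r"
  shows "p = r"
proof (rule mpseries_eqI)
  fix e
  let ?d = "Poly_Mapping.single a 1 :: 'a \<Rightarrow>\<^sub>0 nat"
  have "mcoeff (mvar a * p) (e + ?d) = mcoeff (mvar a * r) (e + ?d)" using assms by simp
  thus "mcoeff p e = mcoeff r e"
    by (simp add: mcoeff_mvar_times lookup_add)
qed

section \<open>Supports, total degree and lowest terms of series\<close>

definition vars_in :: "('r, 'k::comm_ring_1) mpseries \<Rightarrow> 'r set \<Rightarrow> bool" where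
  "vars_in p A \<longleftrightarrow> (\<forall>e. mcoeff p e \<noteq> 0 \<longrightarrow> keys e \<subseteq> A)"

lemma vars_in_mono: "vars_in p A \<Longrightarrow> A \<subseteq> B \<Longrightarrow> vars_in p B"
  by (auto simp: vars_in_def)

lemma vars_in_times [intro]:
  assumes "vars_in p A" "vars_in r A"
  shows "vars_in (p * r) A"
  unfolding vars_in_def
proof (intro allI impI)
  fix e assume "mcoeff (p * r) e \<noteq> 0"
  then obtain \<beta> \<gamma> where "\<beta> + \<gamma> = e" "mcoeff p \<beta> \<noteq> 0" "mcoeff r \<gamma> \<noteq> 0"
    by (rule mcoeff_times_nonzero)
  thus "keys e \<subseteq> A" using assms keys_add[of \<beta> \<gamma>] unfolding vars_in_def by blast
qed

lemma vars_in_add [intro]: "vars_in p A \<Longrightarrow> vars_in r A \<Longrightarrow> vars_in (p + r) A"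
  unfolding vars_in_def by (metis add.left_neutral mcoeff_add)

lemma vars_in_diff [intro]: "vars_in p A \<Longrightarrow> vars_in r A \<Longrightarrow> vars_in (p - r) A"
  unfolding vars_in_def by (metis diff_0_right mcoeff_diff)

lemma vars_in_0 [intro]: "vars_in 0 A"
  by (auto simp: vars_in_def)

lemma vars_in_1 [intro]: "vars_in 1 A"
  by (auto simp: vars_in_def mcoeff_one)

lemma vars_in_mvar [intro]: "a \<in> A \<Longrightarrow> vars_in (mvar a) A"
  by (auto simp: vars_in_def mcoeff_mvar)

lemma vars_in_sum: "(\<And>x. x \<in> X \<Longrightarrow> vars_in (f x) A) \<Longrightarrow> vars_in (\<Sum>x\<in>X. f x) A"
  by (induction X rule: infinite_finite_induct) auto

lemma vars_in_prod: "(\<And>x. x \<in> X \<Longrightarrow> vars_in (f x) A) \<Longrightarrow> vars_in (\<Prod>x\<in>X. f x) A"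
  by (induction X rule: infinite_finite_induct) auto

lemma vars_in_power [intro]: "vars_in p A \<Longrightarrow> vars_in (p ^ n) A"
  by (induction n) auto

definition mdeg :: "('r \<Rightarrow>\<^sub>0 nat) \<Rightarrow> nat" where
  "mdeg \<alpha> = (\<Sum>i\<in>keys \<alpha>. lookup \<alpha> i)"

lemma mdeg_eq_sum: "finite A \<Longrightarrow> keys \<alpha> \<subseteq> A \<Longrightarrow> mdeg \<alpha> = (\<Sum>i\<in>A. lookup \<alpha> i)"
  unfolding mdeg_def by (intro sum.mono_neutral_left) (auto simp: in_keys_iff)

lemma mdeg_add: "mdeg (\<alpha> + \<beta>) = mdeg \<alpha> + mdeg \<beta>"
proof -
  have "finite (keys \<alpha> \<union> keys \<beta>)" by simp
  from mdeg_eq_sum[OF this] show ?thesis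
    using keys_add[of \<alpha> \<beta>] by (simp add: lookup_add sum.distrib)
qed

lemma mdeg_0 [simp]: "mdeg 0 = 0"
  by (simp add: mdeg_def)

lemma mdeg_single [simp]: "mdeg (Poly_Mapping.single a n) = n"
  by (simp add: mdeg_def)

lemma mdeg_eq_0_iff [simp]: "mdeg \<alpha> = 0 \<longleftrightarrow> \<alpha> = 0"
  by (auto simp: mdeg_def in_keys_iff intro!: poly_mapping_eqI)

definition homog :: "nat \<Rightarrow> ('r, 'k::comm_ring_1) mpseries \<Rightarrow> bool" where
  "homog d p \<longleftrightarrow> (\<forall>e. mcoeff p e \<noteq> 0 \<longrightarrow> mdeg e = d)"

lemma homog_times:
  assumes "homog d p" "homog d' r"
  shows "homog (d + d') (p * r)"
  unfolding homog_def
proof (intro allI impI)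
  fix e assume "mcoeff (p * r) e \<noteq> 0"
  then obtain \<beta> \<gamma> where "\<beta> + \<gamma> = e" "mcoeff p \<beta> \<noteq> 0" "mcoeff r \<gamma> \<noteq> 0"
    by (rule mcoeff_times_nonzero)
  thus "mdeg e = d + d'" using assms unfolding homog_def by (auto simp: mdeg_add)
qed

lemma homog_1: "homog 0 1"
  by (auto simp: homog_def mcoeff_one split: if_splits)

lemma homog_power: "homog d p \<Longrightarrow> homog (n * d) (p ^ n)"
  by (induction n) (auto simp: homog_1 homog_times)

lemma homog_prod: "(\<And>x. x \<in> X \<Longrightarrow> homog (d x) (f x)) \<Longrightarrow> homog (\<Sum>x\<in>X. d x) (\<Prod>x\<in>X. f x)"
  by (induction X rule: infinite_finite_induct) (auto simp: homog_1 homog_times)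

lemma homog_mvar_diff: "homog 1 (mvar a - mvar b)"
  by (auto simp: homog_def mcoeff_mvar split: if_splits)

text \<open>The monomial order on \<^typ>\<open>'r \<Rightarrow>\<^sub>0 nat\<close> compares exponents at the smallest label where
  they differ.\<close>

definition lowest :: "('r::linorder, 'k::comm_ring_1) mpseries \<Rightarrow> ('r \<Rightarrow>\<^sub>0 nat) \<Rightarrow> 'k \<Rightarrow> bool" where
  "lowest p k c \<longleftrightarrow> mcoeff p k = c \<and> (\<forall>k'<k. mcoeff p k' = 0)"

text \<open>The order is compatible with addition, so a pair of exponents with sum
  \<open>k + k'\<close> other than \<open>(k, k')\<close> has a component below its bound.\<close>

lemma lowest_times:
  assumes "lowest p k c" "lowest p' k' c'"
  shows "lowest (p * p') (k + k') (c * c')"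
proof -
  have zero: "mcoeff p \<beta> * mcoeff p' \<gamma> = 0" if "\<beta> < k \<or> \<gamma> < k'" for \<beta> \<gamma>
    using that assms by (auto simp: lowest_def)
  have "mcoeff (p * p') (k + k') = (\<Sum>(\<beta>, \<gamma>)\<in>{(k, k')}. mcoeff p \<beta> * mcoeff p' \<gamma>)"
    unfolding mcoeff_times
  proof (rule sum.mono_neutral_right)
    show "\<forall>x\<in>splits (k + k') - {(k, k')}. (case x of (\<beta>, \<gamma>) \<Rightarrow> mcoeff p \<beta> * mcoeff p' \<gamma>) = 0"
    proof safe
      fix \<beta> \<gamma> assume *: "(\<beta>, \<gamma>) \<in> splits (k + k')" "mcoeff p \<beta> * mcoeff p' \<gamma> \<noteq> 0"
      hence sum: "\<beta> + \<gamma> = k + k'" and ge: "\<beta> \<ge> k" "\<gamma> \<ge> k'"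
        using * assms unfolding lowest_def splits_iff
        by (simp, metis mult_zero_left not_le, metis mult_zero_right not_le)
      have "\<not> \<beta> > k" using sum ge by (metis add_less_le_mono less_irrefl)
      hence "\<beta> = k" using ge by simp
      thus "\<beta> = k" .
      show "\<gamma> = k'" using sum \<open>\<beta> = k\<close> by simp
    qed
  qed auto
  moreover have "mcoeff (p * p') j = 0" if "j < k + k'" for j
  proof (rule ccontr)
    assume "mcoeff (p * p') j \<noteq> 0"
    then obtain \<beta> \<gamma> where *: "\<beta> + \<gamma> = j" "mcoeff p \<beta> \<noteq> 0" "mcoeff p' \<gamma> \<noteq> 0"
      by (rule mcoeff_times_nonzero)
    hence "\<beta> \<ge> k" "\<gamma> \<ge> k'" using assms unfolding lowest_def by (metis not_le)+
    hence "j \<ge> k + k'" using * add_mono by blast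
    thus False using that by simp
  qed
  ultimately show ?thesis using assms by (auto simp: lowest_def)
qed

lemma lowest_1: "lowest 1 0 1"
proof -
  have "\<not> k < 0" for k :: "'a \<Rightarrow>\<^sub>0 nat"
    by (auto simp: less_poly_mapping.rep_eq less_fun_def)
  thus ?thesis by (simp add: lowest_def mcoeff_one)
qed

lemma lowest_prod:
  "finite X \<Longrightarrow> (\<And>x. x \<in> X \<Longrightarrow> lowest (f x) (k x) (c x)) \<Longrightarrow>
     lowest (\<Prod>x\<in>X. f x) (\<Sum>x\<in>X. k x) (\<Prod>x\<in>X. c x)"
  by (induction X rule: finite_induct) (auto simp: lowest_1 lowest_times)

lemma single_less_single:
  assumes "s < t"
  shows "Poly_Mapping.single t (1::nat) < Poly_Mapping.single s 1"
  unfolding less_poly_mapping.rep_eq less_fun_def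
  using assms by (intro exI[of _ s]) (auto simp: lookup_single when_def)

text \<open>Variables with larger labels are smaller monomials in this order, so the lowest term
  carries the larger label.\<close>

lemma lowest_mvar_diff:
  assumes "s < t"
  shows "lowest (mvar s - mvar t) (Poly_Mapping.single t 1) (-1)"
    and "lowest (mvar t - mvar s) (Poly_Mapping.single t 1) 1"
  using single_less_single[OF assms] assms
  by (auto simp: lowest_def mcoeff_mvar split: if_splits)

lemma lowest_power:
  assumes "lowest p (Poly_Mapping.single t 1) c"
  shows "lowest (p ^ n) (Poly_Mapping.single t n) (c ^ n)"
proof (induction n)
  case 0
  then show ?case by (simp add: lowest_1)
next
  case (Suc n)
  have "Poly_Mapping.single t (Suc n) = Poly_Mapping.single t 1 + Poly_Mapping.single t n"
    by (simp flip: single_add)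
  then show ?case using lowest_times[OF assms Suc] by (simp)
qed

section \<open>Renaming of variables\<close>

definition rename :: "('r \<Rightarrow> 'r) \<Rightarrow> ('r, 'k::comm_ring_1) mpseries \<Rightarrow> ('r, 'k) mpseries" where
  "rename \<pi> p = Abs_mpseries (\<lambda>e. mcoeff p (Poly_Mapping.map_key \<pi> e))"

lemma mcoeff_rename [simp]: "mcoeff (rename \<pi> p) e = mcoeff p (Poly_Mapping.map_key \<pi> e)"
  by (simp add: rename_def)

lemma lookup_map_key: "inj \<pi> \<Longrightarrow> lookup (Poly_Mapping.map_key \<pi> e) a = lookup e (\<pi> a)"
  by (simp add: map_key.rep_eq)

lemma map_key_add: "inj \<pi> \<Longrightarrow>
    Poly_Mapping.map_key \<pi> (\<alpha> + \<beta>) = Poly_Mapping.map_key \<pi> \<alpha> + Poly_Mapping.map_key \<pi> \<beta>"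
  by (intro poly_mapping_eqI) (simp add: lookup_map_key lookup_add)

lemma map_key_inv:
  fixes e :: "'a \<Rightarrow>\<^sub>0 nat"
  assumes "bij \<pi>"
  shows "Poly_Mapping.map_key \<pi> (Poly_Mapping.map_key (inv \<pi>) e) = e"
    and "Poly_Mapping.map_key (inv \<pi>) (Poly_Mapping.map_key \<pi> e) = e"
  using assms bij_imp_bij_inv[OF assms]
  by (auto intro!: poly_mapping_eqI simp: lookup_map_key bij_is_inj bij_is_surj surj_f_inv_f)

lemma rename_times:
  fixes p r :: "('a, 'k::comm_ring_1) mpseries"
  assumes "bij \<pi>"
  shows "rename \<pi> (p * r) = rename \<pi> p * rename \<pi> r"
proof (rule mpseries_eqI)
  fix e
  have inj: "inj \<pi>" "inj (inv \<pi>)"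
    using assms bij_imp_bij_inv[OF assms] by (auto simp: bij_is_inj)
  let ?m = "Poly_Mapping.map_key \<pi>" and ?m' = "Poly_Mapping.map_key (inv \<pi>)"
  show "mcoeff (rename \<pi> (p * r)) e = mcoeff (rename \<pi> p * rename \<pi> r) e"
    unfolding mcoeff_rename mcoeff_times
    by (rule sum.reindex_bij_witness[where j = "\<lambda>(\<beta>, \<gamma>). (?m' \<beta>, ?m' \<gamma>)"
          and i = "\<lambda>(\<beta>, \<gamma>). (?m \<beta>, ?m \<gamma>)"])
       (auto simp: map_key_inv[OF assms] map_key_add[OF inj(1)]
          map_key_add[OF inj(2), symmetric])
qed

lemma rename_1: "bij \<pi> \<Longrightarrow> rename \<pi> 1 = 1"
proof (rule mpseries_eqI)
  fix e :: "'a \<Rightarrow>\<^sub>0 nat" assume "bij \<pi>"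
  hence "Poly_Mapping.map_key \<pi> e = 0 \<longleftrightarrow> e = 0"
    using map_key_inv(2)[of \<pi> e] by (auto simp: poly_mapping_eq_iff fun_eq_iff map_key.rep_eq bij_is_inj bij_is_surj bij_imp_bij_inv)
  thus "mcoeff (rename \<pi> 1) e = mcoeff 1 e" by (simp add: mcoeff_one)
qed

lemma rename_add: "rename \<pi> (p + r) = rename \<pi> p + rename \<pi> r"
  by (rule mpseries_eqI) simp

lemma rename_diff: "rename \<pi> (p - r) = rename \<pi> p - rename \<pi> r"
  by (rule mpseries_eqI) simp

lemma rename_0: "rename \<pi> 0 = 0"
  by (rule mpseries_eqI) simp

lemma rename_power: "bij \<pi> \<Longrightarrow> rename \<pi> (p ^ n) = rename \<pi> p ^ n"
  by (induction n) (auto simp: rename_1 rename_times)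

lemma rename_sum: "rename \<pi> (\<Sum>x\<in>X. f x) = (\<Sum>x\<in>X. rename \<pi> (f x))"
  by (induction X rule: infinite_finite_induct) (auto simp: rename_0 rename_add)

lemma rename_prod: "bij \<pi> \<Longrightarrow> rename \<pi> (\<Prod>x\<in>X. f x) = (\<Prod>x\<in>X. rename \<pi> (f x))"
  by (induction X rule: infinite_finite_induct) (auto simp: rename_1 rename_times)

lemma rename_mvar:
  assumes "bij \<pi>"
  shows "rename \<pi> (mvar a) = mvar (\<pi> a)"
proof (rule mpseries_eqI)
  fix e :: "'a \<Rightarrow>\<^sub>0 nat"
  have inj: "inj \<pi>" using assms by (simp add: bij_is_inj)
  have "Poly_Mapping.map_key \<pi> (Poly_Mapping.single (\<pi> a) 1) = Poly_Mapping.single a (1::nat)"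
    using inj by (intro poly_mapping_eqI) (auto simp: lookup_map_key lookup_single when_def inj_eq)
  moreover have "Poly_Mapping.map_key \<pi> e = Poly_Mapping.map_key \<pi> e' \<Longrightarrow> e = e'" for e' :: "'a \<Rightarrow>\<^sub>0 nat"
    using map_key_inv(2)[OF assms] by metis
  ultimately have "Poly_Mapping.map_key \<pi> e = Poly_Mapping.single a 1
      \<longleftrightarrow> e = Poly_Mapping.single (\<pi> a) 1" by metis
  thus "mcoeff (rename \<pi> (mvar a)) e = mcoeff (mvar (\<pi> a)) e"
    by (simp add: mcoeff_mvar)
qed

section \<open>Euler operators, partial derivatives and translation\<close>

definition euler :: "'r \<Rightarrow> ('r, 'k::comm_ring_1) mpseries \<Rightarrow> ('r, 'k) mpseries" where
  "euler i f = Abs_mpseries (\<lambda>\<alpha>. of_nat (lookup \<alpha> i) * mcoeff f \<alpha>)"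

lemma mcoeff_euler [simp]: "mcoeff (euler i f) \<alpha> = of_nat (lookup \<alpha> i) * mcoeff f \<alpha>"
  by (simp add: euler_def)

lemma euler_times: "euler i (f * g) = euler i f * g + f * euler i g"
proof (rule mpseries_eqI)
  fix \<alpha>
  have "mcoeff (euler i (f * g)) \<alpha>
      = (\<Sum>(\<beta>, \<gamma>)\<in>splits \<alpha>. of_nat (lookup \<alpha> i) * (mcoeff f \<beta> * mcoeff g \<gamma>))"
    by (simp add: mcoeff_times sum_distrib_left case_prod_unfold)
  also have "\<dots> = (\<Sum>(\<beta>, \<gamma>)\<in>splits \<alpha>. mcoeff (euler i f) \<beta> * mcoeff g \<gamma>
                      + mcoeff f \<beta> * mcoeff (euler i g) \<gamma>)"
    by (intro sum.cong) (auto simp: lookup_add algebra_simps)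
  also have "\<dots> = mcoeff (euler i f * g + f * euler i g) \<alpha>"
    by (simp add: mcoeff_times sum.distrib case_prod_unfold)
  finally show "mcoeff (euler i (f * g)) \<alpha> = mcoeff (euler i f * g + f * euler i g) \<alpha>" .
qed

definition pderivative :: "'r \<Rightarrow> ('r, 'k::comm_ring_1) mpseries \<Rightarrow> ('r, 'k) mpseries" where
  "pderivative a p =
     Abs_mpseries (\<lambda>e. of_nat (Suc (lookup e a)) * mcoeff p (e + Poly_Mapping.single a 1))"

lemma mcoeff_pderivative [simp]:
  "mcoeff (pderivative a p) e = of_nat (Suc (lookup e a)) * mcoeff p (e + Poly_Mapping.single a 1)"
  by (simp add: pderivative_def)

lemma mvar_times_pderivative: "mvar a * pderivative a p = euler a p"
proof (rule mpseries_eqI)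
  fix e :: "'a \<Rightarrow>\<^sub>0 nat"
  have "e - Poly_Mapping.single a 1 + Poly_Mapping.single a 1 = e" if "lookup e a \<noteq> 0"
    using that by (intro poly_mapping_eqI) (auto simp: lookup_add lookup_minus lookup_single when_def)
  thus "mcoeff (mvar a * pderivative a p) e = mcoeff (euler a p) e"
    by (auto simp: mcoeff_mvar_times lookup_minus simp flip: of_nat_Suc)
qed

text \<open>The Euler operator is a derivation and equals \<open>mvar a\<close> times the partial
  derivative, so the product rule follows by cancelling \<open>mvar a\<close>.\<close>

lemma pderivative_times: "pderivative a (p * r) = pderivative a p * r + p * pderivative a r"
  by (rule mvar_times_cancel[of a])
     (simp add: mvar_times_pderivative euler_times distrib_left flip: mult.assoc,
      simp add: mult.left_commute[of _ p] mult.assoc mvar_times_pderivative mult.commute)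

lemma pderivative_diff: "pderivative a (p - r) = pderivative a p - pderivative a r"
  by (rule mpseries_eqI) (simp add: algebra_simps)

lemma pderivative_sum: "pderivative a (\<Sum>x\<in>X. f x) = (\<Sum>x\<in>X. pderivative a (f x))"
  by (rule mpseries_eqI) (simp add: mcoeff_sum sum_distrib_left)

lemma pderivative_mvar: "pderivative a (mvar b) = (if a = b then 1 else 0)"
proof (rule mpseries_eqI)
  fix e :: "'a \<Rightarrow>\<^sub>0 nat"
  have "e + Poly_Mapping.single a 1 = Poly_Mapping.single b 1 \<longleftrightarrow> a = b \<and> e = 0"
  proof
    assume *: "e + Poly_Mapping.single a 1 = Poly_Mapping.single b 1"
    have "lookup (e + Poly_Mapping.single a 1) a = lookup (Poly_Mapping.single b 1) a"
      using * by simp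
    hence "a = b" by (auto simp: lookup_add lookup_single when_def split: if_splits)
    thus "a = b \<and> e = 0" using * by simp
  qed auto
  thus "mcoeff (pderivative a (mvar b)) e = mcoeff (if a = b then 1 else 0) e"
    by (auto simp: mcoeff_mvar mcoeff_one)
qed

lemma pderivative_eq_0:
  assumes "vars_in p A" "a \<notin> A"
  shows "pderivative a p = 0"
proof (rule mpseries_eqI)
  fix e :: "'a \<Rightarrow>\<^sub>0 nat"
  have "a \<in> keys (e + Poly_Mapping.single a 1)" by (simp add: in_keys_iff lookup_add)
  hence "mcoeff p (e + Poly_Mapping.single a 1) = 0"
    using assms unfolding vars_in_def by blast
  thus "mcoeff (pderivative a p) e = mcoeff 0 e" by simp
qed

text \<open>The infinitesimal simultaneous translation of the variables in \<open>A\<close>. It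
  annihilates differences of such variables, hence the kernels below.\<close>

definition translation :: "'r set \<Rightarrow> ('r, 'k::comm_ring_1) mpseries \<Rightarrow> ('r, 'k) mpseries" where
  "translation A p = (\<Sum>a\<in>A. pderivative a p)"

lemma translation_times: "translation A (p * r) = translation A p * r + p * translation A r"
  by (simp add: translation_def pderivative_times sum.distrib sum_distrib_left sum_distrib_right)

lemma translation_sum: "translation A (\<Sum>x\<in>X. f x) = (\<Sum>x\<in>X. translation A (f x))"
  unfolding translation_def pderivative_sum by (rule sum.swap)

lemma translation_mvar: "finite A \<Longrightarrow> a \<in> A \<Longrightarrow> translation A (mvar a) = 1"
  by (simp add: translation_def pderivative_mvar)

lemma translation_mvar_diff: "finite A \<Longrightarrow> a \<in> A \<Longrightarrow> b \<in> A \<Longrightarrow> translation A (mvar a - mvar b) = 0"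
  by (simp add: translation_def pderivative_mvar pderivative_diff sum_subtractf)

lemma translation_1: "translation A 1 = 0"
  using translation_times[of A 1 1] by simp

lemma translation_power_eq_0: "translation A p = 0 \<Longrightarrow> translation A (p ^ n) = 0"
  by (induction n) (auto simp: translation_1 translation_times)

lemma translation_prod_eq_0:
  "(\<And>x. x \<in> X \<Longrightarrow> translation A (f x) = 0) \<Longrightarrow> translation A (\<Prod>x\<in>X. f x) = 0"
  by (induction X rule: infinite_finite_induct) (auto simp: translation_1 translation_times)

lemma translation_eq_on_vars:
  assumes "vars_in p S" "S \<subseteq> A" "finite A"
  shows "translation A p = translation S p"
  unfolding translation_def
  using assms by (intro sum.mono_neutral_right) (auto simp: pderivative_eq_0)

section \<open>A commutative algebra of symmetric polynomials in coloured variables\<close>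

text \<open>A function on finite multisets of letters (colour, exponent) stands for the symmetric
  polynomials \<open>realize \<phi> c A\<close> in the variables \<open>A\<close> coloured by \<open>c\<close>, one for each finite
  coloured set of labels.\<close>

definition letters :: "(nat \<Rightarrow> 'v) \<Rightarrow> nat set \<Rightarrow> (nat \<Rightarrow>\<^sub>0 nat) \<Rightarrow> ('v \<times> nat) multiset" where
  "letters c A e = image_mset (\<lambda>a. (c a, lookup e a)) (mset_set A)"

definition realize ::
    "(('v \<times> nat) multiset \<Rightarrow> rat) \<Rightarrow> (nat \<Rightarrow> 'v) \<Rightarrow> nat set \<Rightarrow> (nat, rat) mpseries" where
  "realize \<phi> c A = Abs_mpseries (\<lambda>e. if keys e \<subseteq> A then \<phi> (letters c A e) else 0)"

lemma mcoeff_realize: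
  "mcoeff (realize \<phi> c A) e = (if keys e \<subseteq> A then \<phi> (letters c A e) else 0)"
  by (simp add: realize_def)

lemma letters_cong:
  assumes "\<And>a. a \<in> A \<Longrightarrow> c a = c' a" "\<And>a. a \<in> A \<Longrightarrow> lookup e a = lookup e' a"
  shows "letters c A e = letters c' A e'"
  unfolding letters_def
  by (cases "finite A") (auto intro!: image_mset_cong simp: assms)

lemma realize_cong:
  assumes "\<And>a. a \<in> A \<Longrightarrow> c a = c' a"
  shows "realize \<phi> c A = realize \<phi> c' A"
  by (rule mpseries_eqI) (simp add: mcoeff_realize letters_cong[OF assms])

lemma vars_in_realize: "vars_in (realize \<phi> c A) A"
  by (auto simp: vars_in_def mcoeff_realize split: if_splits)

text \<open>List the multiset and use positions as labels. Identities between functions on multisets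
  can therefore be checked on their realizations.\<close>

lemma letters_exists:
  obtains c A e where "finite A" "keys e \<subseteq> A" "letters c A e = M"
proof -
  obtain xs where xs: "mset xs = M" using ex_mset by blast
  define c where "c = (\<lambda>k. fst (xs ! k))"
  define e where "e = Poly_Mapping.nth (map snd xs)"
  have look: "lookup e k = (if k < length xs then snd (xs ! k) else 0)" for k
    by (simp add: e_def nth.rep_eq nth_default_def)
  have "letters c {..<length xs} e = image_mset (\<lambda>k. xs ! k) (mset_set {..<length xs})"
    unfolding letters_def by (rule image_mset_cong) (auto simp: look c_def)
  also have "\<dots> = mset (map (\<lambda>k. xs ! k) [0..<length xs])"
    by (simp only: mset_map mset_upt atLeast0LessThan)
  also have "map (\<lambda>k. xs ! k) [0..<length xs] = xs" by (rule map_nth)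
  finally have "letters c {..<length xs} e = M" using xs by simp
  moreover have "keys e \<subseteq> {..<length xs}" by (auto simp: in_keys_iff look split: if_splits)
  ultimately show ?thesis using that[of "{..<length xs}" e c] by blast
qed

lemma realize_inject:
  assumes "\<And>c A. finite A \<Longrightarrow> realize \<phi> c A = realize \<psi> c A"
  shows "\<phi> = \<psi>"
proof
  fix M :: "('a \<times> nat) multiset"
  obtain c A e where "finite A" "keys e \<subseteq> A" "letters c A e = M" by (rule letters_exists)
  thus "\<phi> M = \<psi> M" using assms[of A c] by (metis mcoeff_realize)
qed

lemma realize_add: "realize (\<phi> + \<psi>) c A = realize \<phi> c A + realize \<psi> c A"
  by (rule mpseries_eqI) (simp add: mcoeff_realize)

definition fscale :: "rat \<Rightarrow> ('x \<Rightarrow> rat) \<Rightarrow> 'x \<Rightarrow> rat" where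
  "fscale r \<phi> = (\<lambda>x. r * \<phi> x)"

lemma realize_scale: "realize (fscale r \<phi>) c A = mscale r (realize \<phi> c A)"
  by (rule mpseries_eqI) (simp add: mcoeff_realize fscale_def)

lemma image_mset_eq_imp_bij:
  assumes "finite A" "finite B" "image_mset f (mset_set A) = image_mset g (mset_set B)"
  shows "\<exists>h. bij_betw h A B \<and> (\<forall>a\<in>A. f a = g (h a))"
  using assms
proof (induction A arbitrary: B rule: finite_induct)
  case empty
  hence "B = {}" by (auto simp: mset_set_empty_iff)
  thus ?case by (auto simp: bij_betw_def)
next
  case (insert x A)
  have "f x \<in># image_mset g (mset_set B)" using insert.hyps by (simp flip: insert.prems(2))
  then obtain b where b: "b \<in> B" "f x = g b" using insert.prems(1) by auto
  have "B = insert b (B - {b})" using b by auto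
  hence "mset_set B = add_mset b (mset_set (B - {b}))"
    using insert.prems(1) b by (simp add: mset_set.remove)
  hence "image_mset f (mset_set A) = image_mset g (mset_set (B - {b}))"
    using insert.prems(2) insert.hyps b by simp
  with insert.IH[of "B - {b}"] insert.prems(1) obtain h where
    h: "bij_betw h A (B - {b})" "\<forall>a\<in>A. f a = g (h a)" by auto
  have *: "bij_betw (h(x := b)) A (B - {b})"
    using h(1) insert.hyps by (subst bij_betw_cong[where g = h]) auto
  have "bij_betw (h(x := b)) ({x} \<union> A) ({b} \<union> (B - {b}))"
    using insert.hyps b by (intro bij_betw_combine *) auto
  hence "bij_betw (h(x := b)) (insert x A) B" using b by (simp add: insert_absorb)
  moreover have "\<forall>a\<in>insert x A. f a = g ((h(x := b)) a)" using h b by auto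
  ultimately show ?case by blast
qed

text \<open>Renaming is multiplicative only for permutations of all labels. The sets
  \<open>B - A\<close> and \<open>A - B\<close> have the same size, so one is sent to the other, and
  labels outside both sets are fixed.\<close>

lemma bij_betw_extend_bij:
  fixes A B :: "'a set"
  assumes "finite A" "finite B" "bij_betw h A B"
  shows "\<exists>\<pi>. bij \<pi> \<and> (\<forall>a\<in>A. \<pi> a = h a)"
proof -
  have "card A = card B" using assms(3) by (rule bij_betw_same_card)
  hence "card (B - A) = card (A - B)"
    using assms card_Diff_subset_Int[of B A] card_Diff_subset_Int[of A B]
    by (simp add: Int_commute)
  then obtain g where g: "bij_betw g (B - A) (A - B)"
    using assms finite_same_card_bij[of "B - A" "A - B"] by auto
  define \<pi> where "\<pi> = (\<lambda>x. if x \<in> A then h x else if x \<in> B then g x else x)"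
  have 1: "bij_betw \<pi> A B"
    using assms(3) by (subst bij_betw_cong[where g = h]) (auto simp: \<pi>_def)
  have 2: "bij_betw \<pi> (B - A) (A - B)"
    using g by (subst bij_betw_cong[where g = g]) (auto simp: \<pi>_def)
  have 3: "bij_betw \<pi> (- (A \<union> B)) (- (A \<union> B))"
    by (subst bij_betw_cong[where g = "\<lambda>x. x"]) (auto simp: \<pi>_def bij_betw_def)
  have "bij_betw \<pi> (A \<union> (B - A)) (B \<union> (A - B))"
    by (rule bij_betw_combine[OF 1 2]) auto
  hence "bij_betw \<pi> (A \<union> B) (A \<union> B)" by (simp add: Un_commute)
  from bij_betw_combine[OF this 3] have "bij \<pi>" by (simp only: Compl_partition Compl_disjoint)
  thus ?thesis by (intro exI[of _ \<pi>]) (auto simp: \<pi>_def)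
qed

lemma letters_image:
  assumes "bij \<pi>"
  shows "letters c (\<pi> ` A) e = letters (c \<circ> \<pi>) A (Poly_Mapping.map_key \<pi> e)"
proof -
  have inj: "inj \<pi>" using assms by (rule bij_is_inj)
  hence "mset_set (\<pi> ` A) = image_mset \<pi> (mset_set A)"
    by (metis image_mset_mset_set inj_on_subset subset_UNIV)
  thus ?thesis
    using inj by (simp add: letters_def multiset.map_comp comp_def lookup_map_key)
qed

text \<open>A realization depends on labels only through colours and exponents. For permutations
  that preserve \<open>A\<close> and the colours this is the symmetry in variables of equal
  colour.\<close>

lemma rename_realize:
  assumes "bij \<pi>"
  shows "rename \<pi> (realize \<phi> (c \<circ> \<pi>) A) = realize \<phi> c (\<pi> ` A)"
proof (rule mpseries_eqI)
  fix e :: "nat \<Rightarrow>\<^sub>0 nat"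
  have inj: "inj \<pi>" using assms by (rule bij_is_inj)
  have "keys (Poly_Mapping.map_key \<pi> e) \<subseteq> A \<longleftrightarrow> keys e \<subseteq> \<pi> ` A"
  proof
    assume *: "keys (Poly_Mapping.map_key \<pi> e) \<subseteq> A"
    show "keys e \<subseteq> \<pi> ` A"
    proof
      fix x assume "x \<in> keys e"
      moreover obtain y where "x = \<pi> y" using assms by (metis bij_pointE)
      ultimately have "y \<in> keys (Poly_Mapping.map_key \<pi> e)"
        using inj by (simp add: in_keys_iff lookup_map_key)
      thus "x \<in> \<pi> ` A" using * \<open>x = \<pi> y\<close> by auto
    qed
  next
    assume *: "keys e \<subseteq> \<pi> ` A"
    show "keys (Poly_Mapping.map_key \<pi> e) \<subseteq> A"
    proof
      fix y assume "y \<in> keys (Poly_Mapping.map_key \<pi> e)"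
      hence "\<pi> y \<in> keys e" using inj by (simp add: in_keys_iff lookup_map_key)
      hence "\<pi> y \<in> \<pi> ` A" using * by auto
      thus "y \<in> A" using inj by (simp add: inj_image_mem_iff)
    qed
  qed
  thus "mcoeff (rename \<pi> (realize \<phi> (c \<circ> \<pi>) A)) e = mcoeff (realize \<phi> c (\<pi> ` A)) e"
    by (simp add: mcoeff_realize letters_image[OF assms])
qed

text \<open>Multiplication of all realizations by the sum of their variables, see
  \<open>realize_raise_deg\<close>. Equal letters count with multiplicity because that sum runs over
  labels.\<close>

definition raise_deg :: "(('v \<times> nat) multiset \<Rightarrow> rat) \<Rightarrow> ('v \<times> nat) multiset \<Rightarrow> rat" where
  "raise_deg \<phi> M =
     (\<Sum>l\<in>#M. if snd l = 0 then 0 else \<phi> (add_mset (fst l, snd l - 1) (M - {#l#})))"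

text \<open>The translation operator on all realizations, see \<open>realize_lower_deg\<close>; the
  factor \<open>Suc (snd l)\<close> comes from differentiating a power.\<close>

definition lower_deg :: "(('v \<times> nat) multiset \<Rightarrow> rat) \<Rightarrow> ('v \<times> nat) multiset \<Rightarrow> rat" where
  "lower_deg \<phi> M =
     (\<Sum>l\<in>#M. of_nat (Suc (snd l)) * \<phi> (add_mset (fst l, Suc (snd l)) (M - {#l#})))"

lemma letters_update:
  assumes "finite A" "a \<in> A" "\<And>b. b \<noteq> a \<Longrightarrow> lookup e' b = lookup e b"
  shows "letters c A e' = add_mset (c a, lookup e' a) (letters c A e - {#(c a, lookup e a)#})"
proof -
  have A: "mset_set A = add_mset a (mset_set (A - {a}))"
    using assms by (metis mset_set.remove)
  have "letters c (A - {a}) e' = letters c (A - {a}) e"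
    by (rule letters_cong) (auto simp: assms)
  moreover have "letters c A e'' = add_mset (c a, lookup e'' a) (letters c (A - {a}) e'')" for e''
    unfolding letters_def A by simp
  ultimately show ?thesis by simp
qed

lemma sum_mset_letters: "(\<Sum>l\<in>#letters c A e. g l) = (\<Sum>a\<in>A. g (c a, lookup e a))"
  by (simp add: letters_def multiset.map_comp comp_def sum_unfold_sum_mset)

lemma realize_raise_deg:
  assumes "finite A"
  shows "realize (raise_deg \<phi>) c A = (\<Sum>a\<in>A. mvar a) * realize \<phi> c A"
proof (rule mpseries_eqI)
  fix e :: "nat \<Rightarrow>\<^sub>0 nat"
  have rhs: "mcoeff ((\<Sum>a\<in>A. mvar a) * realize \<phi> c A) e =
    (\<Sum>a\<in>A. if lookup e a = 0 then 0
      else mcoeff (realize \<phi> c A) (e - Poly_Mapping.single a 1))"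
    by (simp add: sum_distrib_right mcoeff_sum mcoeff_mvar_times)
  show "mcoeff (realize (raise_deg \<phi>) c A) e = mcoeff ((\<Sum>a\<in>A. mvar a) * realize \<phi> c A) e"
  proof (cases "keys e \<subseteq> A")
    case True
    have "mcoeff (realize (raise_deg \<phi>) c A) e = (\<Sum>a\<in>A. if lookup e a = 0 then 0
       else \<phi> (add_mset (c a, lookup e a - 1) (letters c A e - {#(c a, lookup e a)#})))"
      using True by (simp add: mcoeff_realize raise_deg_def sum_mset_letters cong: if_cong)
    also have "\<dots> = (\<Sum>a\<in>A. if lookup e a = 0 then 0
      else mcoeff (realize \<phi> c A) (e - Poly_Mapping.single a 1))"
    proof (rule sum.cong)
      fix a assume a: "a \<in> A"
      let ?e = "e - Poly_Mapping.single a 1"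
      have "letters c A ?e = add_mset (c a, lookup ?e a) (letters c A e - {#(c a, lookup e a)#})"
        using assms a by (intro letters_update) (auto simp: lookup_minus lookup_single)
      moreover have "keys ?e \<subseteq> A"
        using True by (auto simp: in_keys_iff lookup_minus subset_iff)
      ultimately show "(if lookup e a = 0 then 0
           else \<phi> (add_mset (c a, lookup e a - 1) (letters c A e - {#(c a, lookup e a)#}))) =
         (if lookup e a = 0 then 0 else mcoeff (realize \<phi> c A) ?e)"
        by (simp add: mcoeff_realize lookup_minus)
    qed simp
    finally show ?thesis using rhs by simp
  next
    case False
    then obtain b where b: "b \<in> keys e" "b \<notin> A" by auto
    have "mcoeff (realize \<phi> c A) (e - Poly_Mapping.single a 1) = 0" if "a \<in> A" for a
    proof -
      have "b \<in> keys (e - Poly_Mapping.single a 1)"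
        using b that by (cases "a = b") (auto simp: in_keys_iff lookup_minus lookup_single)
      thus ?thesis using b by (auto simp: mcoeff_realize)
    qed
    thus ?thesis using False rhs by (simp add: mcoeff_realize cong: if_cong)
  qed
qed

lemma realize_lower_deg:
  assumes "finite A"
  shows "realize (lower_deg \<phi>) c A = translation A (realize \<phi> c A)"
proof (rule mpseries_eqI)
  fix e :: "nat \<Rightarrow>\<^sub>0 nat"
  have rhs: "mcoeff (translation A (realize \<phi> c A)) e = (\<Sum>a\<in>A. of_nat (Suc (lookup e a)) *
      mcoeff (realize \<phi> c A) (e + Poly_Mapping.single a 1))"
    by (simp add: translation_def mcoeff_sum)
  show "mcoeff (realize (lower_deg \<phi>) c A) e = mcoeff (translation A (realize \<phi> c A)) e"
  proof (cases "keys e \<subseteq> A")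
    case True
    have "mcoeff (realize (lower_deg \<phi>) c A) e = (\<Sum>a\<in>A. of_nat (Suc (lookup e a)) *
       \<phi> (add_mset (c a, Suc (lookup e a)) (letters c A e - {#(c a, lookup e a)#})))"
      using True by (simp add: mcoeff_realize lower_deg_def sum_mset_letters)
    also have "\<dots> = (\<Sum>a\<in>A. of_nat (Suc (lookup e a)) *
       mcoeff (realize \<phi> c A) (e + Poly_Mapping.single a 1))"
    proof (rule sum.cong)
      fix a assume a: "a \<in> A"
      let ?e = "e + Poly_Mapping.single a 1"
      have "letters c A ?e = add_mset (c a, lookup ?e a) (letters c A e - {#(c a, lookup e a)#})"
        using assms a by (intro letters_update) (auto simp: lookup_add lookup_single)
      moreover have "keys ?e \<subseteq> A"
        using True a keys_add[of e "Poly_Mapping.single a 1"] by auto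
      ultimately show "of_nat (Suc (lookup e a)) *
           \<phi> (add_mset (c a, Suc (lookup e a)) (letters c A e - {#(c a, lookup e a)#})) =
         of_nat (Suc (lookup e a)) * mcoeff (realize \<phi> c A) ?e"
        by (simp add: mcoeff_realize lookup_add)
    qed simp
    finally show ?thesis using rhs by simp
  next
    case False
    have "\<not> keys (e + Poly_Mapping.single a 1) \<subseteq> A" for a
      using False by (auto simp: in_keys_iff lookup_add subset_iff)
    thus ?thesis using False rhs by (simp add: mcoeff_realize)
  qed
qed

lemma size_letters: "size (letters c A e) = card A"
  by (simp add: letters_def)

text \<open>Translation is a derivation that sends the sum of the variables to their number, and
  that number is the size of the multiset: a Heisenberg relation on each component of fixed
  size.\<close>

lemma lower_raise_commutator:
  "lower_deg (raise_deg \<phi>) M = raise_deg (lower_deg \<phi>) M + of_nat (size M) * \<phi> M"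
proof -
  obtain c A e where A: "finite A" "keys e \<subseteq> A" "letters c A e = M" by (rule letters_exists)
  have "realize (lower_deg (raise_deg \<phi>)) c A =
      translation A (\<Sum>a\<in>A. mvar a) * realize \<phi> c A + realize (raise_deg (lower_deg \<phi>)) c A"
    using A(1) by (simp add: realize_lower_deg realize_raise_deg translation_times)
  also have "translation A (\<Sum>a\<in>A. mvar a) = (of_nat (card A) :: (nat, rat) mpseries)"
    using A(1) by (simp add: translation_sum translation_mvar)
  finally have *: "realize (lower_deg (raise_deg \<phi>)) c A =
     of_nat (card A) * realize \<phi> c A + realize (raise_deg (lower_deg \<phi>)) c A" .
  have of_nat: "mcoeff (of_nat n * p) e = of_nat n * mcoeff p e"
    for n and p :: "(nat, rat) mpseries"
  proof (induction n)
    case (Suc n)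
    have "of_nat (Suc n) * p = p + of_nat n * p" by (simp add: distrib_right)
    then show ?case using Suc by (simp only: mcoeff_add of_nat_Suc distrib_right mult_1)
  qed simp
  have "mcoeff (realize (lower_deg (raise_deg \<phi>)) c A) e =
      of_nat (card A) * mcoeff (realize \<phi> c A) e + mcoeff (realize (raise_deg (lower_deg \<phi>)) c A) e"
    unfolding * by (simp only: mcoeff_add of_nat)
  moreover have "mcoeff (realize \<psi> c A) e = \<psi> M" for \<psi>
    using A by (simp add: mcoeff_realize)
  moreover have "card A = size M" using A(3) by (metis size_letters)
  ultimately show ?thesis by (simp only: add.commute)
qed

text \<open>In the application \<open>m\<close> is the polarisation of the quadratic form, whose
  diagonal is twice the form. Evenness makes a power of \<open>x - y\<close> with exponent
  \<open>m i i\<close> symmetric in two variables of colour \<open>i\<close>.\<close>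

locale link =
  fixes m :: "'v::linorder \<Rightarrow> 'v \<Rightarrow> nat"
  assumes m_sym: "m i j = m j i"
    and m_even: "even (m i i)"
begin

text \<open>Ordering the two variables by colour makes the kernel independent of the order of its
  arguments even for odd exponents; this is what makes the product below commutative.\<close>

definition kernel1 :: "(nat \<Rightarrow> 'v) \<Rightarrow> nat \<Rightarrow> nat \<Rightarrow> (nat, rat) mpseries" where
  "kernel1 c s t = (if c s \<le> c t then mvar s - mvar t else mvar t - mvar s) ^ m (c s) (c t)"

definition kernel :: "(nat \<Rightarrow> 'v) \<Rightarrow> nat set \<Rightarrow> nat set \<Rightarrow> (nat, rat) mpseries" where
  "kernel c S T = (\<Prod>s\<in>S. \<Prod>t\<in>T. kernel1 c s t)"

text \<open>A shuffle product of the kind known from cohomological Hall algebras of quivers; the sum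
  over all subsets of labels takes the place of a symmetrization.\<close>

definition conv where
  "conv \<phi> \<psi> c A =
     (\<Sum>S\<in>Pow A. realize \<phi> c S * realize \<psi> c (A - S) * kernel c S (A - S))"

text \<open>The value is computed from a labelling of \<open>M\<close>. By
  \<open>mcoeff_conv_cong\<close> it is the same for all labellings, so the description denotes and
  \<open>realize_star\<close> holds.\<close>

definition star ::
    "(('v \<times> nat) multiset \<Rightarrow> rat) \<Rightarrow> (('v \<times> nat) multiset \<Rightarrow> rat) \<Rightarrow> ('v \<times> nat) multiset \<Rightarrow> rat"
    (infixl \<open>\<star>\<close> 70) where
  "(\<phi> \<star> \<psi>) M =
     (THE x. \<forall>c A e. finite A \<longrightarrow> keys e \<subseteq> A \<longrightarrow> letters c A e = M \<longrightarrow> x = mcoeff (conv \<phi> \<psi> c A) e)"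

lemma kernel1_commute: "kernel1 c s t = kernel1 c t s"
proof -
  have "(mvar s - mvar t) ^ m (c s) (c s) = (mvar t - mvar s :: (nat, rat) mpseries) ^ m (c s) (c s)"
    using m_even by (metis minus_diff_eq power_minus_even)
  thus ?thesis using m_sym[of "c s" "c t"]
    by (cases "c s" "c t" rule: linorder_cases) (auto simp: kernel1_def)
qed

lemma kernel_commute: "kernel c S T = kernel c T S"
  unfolding kernel_def by (subst prod.swap) (simp add: kernel1_commute)

lemma kernel_Un_left:
  "finite S \<Longrightarrow> finite S' \<Longrightarrow> S \<inter> S' = {} \<Longrightarrow> kernel c (S \<union> S') T = kernel c S T * kernel c S' T"
  by (simp add: kernel_def prod.union_disjoint)

lemma kernel_Un_right:
  "finite T \<Longrightarrow> finite T' \<Longrightarrow> T \<inter> T' = {} \<Longrightarrow> kernel c S (T \<union> T') = kernel c S T * kernel c S T'"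
  by (metis kernel_Un_left kernel_commute)

lemma kernel_cong:
  assumes "\<And>a. a \<in> S \<union> T \<Longrightarrow> c a = c' a"
  shows "kernel c S T = kernel c' S T"
  unfolding kernel_def kernel1_def by (intro prod.cong refl) (simp add: assms)

lemma vars_in_kernel: "S \<subseteq> A \<Longrightarrow> T \<subseteq> A \<Longrightarrow> vars_in (kernel c S T) A"
  unfolding kernel_def kernel1_def
  by (auto intro!: vars_in_prod vars_in_power vars_in_diff vars_in_mvar simp: subset_iff)

lemma translation_kernel:
  assumes "finite A" "S \<subseteq> A" "T \<subseteq> A"
  shows "translation A (kernel c S T) = 0"
  unfolding kernel_def kernel1_def using assms
  by (auto intro!: translation_prod_eq_0 translation_power_eq_0 translation_mvar_diff)

lemma rename_kernel:
  assumes "bij \<pi>"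
  shows "rename \<pi> (kernel (c \<circ> \<pi>) S T) = kernel c (\<pi> ` S) (\<pi> ` T)"
proof -
  have "rename \<pi> (kernel1 (c \<circ> \<pi>) s t) = kernel1 c (\<pi> s) (\<pi> t)" for s t
    using assms by (simp add: kernel1_def rename_power rename_mvar rename_diff)
  moreover have "inj_on \<pi> X" for X using assms by (meson bij_is_inj inj_on_subset subset_UNIV)
  ultimately show ?thesis
    using assms by (simp add: kernel_def rename_prod prod.reindex)
qed

lemma conv_cong:
  assumes "\<And>a. a \<in> A \<Longrightarrow> c a = c' a"
  shows "conv \<phi> \<psi> c A = conv \<phi> \<psi> c' A"
  unfolding conv_def
proof (intro sum.cong refl)
  fix S assume S: "S \<in> Pow A"
  have "realize \<phi> c S = realize \<phi> c' S" "realize \<psi> c (A - S) = realize \<psi> c' (A - S)"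
    "kernel c S (A - S) = kernel c' S (A - S)"
    using S assms by (auto intro!: realize_cong kernel_cong)
  thus "realize \<phi> c S * realize \<psi> c (A - S) * kernel c S (A - S) =
         realize \<phi> c' S * realize \<psi> c' (A - S) * kernel c' S (A - S)" by simp
qed

lemma rename_conv:
  assumes "bij \<pi>"
  shows "rename \<pi> (conv \<phi> \<psi> (c \<circ> \<pi>) A) = conv \<phi> \<psi> c (\<pi> ` A)"
proof -
  have inj: "inj \<pi>" using assms by (rule bij_is_inj)
  have "inj_on ((`) \<pi>) (Pow A)"
    using inj by (auto simp: inj_on_def inj_image_eq_iff)
  hence "conv \<phi> \<psi> c (\<pi> ` A) = (\<Sum>S\<in>Pow A. realize \<phi> c (\<pi> ` S) *
      realize \<psi> c (\<pi> ` A - \<pi> ` S) * kernel c (\<pi> ` S) (\<pi> ` A - \<pi> ` S))"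
    unfolding conv_def image_Pow_surj[OF refl, symmetric] by (simp add: sum.reindex)
  also have "\<dots> = rename \<pi> (conv \<phi> \<psi> (c \<circ> \<pi>) A)"
    using assms by (simp add: conv_def rename_sum rename_times rename_realize rename_kernel
        image_set_diff[OF inj])
  finally show ?thesis by simp
qed

text \<open>Labellings with the same letters differ by a permutation of labels that matches colours
  and exponents, and \<open>conv\<close> is equivariant by \<open>rename_conv\<close>.\<close>

lemma mcoeff_conv_cong:
  assumes "finite A" "keys e \<subseteq> A" "finite A'" "keys e' \<subseteq> A'" "letters c A e = letters c' A' e'"
  shows "mcoeff (conv \<phi> \<psi> c A) e = mcoeff (conv \<phi> \<psi> c' A') e'"
proof -
  obtain h where h: "bij_betw h A A'" "\<forall>a\<in>A. (c a, lookup e a) = (c' (h a), lookup e' (h a))"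
    using image_mset_eq_imp_bij[OF assms(1,3)] assms(5) unfolding letters_def by blast
  obtain \<pi> where \<pi>: "bij \<pi>" "\<forall>a\<in>A. \<pi> a = h a"
    using bij_betw_extend_bij[OF assms(1,3) h(1)] by blast
  have inj: "inj \<pi>" using \<pi>(1) by (rule bij_is_inj)
  have A': "A' = \<pi> ` A" using h(1) \<pi>(2) by (auto simp: bij_betw_def)
  have "lookup (Poly_Mapping.map_key \<pi> e') a = lookup e a" for a
  proof (cases "a \<in> A")
    case True
    thus ?thesis using h \<pi> inj by (simp add: lookup_map_key)
  next
    case False
    hence "\<pi> a \<notin> A'" using A' inj by (simp add: inj_image_mem_iff)
    hence "lookup e' (\<pi> a) = 0" "lookup e a = 0"
      using False assms(2,4) by (auto simp: in_keys_iff subset_iff)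
    thus ?thesis using inj by (simp add: lookup_map_key)
  qed
  hence e: "Poly_Mapping.map_key \<pi> e' = e" by (rule poly_mapping_eqI)
  have "mcoeff (conv \<phi> \<psi> c' A') e' = mcoeff (conv \<phi> \<psi> (c' \<circ> \<pi>) A) e"
    unfolding A' rename_conv[OF \<pi>(1), symmetric] by (simp add: e)
  also have "conv \<phi> \<psi> (c' \<circ> \<pi>) A = conv \<phi> \<psi> c A"
    by (rule conv_cong) (use h \<pi> in auto)
  finally show ?thesis by simp
qed

lemma vars_in_conv: "vars_in (conv \<phi> \<psi> c A) A"
proof -
  have "vars_in (realize \<phi> c S * realize \<psi> c (A - S) * kernel c S (A - S)) A" if "S \<subseteq> A" for S
    using that vars_in_mono[OF vars_in_realize, of S A \<phi> c] vars_in_kernel[of S A "A - S" c]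
      vars_in_mono[OF vars_in_realize, of "A - S" A \<psi> c] by auto
  thus ?thesis unfolding conv_def by (intro vars_in_sum) auto
qed

lemma realize_star:
  assumes "finite A"
  shows "realize (\<phi> \<star> \<psi>) c A = conv \<phi> \<psi> c A"
proof (rule mpseries_eqI)
  fix e
  show "mcoeff (realize (\<phi> \<star> \<psi>) c A) e = mcoeff (conv \<phi> \<psi> c A) e"
  proof (cases "keys e \<subseteq> A")
    case True
    have "(\<phi> \<star> \<psi>) (letters c A e) = mcoeff (conv \<phi> \<psi> c A) e"
      unfolding star_def
    proof (rule the_equality)
      show "\<forall>c' A' e'. finite A' \<longrightarrow> keys e' \<subseteq> A' \<longrightarrow> letters c' A' e' = letters c A e \<longrightarrow>
              mcoeff (conv \<phi> \<psi> c A) e = mcoeff (conv \<phi> \<psi> c' A') e'"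
        using mcoeff_conv_cong[OF assms True] by metis
    qed (use assms True in blast)
    thus ?thesis using True by (simp add: mcoeff_realize)
  next
    case False
    thus ?thesis using vars_in_conv[of \<phi> \<psi> c A] by (auto simp: mcoeff_realize vars_in_def)
  qed
qed

lemma star_commute: "\<phi> \<star> \<psi> = \<psi> \<star> \<phi>"
proof (rule realize_inject)
  fix c :: "nat \<Rightarrow> 'v" and A :: "nat set" assume A: "finite A"
  have "conv \<phi> \<psi> c A = conv \<psi> \<phi> c A"
    unfolding conv_def
    by (rule sum.reindex_bij_witness[where i = "\<lambda>S. A - S" and j = "\<lambda>S. A - S"])
       (auto simp: double_diff kernel_commute[of c _ "A - _"] mult_ac)
  thus "realize (\<phi> \<star> \<psi>) c A = realize (\<psi> \<star> \<phi>) c A" using A by (simp add: realize_star)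
qed

text \<open>Both bracketings are the same sum over ordered partitions of \<open>A\<close> into three
  parts, because the kernel is multiplicative in each argument.\<close>

lemma star_assoc: "\<phi> \<star> \<psi> \<star> \<rho> = \<phi> \<star> (\<psi> \<star> \<rho>)"
proof (rule realize_inject)
  fix c :: "nat \<Rightarrow> 'v" and A :: "nat set" assume A: "finite A"
  have fin: "finite S" if "S \<subseteq> A" for S using that A finite_subset by blast
  let ?t = "\<lambda>S T U. realize \<phi> c S * realize \<psi> c T * realize \<rho> c U *
              (kernel c S T * kernel c S U * kernel c T U)"
  have "realize (\<phi> \<star> \<psi> \<star> \<rho>) c A = (\<Sum>S\<in>Pow A. \<Sum>T\<in>Pow S. ?t T (S - T) (A - S))"
  proof -
    have "realize (\<phi> \<star> \<psi>) c S * realize \<rho> c (A - S) * kernel c S (A - S) =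
        (\<Sum>T\<in>Pow S. ?t T (S - T) (A - S))" if "S \<in> Pow A" for S
    proof -
      have "kernel c S (A - S) = kernel c T (A - S) * kernel c (S - T) (A - S)" if "T \<in> Pow S" for T
      proof -
        have "kernel c (T \<union> (S - T)) (A - S) = kernel c T (A - S) * kernel c (S - T) (A - S)"
          using that \<open>S \<in> Pow A\<close> fin by (intro kernel_Un_left) auto
        thus ?thesis using that by (simp add: Un_absorb1)
      qed
      hence "(\<Sum>T\<in>Pow S. realize \<phi> c T * realize \<psi> c (S - T) * kernel c T (S - T) *
          realize \<rho> c (A - S) * kernel c S (A - S)) = (\<Sum>T\<in>Pow S. ?t T (S - T) (A - S))"
        by (intro sum.cong refl) (simp only: mult_ac)
      thus ?thesis using that fin by (simp add: realize_star conv_def sum_distrib_right)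
    qed
    thus ?thesis using A by (subst realize_star) (auto simp: conv_def)
  qed
  also have "\<dots> = (\<Sum>(S, T)\<in>Sigma (Pow A) Pow. ?t T (S - T) (A - S))"
    using A fin by (subst sum.Sigma) auto
  also have "\<dots> = (\<Sum>(S, T)\<in>Sigma (Pow A) (\<lambda>S. Pow (A - S)). ?t S T (A - S - T))"
  proof (rule sum.reindex_bij_witness[where i = "\<lambda>(S, T). (S \<union> T, S)" and j = "\<lambda>(S, T). (T, S - T)"];
      clarsimp)
    fix S T assume "S \<subseteq> A" "T \<subseteq> S"
    hence "A - T - (S - T) = A - S" by auto
    thus "?t T (S - T) (A - T - (S - T)) = ?t T (S - T) (A - S)" by simp
  qed auto
  also have "\<dots> = (\<Sum>S\<in>Pow A. \<Sum>T\<in>Pow (A - S). ?t S T (A - S - T))"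
    using A fin by (subst sum.Sigma) auto
  also have "\<dots> = realize (\<phi> \<star> (\<psi> \<star> \<rho>)) c A"
  proof -
    have "realize \<phi> c S * realize (\<psi> \<star> \<rho>) c (A - S) * kernel c S (A - S) =
        (\<Sum>T\<in>Pow (A - S). ?t S T (A - S - T))" if "S \<in> Pow A" for S
    proof -
      have "kernel c S (A - S) = kernel c S T * kernel c S (A - S - T)" if "T \<in> Pow (A - S)" for T
      proof -
        have "kernel c S (T \<union> (A - S - T)) = kernel c S T * kernel c S (A - S - T)"
          using that A by (intro kernel_Un_right) (auto intro: finite_subset)
        moreover have "T \<union> (A - S - T) = A - S" using that by auto
        ultimately show ?thesis by simp
      qed
      hence "(\<Sum>T\<in>Pow (A - S). realize \<phi> c S * (realize \<psi> c T * realize \<rho> c (A - S - T) *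
          kernel c T (A - S - T)) * kernel c S (A - S)) = (\<Sum>T\<in>Pow (A - S). ?t S T (A - S - T))"
        by (intro sum.cong refl) (simp only: mult_ac)
      thus ?thesis using that A
        by (simp add: realize_star conv_def sum_distrib_right sum_distrib_left)
    qed
    thus ?thesis using A by (subst realize_star) (auto simp: conv_def)
  qed
  finally show "realize (\<phi> \<star> \<psi> \<star> \<rho>) c A = realize (\<phi> \<star> (\<psi> \<star> \<rho>)) c A" .
qed

definition unit :: "('v \<times> nat) multiset \<Rightarrow> rat" where
  "unit M = (if M = {#} then 1 else 0)"

lemma star_unit: "unit \<star> \<phi> = \<phi>"
proof (rule realize_inject)
  fix c :: "nat \<Rightarrow> 'v" and A :: "nat set" assume A: "finite A"
  have unit: "realize unit c S = (if S = {} then 1 else 0)" if "finite S" for S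
  proof (rule mpseries_eqI)
    fix e
    have "letters c S e = {#} \<longleftrightarrow> S = {}"
      using that by (auto simp: letters_def mset_set_empty_iff)
    thus "mcoeff (realize unit c S) e = mcoeff (if S = {} then 1 else 0) e"
      by (auto simp: mcoeff_realize unit_def mcoeff_one)
  qed
  have "conv unit \<phi> c A = (\<Sum>S\<in>{{}}. realize unit c S * realize \<phi> c (A - S) * kernel c S (A - S))"
    unfolding conv_def using A finite_subset[of _ A]
    by (intro sum.mono_neutral_right) (auto simp: unit)
  thus "realize (unit \<star> \<phi>) c A = realize \<phi> c A"
    using A by (simp add: realize_star unit kernel_def)
qed

lemma star_add_left: "(\<phi> + \<psi>) \<star> \<rho> = \<phi> \<star> \<rho> + \<psi> \<star> \<rho>"
  by (rule realize_inject)
     (simp add: realize_star realize_add conv_def distrib_right sum.distrib)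

lemma mscale_times: "mscale r p * p' = mscale r (p * p' :: ('a, rat) mpseries)"
  by (rule mpseries_eqI) (simp add: mcoeff_times sum_distrib_left case_prod_unfold mult.assoc)

lemma star_scale_left: "fscale r \<phi> \<star> \<psi> = fscale r (\<phi> \<star> \<psi>)"
proof (rule realize_inject)
  fix c :: "nat \<Rightarrow> 'v" and A :: "nat set" assume A: "finite A"
  have "mscale r (\<Sum>x\<in>X. f x) = (\<Sum>x\<in>X. mscale r (f x :: (nat, rat) mpseries))"
    for X :: "nat set set" and f
    by (rule mpseries_eqI) (simp add: mcoeff_sum sum_distrib_left)
  thus "realize (fscale r \<phi> \<star> \<psi>) c A = realize (fscale r (\<phi> \<star> \<psi>)) c A"
    using A by (simp add: realize_star realize_scale conv_def mscale_times)
qed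

text \<open>The sum of the variables of \<open>A\<close> splits into the sums over \<open>S\<close>
  and over \<open>A - S\<close>, so multiplication by it is a derivation of the product.\<close>

lemma raise_deg_star: "raise_deg (\<phi> \<star> \<psi>) = raise_deg \<phi> \<star> \<psi> + \<phi> \<star> raise_deg \<psi>"
proof (rule realize_inject)
  fix c :: "nat \<Rightarrow> 'v" and A :: "nat set" assume A: "finite A"
  have fin: "finite S" if "S \<subseteq> A" for S using that A finite_subset by blast
  have "(\<Sum>a\<in>A. mvar a) * (realize \<phi> c S * realize \<psi> c (A - S) * kernel c S (A - S)) =
        realize (raise_deg \<phi>) c S * realize \<psi> c (A - S) * kernel c S (A - S) +
        realize \<phi> c S * realize (raise_deg \<psi>) c (A - S) * kernel c S (A - S)" if "S \<in> Pow A" for S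
  proof -
    have "(\<Sum>a\<in>A. mvar a :: (nat, rat) mpseries) = (\<Sum>a\<in>A - S. mvar a) + (\<Sum>a\<in>S. mvar a)"
      using that A by (intro sum.subset_diff) auto
    thus ?thesis using that fin by (simp add: realize_raise_deg algebra_simps)
  qed
  thus "realize (raise_deg (\<phi> \<star> \<psi>)) c A = realize (raise_deg \<phi> \<star> \<psi> + \<phi> \<star> raise_deg \<psi>) c A"
    using A by (simp add: realize_raise_deg realize_star realize_add conv_def sum_distrib_left
        sum.distrib)
qed

text \<open>The kernel is built from differences of variables, so translation annihilates it and the
  product rule involves the two factors only.\<close>

lemma lower_deg_star: "lower_deg (\<phi> \<star> \<psi>) = lower_deg \<phi> \<star> \<psi> + \<phi> \<star> lower_deg \<psi>"
proof (rule realize_inject)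
  fix c :: "nat \<Rightarrow> 'v" and A :: "nat set" assume A: "finite A"
  have fin: "finite S" if "S \<subseteq> A" for S using that A finite_subset by blast
  have "translation A (realize \<phi> c S * realize \<psi> c (A - S) * kernel c S (A - S)) =
        realize (lower_deg \<phi>) c S * realize \<psi> c (A - S) * kernel c S (A - S) +
        realize \<phi> c S * realize (lower_deg \<psi>) c (A - S) * kernel c S (A - S)" if "S \<in> Pow A" for S
  proof -
    have "translation A (kernel c S (A - S)) = 0"
      using that A by (intro translation_kernel) auto
    moreover have "translation A (realize \<phi> c S) = realize (lower_deg \<phi>) c S"
      using that A fin by (subst translation_eq_on_vars[OF vars_in_realize])
        (auto simp: realize_lower_deg)
    moreover have "translation A (realize \<psi> c (A - S)) = realize (lower_deg \<psi>) c (A - S)"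
      using that A fin by (subst translation_eq_on_vars[OF vars_in_realize])
        (auto simp: realize_lower_deg)
    ultimately show ?thesis by (simp add: translation_times algebra_simps)
  qed
  thus "realize (lower_deg (\<phi> \<star> \<psi>)) c A = realize (lower_deg \<phi> \<star> \<psi> + \<phi> \<star> lower_deg \<psi>) c A"
    using A by (simp add: realize_lower_deg realize_star realize_add conv_def translation_sum
        sum.distrib)
qed

end

section \<open>Leading words\<close>

context link
begin

text \<open>The word of a list of coloured exponents: the exponents of the leading term of the
  rational function obtained by dividing a monomial by the product of all kernels, expanded where
  each variable is small compared to the following ones. Exponents are negated, so that the
  lexicographically largest word leads.\<close>

fun enc_from :: "('v \<Rightarrow> int) \<Rightarrow> ('v \<times> int) list \<Rightarrow> (int \<times> 'v) list" where
  "enc_from f [] = []"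
| "enc_from f ((v, e) # xs) = (f v - e, v) # enc_from (\<lambda>u. f u + int (m v u)) xs"

abbreviation enc :: "('v \<times> int) list \<Rightarrow> (int \<times> 'v) list" where
  "enc \<equiv> enc_from (\<lambda>_. 0)"

definition encn :: "('v \<times> nat) list \<Rightarrow> (int \<times> 'v) list" where
  "encn xs = enc (map (apsnd int) xs)"

definition weight :: "('v \<times> int) list \<Rightarrow> 'v \<Rightarrow> int" where
  "weight xs u = (\<Sum>x\<leftarrow>xs. int (m (fst x) u))"

lemma enc_from_append:
  "enc_from f (xs @ ys) = enc_from f xs @ enc_from (\<lambda>u. f u + weight xs u) ys"
proof (induction xs arbitrary: f)
  case (Cons x xs)
  show ?case by (cases x) (simp add: Cons.IH weight_def add.assoc)
qed (simp add: weight_def)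

lemma enc_from_shift:
  "enc_from (\<lambda>u. g u + f u) ys = enc_from g (map (\<lambda>(v, e). (v, e - f v)) ys)"
proof (induction ys arbitrary: g)
  case (Cons y ys)
  have "(\<lambda>u. g u + f u + int (m (fst y) u)) = (\<lambda>u. (g u + int (m (fst y) u)) + f u)"
    by (simp add: fun_eq_iff)
  thus ?case using Cons.IH[of "\<lambda>u. g u + int (m (fst y) u)"] by (cases y) simp
qed simp

text \<open>A later block sees an earlier one only through the shift \<open>weight xs\<close>.
  Subtracting it can make exponents negative, which is why \<open>enc\<close> works with
  integers.\<close>

lemma enc_append: "enc (xs @ ys) = enc xs @ enc (map (\<lambda>(v, e). (v, e - weight xs v)) ys)"
  using enc_from_shift[of "\<lambda>_. 0" "weight xs" ys] by (simp add: enc_from_append)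

lemma length_enc_from [simp]: "length (enc_from f xs) = length xs"
  by (induction xs arbitrary: f) auto

lemma map_snd_enc_from [simp]: "map snd (enc_from f xs) = map fst xs"
  by (induction xs arbitrary: f) auto

lemma enc_from_inject: "enc_from f xs = enc_from f ys \<longleftrightarrow> xs = ys"
proof (induction xs arbitrary: f ys)
  case Nil
  then show ?case by (cases ys) auto
next
  case (Cons x xs)
  then show ?case by (cases x; cases ys) auto
qed

lemma encn_inject: "encn xs = encn ys \<longleftrightarrow> xs = ys"
proof -
  have "inj (apsnd int :: 'v \<times> nat \<Rightarrow> _)" by (auto simp: inj_def apsnd_def map_prod_def split: prod.splits)
  thus ?thesis by (simp add: encn_def enc_from_inject inj_map_eq_map)
qed

lemma length_encn [simp]: "length (encn xs) = length xs"
  by (simp add: encn_def)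

lemma map_snd_encn [simp]: "map snd (encn xs) = map fst xs"
  by (simp add: encn_def comp_def)

definition best :: "('v \<times> int) list \<Rightarrow> bool" where
  "best xs \<longleftrightarrow> (\<forall>ys. mset ys = mset xs \<longrightarrow> enc ys \<le> enc xs)"

text \<open>One word for each multiset of letters, by \<open>bij_betw_dec\<close>. These are exactly
  the possible leading words, by \<open>lead_in_Lwords\<close> and \<open>lead_gen\<close>.\<close>

definition Lwords :: "(int \<times> 'v) list set" where
  "Lwords = {encn xs | xs. best (map (apsnd int) xs)}"

lemma append_le_append_prefix:
  "length u = length u' \<Longrightarrow> u @ w \<le> u' @ w' \<Longrightarrow> (u :: 'a::linorder list) \<le> u'"
proof (induction u arbitrary: u')
  case (Cons a u)
  then show ?case by (cases u') auto
qed simp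

text \<open>A better order of the prefix would improve the whole word, since a comparison decided
  within the first \<open>length xs\<close> letters is not affected by what follows.\<close>

lemma best_appendD1:
  assumes "best (xs @ ys)"
  shows "best xs"
  unfolding best_def
proof (intro allI impI)
  fix zs assume zs: "mset zs = mset xs"
  hence "mset (zs @ ys) = mset (xs @ ys)" by simp
  hence "enc (zs @ ys) \<le> enc (xs @ ys)" using assms unfolding best_def by blast
  hence "enc zs @ enc (map (\<lambda>(v, e). (v, e - weight zs v)) ys) \<le>
         enc xs @ enc (map (\<lambda>(v, e). (v, e - weight xs v)) ys)"
    unfolding enc_append .
  moreover have "length zs = length xs" using zs by (rule mset_eq_length)
  hence "length (enc zs) = length (enc xs)" by simp
  ultimately show "enc zs \<le> enc xs" using append_le_append_prefix by blast
qed

text \<open>Permuting the tail leaves the shift imposed by \<open>xs\<close> unchanged, so the tail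
  is best once this shift has been subtracted from its exponents.\<close>

lemma best_appendD2:
  assumes "best (xs @ ys)"
  shows "best (map (\<lambda>(v, e). (v, e - weight xs v)) ys)"
  unfolding best_def
proof (intro allI impI)
  fix zs assume zs: "mset zs = mset (map (\<lambda>(v, e). (v, e - weight xs v)) ys)"
  define zs' where "zs' = map (\<lambda>(v, e). (v, e + weight xs v)) zs"
  have "mset zs' = mset ys"
    unfolding zs'_def mset_map zs by (simp add: multiset.map_comp comp_def case_prod_unfold)
  hence "mset (xs @ zs') = mset (xs @ ys)" by simp
  hence "enc (xs @ zs') \<le> enc (xs @ ys)" using assms unfolding best_def by blast
  moreover have "map (\<lambda>(v, e). (v, e - weight xs v)) zs' = zs"
    by (simp add: zs'_def comp_def case_prod_unfold)
  ultimately show "enc zs \<le> enc (map (\<lambda>(v, e). (v, e - weight xs v)) ys)"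
    by (simp add: enc_append)
qed

text \<open>Nothing shifts the first position and exponents enter negated, so moving a smaller
  exponent to the front would enlarge the word.\<close>

lemma best_hd_le:
  assumes "best xs" "x \<in> set xs"
  shows "snd (hd xs) \<le> snd x"
proof (rule ccontr)
  assume *: "\<not> snd (hd xs) \<le> snd x"
  have "mset (x # remove1 x xs) = mset xs" using assms(2) by simp
  hence "enc (x # remove1 x xs) \<le> enc xs" using assms(1) unfolding best_def by blast
  moreover obtain y ys where "xs = y # ys" using assms(2) by (cases xs) auto
  ultimately show False using * by (cases x; cases y) (auto simp: less_eq_prod_def less_prod_def)
qed

text \<open>The first component of the first letter is minus the first exponent, and that exponent
  is the least by \<open>best_hd_le\<close>. Nonnegativity of all exponents thus becomes a condition
  on the first letter, which can be tested on factors of a word.\<close>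

lemma Lwords_iff: "w \<in> Lwords \<longleftrightarrow> (\<exists>xs. best xs \<and> w = enc xs \<and> (w \<noteq> [] \<longrightarrow> fst (hd w) \<le> 0))"
proof
  assume "w \<in> Lwords"
  then obtain xs where xs: "best (map (apsnd int) xs)" "w = encn xs" by (auto simp: Lwords_def)
  show "\<exists>xs. best xs \<and> w = enc xs \<and> (w \<noteq> [] \<longrightarrow> fst (hd w) \<le> 0)"
    using xs by (intro exI[of _ "map (apsnd int) xs"]) (cases xs; cases "hd xs"; simp add: encn_def)
next
  assume "\<exists>xs. best xs \<and> w = enc xs \<and> (w \<noteq> [] \<longrightarrow> fst (hd w) \<le> 0)"
  then obtain xs where xs: "best xs" "w = enc xs" "w \<noteq> [] \<longrightarrow> fst (hd w) \<le> 0" by blast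
  have nonneg: "snd x \<ge> 0" if "x \<in> set xs" for x
  proof -
    have "snd (hd xs) \<ge> 0" using xs that by (cases xs) auto
    thus ?thesis using best_hd_le[OF xs(1) that] by simp
  qed
  define ys where "ys = map (apsnd nat) xs"
  have "map (apsnd int) ys = xs"
    unfolding ys_def map_map by (rule map_idI) (auto dest: nonneg)
  thus "w \<in> Lwords" using xs by (auto simp: Lwords_def encn_def intro!: exI[of _ ys])
qed

lemma Lwords_factor:
  assumes "t @ l @ r \<in> Lwords" "l \<noteq> []" "fst (hd l) \<le> 0"
  shows "l \<in> Lwords"
proof -
  obtain xs where xs: "best xs" "t @ l @ r = enc xs" using assms(1) Lwords_iff by blast
  define ys rs where "ys = take (length t + length l) xs" and "rs = drop (length t + length l) xs"
  have split: "ys @ rs = xs" by (simp add: ys_def rs_def)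
  have best: "best ys" by (rule best_appendD1[of ys rs]) (simp add: split xs)
  have "length (enc xs) = length t + (length l + length r)" by (simp flip: xs(2))
  hence "length (enc ys) = length (t @ l)" by (simp add: ys_def)
  moreover have "enc ys @ enc (map (\<lambda>(v, e). (v, e - weight ys v)) rs) = (t @ l) @ r"
    unfolding enc_append[symmetric] split by (simp add: xs(2))
  ultimately have enc: "enc ys = t @ l" using append_eq_append_conv by blast
  define us vs where "us = take (length t) ys" and "vs = drop (length t) ys"
  have split': "us @ vs = ys" by (simp add: us_def vs_def)
  define zs where "zs = map (\<lambda>(v, e). (v, e - weight us v)) vs"
  have "best zs" unfolding zs_def by (rule best_appendD2) (simp add: split' best)
  moreover have "enc zs = l"
  proof -
    have "length (enc ys) = length t + length l" by (simp add: enc)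
    hence "length (enc us) = length t" by (simp add: us_def)
    moreover have "enc us @ enc zs = t @ l"
      unfolding zs_def enc_append[symmetric] split' by (rule enc)
    ultimately show ?thesis using append_eq_append_conv by blast
  qed
  ultimately show ?thesis using assms by (auto simp: Lwords_iff)
qed

text \<open>The factors are nonincreasing, so each begins with a letter at most the first letter of
  the whole word; this is the sign condition of \<open>Lwords_factor\<close>.\<close>

lemma Lwords_lyndon_factor:
  assumes "concat ls \<in> Lwords" "lyndon_seq ls" "l \<in> set ls"
  shows "l \<in> Lwords"
proof -
  have ne: "k \<noteq> []" if "k \<in> set ls" for k using that assms(2) by (auto simp: lyndon_seq_def lyndon_def)
  obtain k ks where ks: "ls = k # ks" using assms(3) by (cases ls) auto
  have "l \<le> k" using assms(2,3) ks by (auto simp: lyndon_seq_def)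
  moreover have "k \<noteq> []" "l \<noteq> []" using ne assms(3) ks by auto
  ultimately have "hd l \<le> hd k" by (cases l; cases k) auto
  hence "fst (hd l) \<le> fst (hd k)" by (auto simp: less_eq_prod_def less_prod_def split: prod.splits)
  moreover have "hd (concat ls) = hd k" "concat ls \<noteq> []" using ks \<open>k \<noteq> []\<close> by auto
  hence "fst (hd k) \<le> 0" using assms(1) by (metis Lwords_iff)
  moreover obtain as bs where "ls = as @ l # bs" using assms(3) by (meson split_list)
  hence "concat ls = concat as @ l @ concat bs" by simp
  ultimately show ?thesis using assms(1) \<open>l \<noteq> []\<close>
    by (intro Lwords_factor[of "concat as" l "concat bs"]) auto
qed

definition lead :: "(('v \<times> nat) multiset \<Rightarrow> rat) \<Rightarrow> (int \<times> 'v) list \<Rightarrow> bool" where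
  "lead \<phi> w \<longleftrightarrow> (\<exists>xs. \<phi> (mset xs) \<noteq> 0 \<and> encn xs = w) \<and>
     (\<forall>xs. \<phi> (mset xs) \<noteq> 0 \<longrightarrow> encn xs \<le> w)"

text \<open>The value \<open>\<phi> (mset xs)\<close> does not depend on the order of
  \<open>xs\<close>, so every rearrangement of a leading list competes with it.\<close>

lemma lead_in_Lwords:
  assumes "lead \<phi> w"
  shows "w \<in> Lwords"
proof -
  obtain xs where xs: "\<phi> (mset xs) \<noteq> 0" "encn xs = w" using assms by (auto simp: lead_def)
  have "best (map (apsnd int) xs)" unfolding best_def
  proof (intro allI impI)
    fix ys assume ys: "mset ys = mset (map (apsnd int) xs)"
    define zs where "zs = map (apsnd nat) ys"
    have "mset zs = mset xs"
      unfolding zs_def mset_map ys by (simp add: multiset.map_comp comp_def apsnd_def map_prod_def case_prod_unfold)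
    moreover have "map (apsnd int) zs = ys"
    proof -
      have "snd y \<ge> 0" if "y \<in> set ys" for y
      proof -
        have "y \<in># mset (map (apsnd int) xs)" using that ys by (metis set_mset_mset)
        thus ?thesis by auto
      qed
      thus ?thesis unfolding zs_def map_map by (intro map_idI) auto
    qed
    ultimately show "enc ys \<le> enc (map (apsnd int) xs)"
      using assms xs by (metis lead_def encn_def)
  qed
  thus ?thesis using xs by (auto simp: Lwords_def)
qed

subsection \<open>The leading word of a product\<close>

text \<open>The exponent of the lowest term of \<open>kernel c S T\<close> for disjoint
  \<open>S\<close> and \<open>T\<close>, with coefficient \<open>cross_sgn c S T\<close>: each
  factor contributes its variable with the larger label.\<close>

definition cross_exp :: "(nat \<Rightarrow> 'v) \<Rightarrow> nat set \<Rightarrow> nat set \<Rightarrow> nat \<Rightarrow>\<^sub>0 nat" where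
  "cross_exp c S T = (\<Sum>s\<in>S. \<Sum>t\<in>T. Poly_Mapping.single (max s t) (m (c s) (c t)))"

definition sgn_pair :: "'v \<Rightarrow> 'v \<Rightarrow> rat" where
  "sgn_pair i j = (if i \<le> j then (-1) ^ m i j else 1)"

definition cross_sgn :: "(nat \<Rightarrow> 'v) \<Rightarrow> nat set \<Rightarrow> nat set \<Rightarrow> rat" where
  "cross_sgn c S T = (\<Prod>s\<in>S. \<Prod>t\<in>T. sgn_pair (c (min s t)) (c (max s t)))"

text \<open>The product of \<open>sgn_pair\<close> over all pairs of positions. By
  \<open>cross_sgn_eq\<close> it expresses the sign of a splitting through the colours of three
  words.\<close>

fun word_sgn :: "'v list \<Rightarrow> rat" where
  "word_sgn [] = 1"
| "word_sgn (v # vs) = (\<Prod>u\<leftarrow>vs. sgn_pair v u) * word_sgn vs"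

lemma lowest_kernel1:
  assumes "s \<noteq> t"
  shows "lowest (kernel1 c s t) (Poly_Mapping.single (max s t) (m (c s) (c t)))
           (sgn_pair (c (min s t)) (c (max s t)))"
proof -
  have 1: "lowest ((mvar s - mvar t) ^ n) (Poly_Mapping.single t n) ((- 1) ^ n :: rat)"
    "lowest ((mvar t - mvar s) ^ n) (Poly_Mapping.single t n) (1 :: rat)" if "s < t" for s t n :: nat
    using lowest_power[OF lowest_mvar_diff(1)[OF that]] lowest_power[OF lowest_mvar_diff(2)[OF that]]
    by auto
  have "lowest (kernel1 c s t) (Poly_Mapping.single t (m (c s) (c t))) (sgn_pair (c s) (c t))"
    if "s < t" for s t
    using 1[OF that] by (simp add: kernel1_def sgn_pair_def)
  from this[of s t] this[of t s] show ?thesis using assms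
    by (cases "s < t") (auto simp: max_def min_def kernel1_commute[of c t s] m_sym[of "c t" "c s"])
qed

lemma lowest_kernel:
  assumes "finite S" "finite T" "S \<inter> T = {}"
  shows "lowest (kernel c S T) (cross_exp c S T) (cross_sgn c S T)"
  unfolding kernel_def cross_exp_def cross_sgn_def
  using assms by (intro lowest_prod lowest_kernel1) auto

definition shift_at :: "(nat \<Rightarrow> 'v) \<Rightarrow> nat set \<Rightarrow> nat \<Rightarrow> int" where
  "shift_at c S a = (\<Sum>b\<in>{b\<in>S. b < a}. int (m (c b) (c a)))"

definition label_letter :: "(nat \<Rightarrow> 'v) \<Rightarrow> nat set \<Rightarrow> (nat \<Rightarrow>\<^sub>0 nat) \<Rightarrow> nat \<Rightarrow> int \<times> 'v" where
  "label_letter c A e a = (shift_at c A a - int (lookup e a), c a)"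

definition label_word :: "(nat \<Rightarrow> 'v) \<Rightarrow> nat set \<Rightarrow> (nat \<Rightarrow>\<^sub>0 nat) \<Rightarrow> (int \<times> 'v) list" where
  "label_word c A e = map (label_letter c A e) (sorted_list_of_set A)"

definition label_list :: "(nat \<Rightarrow> 'v) \<Rightarrow> nat set \<Rightarrow> (nat \<Rightarrow>\<^sub>0 nat) \<Rightarrow> ('v \<times> nat) list" where
  "label_list c A e = map (\<lambda>a. (c a, lookup e a)) (sorted_list_of_set A)"

lemma mset_label_list: "finite A \<Longrightarrow> mset (label_list c A e) = letters c A e"
  by (simp add: label_list_def letters_def flip: sorted_list_of_mset_set)

lemma enc_from_map_sorted:
  assumes "sorted_wrt (<) as"
  shows "enc_from f (map (\<lambda>a. (c a, h a)) as) =
    map (\<lambda>a. (f (c a) + (\<Sum>b\<in>{b\<in>set as. b < a}. int (m (c b) (c a))) - h a, c a)) (as :: nat list)"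
  using assms
proof (induction as arbitrary: f)
  case (Cons x as)
  have "{b \<in> set (x # as). b < x} = {}" using Cons.prems by auto
  hence x: "(\<Sum>b\<in>{b\<in>set (x # as). b < x}. int (m (c b) (c x))) = 0" by (simp only: sum.empty)
  have "(\<Sum>b\<in>{b\<in>set (x # as). b < a}. int (m (c b) (c a))) =
      int (m (c x) (c a)) + (\<Sum>b\<in>{b\<in>set as. b < a}. int (m (c b) (c a)))" if "a \<in> set as" for a
  proof -
    have "{b\<in>set (x # as). b < a} = insert x {b\<in>set as. b < a}" using Cons.prems that by auto
    moreover have "x \<notin> set as" using Cons.prems by auto
    ultimately show ?thesis by simp
  qed
  thus ?case using Cons x by (simp add: add.assoc)
qed simp

lemma encn_label_list:
  assumes "finite A"
  shows "encn (label_list c A e) = label_word c A e"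
  using enc_from_map_sorted[of "sorted_list_of_set A" "\<lambda>_. 0" c "\<lambda>a. int (lookup e a)"] assms
  by (simp add: encn_def label_list_def label_word_def label_letter_def[abs_def] shift_at_def comp_def)

lemma length_label_word: "finite A \<Longrightarrow> length (label_word c A e) = card A"
  by (simp add: label_word_def)

lemma lookup_sum: "lookup (\<Sum>x\<in>X. f x) a = (\<Sum>x\<in>X. lookup (f x) a)"
  by (induction X rule: infinite_finite_induct) (auto simp: lookup_add)

lemma lookup_cross_exp:
  assumes "finite S" "finite T" "S \<inter> T = {}"
  shows "a \<in> S \<Longrightarrow> int (lookup (cross_exp c S T) a) = shift_at c T a"
    and "a \<in> T \<Longrightarrow> int (lookup (cross_exp c S T) a) = shift_at c S a"
    and "a \<notin> S \<union> T \<Longrightarrow> lookup (cross_exp c S T) a = 0"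
proof -
  have *: "lookup (cross_exp c S T) a = (\<Sum>s\<in>S. \<Sum>t\<in>T. if max s t = a then m (c s) (c t) else 0)" for a
    by (simp add: cross_exp_def lookup_sum lookup_single when_def)
  show "int (lookup (cross_exp c S T) a) = shift_at c T a" if "a \<in> S"
  proof -
    have "lookup (cross_exp c S T) a =
        (\<Sum>s\<in>S. if s = a then (\<Sum>t\<in>{t\<in>T. t < a}. m (c s) (c t)) else 0)"
      unfolding * using that assms
      by (intro sum.cong refl) (auto simp: sum.inter_filter max_def intro!: sum.cong sum.neutral)
    thus ?thesis using that assms by (simp add: shift_at_def m_sym)
  qed
  show "int (lookup (cross_exp c S T) a) = shift_at c S a" if "a \<in> T"
  proof -
    have "lookup (cross_exp c S T) a = (\<Sum>t\<in>T. \<Sum>s\<in>S. if max s t = a then m (c s) (c t) else 0)"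
      unfolding * by (rule sum.swap)
    also have "\<dots> = (\<Sum>t\<in>T. if t = a then (\<Sum>s\<in>{s\<in>S. s < a}. m (c s) (c t)) else 0)"
      using that assms
      by (intro sum.cong refl) (auto simp: sum.inter_filter max_def intro!: sum.cong sum.neutral)
    finally show ?thesis using that assms by (simp add: shift_at_def)
  qed
  show "lookup (cross_exp c S T) a = 0" if "a \<notin> S \<union> T"
    unfolding * using that by (intro sum.neutral ballI) (auto simp: max_def)
qed

lemma shift_at_Un:
  "finite S \<Longrightarrow> finite T \<Longrightarrow> S \<inter> T = {} \<Longrightarrow> shift_at c (S \<union> T) a = shift_at c S a + shift_at c T a"
proof -
  assume "finite S" "finite T" "S \<inter> T = {}"
  moreover have "{b \<in> S \<union> T. b < a} = {b\<in>S. b < a} \<union> {b\<in>T. b < a}" by auto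
  ultimately show ?thesis unfolding shift_at_def by (simp, subst sum.union_disjoint) auto
qed

text \<open>Passing to the union adds to the letter at \<open>a\<close> the shift caused by the
  smaller labels of the other part, and \<open>cross_exp\<close> raises the exponent at
  \<open>a\<close> by the same amount. This cancellation is the purpose of the shifts in
  \<open>enc_from\<close>.\<close>

lemma label_letter_merge:
  assumes "finite S" "finite T" "S \<inter> T = {}" "keys e1 \<subseteq> S" "keys e2 \<subseteq> T"
  shows "a \<in> S \<Longrightarrow> label_letter c (S \<union> T) (e1 + e2 + cross_exp c S T) a = label_letter c S e1 a"
    and "a \<in> T \<Longrightarrow> label_letter c (S \<union> T) (e1 + e2 + cross_exp c S T) a = label_letter c T e2 a"
proof -
  have "lookup e1 a = 0" if "a \<in> T" using that assms by (auto simp: in_keys_iff subset_iff disjoint_iff)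
  moreover have "lookup e2 a = 0" if "a \<in> S"
    using that assms by (auto simp: in_keys_iff subset_iff disjoint_iff)
  ultimately show "a \<in> S \<Longrightarrow> label_letter c (S \<union> T) (e1 + e2 + cross_exp c S T) a = label_letter c S e1 a"
    and "a \<in> T \<Longrightarrow> label_letter c (S \<union> T) (e1 + e2 + cross_exp c S T) a = label_letter c T e2 a"
    using lookup_cross_exp[OF assms(1-3), of a c] shift_at_Un[OF assms(1-3), of c a]
    by (auto simp: label_letter_def lookup_add)
qed

lemma filter_sorted_list_of_set:
  "finite A \<Longrightarrow> filter P (sorted_list_of_set A) = sorted_list_of_set {a\<in>A. P a}"
  by (rule sorted_distinct_set_unique) (auto intro: sorted_filter[of id, simplified])

text \<open>Letters are unchanged by \<open>label_letter_merge\<close> and sorting the labels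
  interleaves the two parts, so the lowest kernel term produces a shuffle.\<close>

lemma label_word_merge:
  assumes "finite S" "finite T" "S \<inter> T = {}" "keys e1 \<subseteq> S" "keys e2 \<subseteq> T"
  shows "label_word c (S \<union> T) (e1 + e2 + cross_exp c S T) \<in>
           shuffles (label_word c S e1) (label_word c T e2)"
proof -
  let ?h = "label_letter c (S \<union> T) (e1 + e2 + cross_exp c S T)"
  have "{a \<in> S \<union> T. a \<in> S} = S" "{a \<in> S \<union> T. a \<notin> S} = T" using assms(3) by auto
  hence "filter (\<lambda>a. a \<in> S) (sorted_list_of_set (S \<union> T)) = sorted_list_of_set S"
    "filter (\<lambda>a. a \<notin> S) (sorted_list_of_set (S \<union> T)) = sorted_list_of_set T"
    using assms(1,2) by (simp_all add: filter_sorted_list_of_set)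
  moreover have "map ?h (sorted_list_of_set S) = label_word c S e1"
    unfolding label_word_def using assms(1)
    by (intro map_cong refl label_letter_merge(1)[OF assms]) auto
  moreover have "map ?h (sorted_list_of_set T) = label_word c T e2"
    unfolding label_word_def using assms(2)
    by (intro map_cong refl label_letter_merge(2)[OF assms]) auto
  ultimately show ?thesis
    using map_in_shuffles[of ?h "sorted_list_of_set (S \<union> T)" "\<lambda>a. a \<in> S"]
    unfolding label_word_def[of c "S \<union> T"] by simp
qed

lemma map_less_map_sorted:
  fixes as :: "nat list" and h h' :: "nat \<Rightarrow> 'b::linorder"
  assumes "sorted_wrt (<) as" "k \<in> set as" "h k < h' k"
    "\<And>a. a \<in> set as \<Longrightarrow> a < k \<Longrightarrow> h a = h' a"
  shows "map h as < map h' as"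
  using assms by (induction as) auto

text \<open>Both orders decide at the first label of difference and exponents enter letters negated,
  so lower monomials have larger words.\<close>

lemma label_word_less:
  assumes "finite A" "keys e \<subseteq> A" "e0 < e"
  shows "label_word c A e < label_word c A e0"
proof -
  obtain k where k: "lookup e0 k < lookup e k" "\<And>a. a < k \<Longrightarrow> lookup e0 a = lookup e a"
    using assms(3) by (auto simp: less_poly_mapping.rep_eq less_fun_def)
  hence "k \<in> A" using assms(2) by (auto simp: in_keys_iff subset_iff)
  show ?thesis unfolding label_word_def
    using assms(1) k \<open>k \<in> A\<close>
    by (intro map_less_map_sorted[where k = k]) (auto simp: label_letter_def less_prod_def)
qed

text \<open>Every pair of positions lies within one of the two subsequences or goes across them, and
  the sign of the whole word factors accordingly.\<close>

lemma cross_sgn_filter: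
  assumes "sorted_wrt (<) as"
  shows "cross_sgn c (set (filter P as)) (set (filter (\<lambda>a. \<not> P a) as)) *
      word_sgn (map c (filter P as)) * word_sgn (map c (filter (\<lambda>a. \<not> P a) as)) =
      word_sgn (map c as)"
  using assms
proof (induction as)
  case Nil
  then show ?case by (simp add: cross_sgn_def)
next
  case (Cons x as)
  let ?S = "set (filter P as)" and ?T = "set (filter (\<lambda>a. \<not> P a) as)"
  have lt: "x < a" if "a \<in> set as" for a using that Cons.prems by auto
  have dist: "distinct as" using Cons.prems by (simp add: strict_sorted_iff)
  have xnot: "x \<notin> set as" using lt by auto
  have prod: "(\<Prod>u\<leftarrow>map c (filter Q as). sgn_pair (c x) u) = (\<Prod>t\<in>set (filter Q as). sgn_pair (c x) (c t))"
    for Q using dist prod.distinct_set_conv_list[of "filter Q as" "\<lambda>t. sgn_pair (c x) (c t)"]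
    by (simp add: comp_def)
  have split: "(\<Prod>u\<leftarrow>map c as. sgn_pair (c x) u) =
     (\<Prod>u\<leftarrow>map c (filter P as). sgn_pair (c x) u) * (\<Prod>u\<leftarrow>map c (filter (\<lambda>a. \<not> P a) as). sgn_pair (c x) u)"
    by (induction as) auto
  have IH: "cross_sgn c ?S ?T * word_sgn (map c (filter P as)) *
      word_sgn (map c (filter (\<lambda>a. \<not> P a) as)) = word_sgn (map c as)"
    using Cons by simp
  show ?case
  proof (cases "P x")
    case True
    have "cross_sgn c (insert x ?S) ?T = (\<Prod>t\<in>?T. sgn_pair (c x) (c t)) * cross_sgn c ?S ?T"
    proof -
      have "x \<notin> ?S" using xnot by auto
      moreover have "(\<Prod>t\<in>?T. sgn_pair (c (min x t)) (c (max x t))) = (\<Prod>t\<in>?T. sgn_pair (c x) (c t))"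
        by (rule prod.cong) (auto simp: min_absorb1 max_absorb2 less_imp_le lt)
      ultimately show ?thesis by (simp add: cross_sgn_def)
    qed
    thus ?thesis using True IH split prod[of "\<lambda>a. \<not> P a"] by simp
  next
    case False
    have "(\<Prod>t\<in>insert x ?T. sgn_pair (c (min s t)) (c (max s t))) =
        sgn_pair (c x) (c s) * (\<Prod>t\<in>?T. sgn_pair (c (min s t)) (c (max s t)))" if "s \<in> ?S" for s
      using that xnot lt[of s] by (simp add: min_def max_def)
    hence "cross_sgn c ?S (insert x ?T) = (\<Prod>s\<in>?S. sgn_pair (c x) (c s)) * cross_sgn c ?S ?T"
      by (simp add: cross_sgn_def prod.distrib)
    thus ?thesis using False IH split prod[of P] by simp
  qed
qed

lemma word_sgn_square: "word_sgn vs * word_sgn vs = 1"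
proof (induction vs)
  case (Cons v vs)
  have "(\<Prod>u\<leftarrow>vs. sgn_pair v u) * (\<Prod>u\<leftarrow>vs. sgn_pair v u) = 1"
    by (induction vs) (auto simp: sgn_pair_def algebra_simps simp flip: power_add mult_2)
  then show ?case using Cons by (simp add: algebra_simps)
qed simp

lemma cross_sgn_eq:
  assumes "finite S" "finite T" "S \<inter> T = {}"
  shows "cross_sgn c S T = word_sgn (map c (sorted_list_of_set (S \<union> T))) *
    word_sgn (map c (sorted_list_of_set S)) * word_sgn (map c (sorted_list_of_set T))"
proof -
  have "{a \<in> S \<union> T. a \<in> S} = S" "{a \<in> S \<union> T. a \<notin> S} = T" using assms(3) by auto
  hence f: "filter (\<lambda>a. a \<in> S) (sorted_list_of_set (S \<union> T)) = sorted_list_of_set S"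
    "filter (\<lambda>a. a \<notin> S) (sorted_list_of_set (S \<union> T)) = sorted_list_of_set T"
    using assms(1,2) by (simp_all add: filter_sorted_list_of_set)
  have *: "cross_sgn c S T * word_sgn (map c (sorted_list_of_set S)) *
      word_sgn (map c (sorted_list_of_set T)) = word_sgn (map c (sorted_list_of_set (S \<union> T)))"
    using cross_sgn_filter[of "sorted_list_of_set (S \<union> T)" c "\<lambda>a. a \<in> S"] assms(1,2) f by simp
  show ?thesis unfolding *[symmetric]
    using word_sgn_square[of "map c (sorted_list_of_set S)"]
      word_sgn_square[of "map c (sorted_list_of_set T)"]
    by (metis (no_types, lifting) mult.assoc mult.commute mult.right_neutral)
qed

lemma map_snd_label_word: "map snd (label_word c A e) = map c (sorted_list_of_set A)"
  by (simp add: label_word_def label_letter_def comp_def)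

lemma mcoeff_realize_times_nonzero:
  assumes "mcoeff (realize \<phi> c S * realize \<psi> c T) e \<noteq> 0"
  obtains e1 e2 where "e = e1 + e2" "keys e1 \<subseteq> S" "keys e2 \<subseteq> T"
    "\<phi> (letters c S e1) \<noteq> 0" "\<psi> (letters c T e2) \<noteq> 0"
proof -
  obtain e1 e2 where "e1 + e2 = e" "mcoeff (realize \<phi> c S) e1 \<noteq> 0" "mcoeff (realize \<psi> c T) e2 \<noteq> 0"
    using assms by (rule mcoeff_times_nonzero)
  thus ?thesis using that[of e1 e2] by (auto simp: mcoeff_realize split: if_splits)
qed

lemma conv_term_nonzero:
  assumes "mcoeff (realize \<phi> c S * realize \<psi> c T * kernel c S T) e \<noteq> 0"
  obtains e1 e2 k where "e = e1 + e2 + k" "keys e1 \<subseteq> S" "keys e2 \<subseteq> T"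
    "\<phi> (letters c S e1) \<noteq> 0" "\<psi> (letters c T e2) \<noteq> 0" "mcoeff (kernel c S T) k \<noteq> 0"
proof -
  obtain d k where "d + k = e" "mcoeff (realize \<phi> c S * realize \<psi> c T) d \<noteq> 0"
    "mcoeff (kernel c S T) k \<noteq> 0"
    using assms by (rule mcoeff_times_nonzero)
  thus ?thesis using that by (metis mcoeff_realize_times_nonzero)
qed

lemma conv_nonzero:
  assumes "mcoeff (conv \<phi> \<psi> c A) e \<noteq> 0"
  obtains S where "S \<subseteq> A"
    "mcoeff (realize \<phi> c S * realize \<psi> c (A - S) * kernel c S (A - S)) e \<noteq> 0"
proof -
  have "\<exists>S\<in>Pow A. mcoeff (realize \<phi> c S * realize \<psi> c (A - S) * kernel c S (A - S)) e \<noteq> 0"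
    using assms unfolding conv_def mcoeff_sum by (meson sum.neutral)
  thus ?thesis using that by auto
qed

text \<open>A term can fall short of the maximal shuffle in two ways: through a kernel monomial
  above the lowest one, or through a factor whose word is not its leading word. Equality excludes
  both.\<close>

lemma label_word_le_max_shuffle:
  assumes fin: "finite S" "finite T" "S \<inter> T = {}"
    and lead: "lead \<phi> u" "lead \<psi> v"
    and size: "\<And>M. \<phi> M \<noteq> 0 \<Longrightarrow> size M = length u" "\<And>M. \<psi> M \<noteq> 0 \<Longrightarrow> size M = length v"
    and max: "\<And>w. w \<in> shuffles u v \<Longrightarrow> w \<le> wm"
    and e: "keys e1 \<subseteq> S" "keys e2 \<subseteq> T"
    and nz: "\<phi> (letters c S e1) \<noteq> 0" "\<psi> (letters c T e2) \<noteq> 0" "mcoeff (kernel c S T) k \<noteq> 0"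
  shows "label_word c (S \<union> T) (e1 + e2 + k) \<le> wm"
    and "label_word c (S \<union> T) (e1 + e2 + k) = wm \<Longrightarrow>
      k = cross_exp c S T \<and> label_word c S e1 = u \<and> label_word c T e2 = v"
proof -
  let ?k = "cross_exp c S T" and ?w = "label_word c (S \<union> T)"
  have "\<not> k < ?k" using lowest_kernel[OF fin, of c] nz(3) by (auto simp: lowest_def)
  hence "?k \<le> k" by simp
  have keys: "keys (e1 + e2 + k) \<subseteq> S \<union> T"
  proof -
    have "keys k \<subseteq> S \<union> T" using vars_in_kernel[of S "S \<union> T" T c] nz(3) by (auto simp: vars_in_def)
    thus ?thesis using e keys_add[of "e1 + e2" k] keys_add[of e1 e2] by blast
  qed
  have le1: "?w (e1 + e2 + k) \<le> ?w (e1 + e2 + ?k)"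
    and eq1: "?w (e1 + e2 + k) = ?w (e1 + e2 + ?k) \<Longrightarrow> k = ?k"
  proof -
    have *: "?w (e1 + e2 + k) < ?w (e1 + e2 + ?k)" if "k \<noteq> ?k"
    proof (rule label_word_less[OF _ keys])
      show "e1 + e2 + ?k < e1 + e2 + k" using that \<open>?k \<le> k\<close> by (intro add_strict_left_mono) simp
    qed (use fin in auto)
    show "?w (e1 + e2 + k) \<le> ?w (e1 + e2 + ?k)"
      using * by (cases "k = ?k") (simp_all add: less_imp_le)
    show "k = ?k" if "?w (e1 + e2 + k) = ?w (e1 + e2 + ?k)"
      using * that by fastforce
  qed
  have word_le: "label_word c X d \<le> w"
    if "finite X" "lead \<xi> w" "\<xi> (letters c X d) \<noteq> 0" for X d w \<xi>
  proof -
    have "\<xi> (mset (label_list c X d)) \<noteq> 0" using that by (simp add: mset_label_list)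
    hence "encn (label_list c X d) \<le> w" using that(2) unfolding lead_def by blast
    thus ?thesis using that(1) by (simp add: encn_label_list)
  qed
  have u: "label_word c S e1 \<le> u" "length (label_word c S e1) = length u"
    using word_le[OF fin(1) lead(1) nz(1)] size(1)[OF nz(1)] fin(1)
    by (simp_all add: length_label_word size_letters)
  have v: "label_word c T e2 \<le> v" "length (label_word c T e2) = length v"
    using word_le[OF fin(2) lead(2) nz(2)] size(2)[OF nz(2)] fin(2)
    by (simp_all add: length_label_word size_letters)
  obtain w where w: "w \<in> shuffles u v" "?w (e1 + e2 + ?k) \<le> w"
    "?w (e1 + e2 + ?k) = w \<longrightarrow> label_word c S e1 = u \<and> label_word c T e2 = v"
    using shuffles_mono[OF label_word_merge[OF fin e, of c] u(1) v(1) u(2) v(2)] by blast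
  have "w \<le> wm" by (rule max) (rule w)
  thus "?w (e1 + e2 + k) \<le> wm" using order.trans[OF le1 w(2)] by (rule order.trans[rotated])
  show "k = ?k \<and> label_word c S e1 = u \<and> label_word c T e2 = v" if "?w (e1 + e2 + k) = wm"
  proof -
    have "?w (e1 + e2 + ?k) = wm"
      using that le1 order.trans[OF w(2) \<open>w \<le> wm\<close>] by (intro order.antisym) simp_all
    moreover from this have "w = wm" using w(2) \<open>w \<le> wm\<close> by (intro order.antisym) simp_all
    moreover have "k = ?k" by (rule eq1) (simp add: that calculation)
    ultimately show ?thesis using w(3) by blast
  qed
qed

text \<open>The value involves only the words and not \<open>S\<close> and \<open>T\<close>.
  Contributions of different splittings to a leading monomial are therefore equal and cannot
  cancel.\<close>

lemma conv_term_eq: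
  assumes fin: "finite S" "finite T" "S \<inter> T = {}"
    and lead: "lead \<phi> u" "lead \<psi> v"
    and size: "\<And>M. \<phi> M \<noteq> 0 \<Longrightarrow> size M = length u" "\<And>M. \<psi> M \<noteq> 0 \<Longrightarrow> size M = length v"
    and max: "\<And>w. w \<in> shuffles u v \<Longrightarrow> w \<le> wm"
    and e: "keys e1 \<subseteq> S" "keys e2 \<subseteq> T" "e = e1 + e2 + cross_exp c S T"
    and wd: "label_word c S e1 = u" "label_word c T e2 = v" "label_word c (S \<union> T) e = wm"
    and xs: "encn xs = u" "encn ys = v"
  shows "mcoeff (realize \<phi> c S * realize \<psi> c T * kernel c S T) e =
    \<phi> (mset xs) * \<psi> (mset ys) *
      (word_sgn (map snd wm) * word_sgn (map snd u) * word_sgn (map snd v))"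
proof -
  let ?k = "cross_exp c S T" and ?P = "realize \<phi> c S * realize \<psi> c T"
  have "mcoeff (?P * kernel c S T) e =
      (\<Sum>(\<beta>, k)\<in>{(e1 + e2, ?k)}. mcoeff ?P \<beta> * mcoeff (kernel c S T) k)"
    unfolding mcoeff_times[of ?P]
  proof (rule sum.mono_neutral_right)
    show "\<forall>x\<in>splits e - {(e1 + e2, ?k)}. (case x of (\<beta>, k) \<Rightarrow> mcoeff ?P \<beta> * mcoeff (kernel c S T) k) = 0"
    proof (rule ballI, rule ccontr)
      fix x assume x: "x \<in> splits e - {(e1 + e2, ?k)}"
        "(case x of (\<beta>, k) \<Rightarrow> mcoeff ?P \<beta> * mcoeff (kernel c S T) k) \<noteq> 0"
      obtain \<beta> k where "x = (\<beta>, k)" by (cases x)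
      with x have *: "(\<beta>, k) \<in> splits e" "(\<beta>, k) \<noteq> (e1 + e2, ?k)"
        "mcoeff ?P \<beta> * mcoeff (kernel c S T) k \<noteq> 0" by auto
      hence "mcoeff ?P \<beta> \<noteq> 0" "mcoeff (kernel c S T) k \<noteq> 0" by auto
      then obtain d1 d2 where d: "\<beta> = d1 + d2" "keys d1 \<subseteq> S" "keys d2 \<subseteq> T"
        "\<phi> (letters c S d1) \<noteq> 0" "\<psi> (letters c T d2) \<noteq> 0"
        by (metis mcoeff_realize_times_nonzero)
      have "label_word c (S \<union> T) (d1 + d2 + k) = wm" using * d wd by simp
      hence "k = ?k"
        using label_word_le_max_shuffle(2)[OF fin lead size max d(2-5)] * by auto
      moreover have "\<beta> + k = e" using * by simp
      ultimately have "\<beta> = e1 + e2" using e by simp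
      thus False using * \<open>k = ?k\<close> by simp
    qed
  qed (use e in auto)
  also have "\<dots> = mcoeff ?P (e1 + e2) * cross_sgn c S T"
    using lowest_kernel[OF fin, of c] by (simp add: lowest_def)
  also have "mcoeff ?P (e1 + e2) = (\<Sum>(\<beta>, \<gamma>)\<in>{(e1, e2)}. mcoeff (realize \<phi> c S) \<beta> * mcoeff (realize \<psi> c T) \<gamma>)"
    unfolding mcoeff_times
  proof (rule sum.mono_neutral_right)
    show "\<forall>x\<in>splits (e1 + e2) - {(e1, e2)}.
        (case x of (\<beta>, \<gamma>) \<Rightarrow> mcoeff (realize \<phi> c S) \<beta> * mcoeff (realize \<psi> c T) \<gamma>) = 0"
    proof (rule ballI, rule ccontr)
      fix x assume x: "x \<in> splits (e1 + e2) - {(e1, e2)}"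
        "(case x of (\<beta>, \<gamma>) \<Rightarrow> mcoeff (realize \<phi> c S) \<beta> * mcoeff (realize \<psi> c T) \<gamma>) \<noteq> 0"
      obtain \<beta> \<gamma> where "x = (\<beta>, \<gamma>)" by (cases x)
      with x have *: "(\<beta>, \<gamma>) \<in> splits (e1 + e2)" "(\<beta>, \<gamma>) \<noteq> (e1, e2)"
        "mcoeff (realize \<phi> c S) \<beta> * mcoeff (realize \<psi> c T) \<gamma> \<noteq> 0" by auto
      hence k: "keys \<beta> \<subseteq> S" "keys \<gamma> \<subseteq> T" by (auto simp: mcoeff_realize split: if_splits)
      have sum: "\<beta> + \<gamma> = e1 + e2" using * by simp
      have "lookup \<beta> a = lookup e1 a" for a
      proof (cases "a \<in> S")
        case True
        hence "lookup \<gamma> a = 0" "lookup e2 a = 0"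
          using k e fin(3) by (auto simp: in_keys_iff subset_iff disjoint_iff)
        thus ?thesis using arg_cong[OF sum, of "\<lambda>x. lookup x a"] by (simp add: lookup_add)
      next
        case False
        hence "lookup \<beta> a = 0" "lookup e1 a = 0" using k e by (auto simp: in_keys_iff subset_iff)
        thus ?thesis by simp
      qed
      hence "\<beta> = e1" by (rule poly_mapping_eqI)
      thus False using * sum by simp
    qed
  qed auto
  also have "\<dots> = \<phi> (mset xs) * \<psi> (mset ys)"
  proof -
    have "label_list c S e1 = xs" "label_list c T e2 = ys"
      using wd xs fin by (metis encn_label_list encn_inject)+
    hence "letters c S e1 = mset xs" "letters c T e2 = mset ys"
      using fin by (metis mset_label_list)+
    thus ?thesis using e by (simp add: mcoeff_realize)
  qed
  also have "cross_sgn c S T = word_sgn (map snd wm) * word_sgn (map snd u) * word_sgn (map snd v)"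
    unfolding cross_sgn_eq[OF fin] by (simp flip: wd add: map_snd_label_word)
  finally show ?thesis .
qed

lemma label_word_lessThan_append:
  assumes "keys e1 \<subseteq> {..<k}" "keys e2 \<subseteq> {k..<k + n}"
  shows "label_word c ({..<k} \<union> {k..<k + n}) (e1 + e2 + cross_exp c {..<k} {k..<k + n}) =
    label_word c {..<k} e1 @ label_word c {k..<k + n} e2"
proof -
  have sl: "sorted_list_of_set ({..<k} \<union> {k..<k + n}) =
      sorted_list_of_set {..<k} @ sorted_list_of_set {k..<k + n}"
  proof -
    have "{..<k} \<union> {k..<k + n} = {0..<k + n}" "{..<k} = {0..<k}" by auto
    thus ?thesis by (simp only: sorted_list_of_set_range upt_add_eq_append[of 0 k n, OF le0])
  qed
  have fin: "finite {..<k}" "finite {k..<k + n}" "{..<k} \<inter> {k..<k + n} = {}" by auto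
  show ?thesis unfolding label_word_def sl map_append
    by (intro arg_cong2[where f = "(@)"] map_cong refl label_letter_merge[OF fin assms]) auto
qed

lemma label_list_shift:
  assumes "\<And>i. i < length xs \<Longrightarrow> c (k + i) = fst (xs ! i)"
    "\<And>i. i < length xs \<Longrightarrow> lookup e (k + i) = snd (xs ! i)"
  shows "label_list c {k..<k + length xs} e = xs"
  using assms by (intro nth_equalityI) (auto simp: label_list_def)

text \<open>The upper bound is \<open>label_word_le_max_shuffle\<close> applied to each splitting.
  The bound is attained because every splitting that contributes to the chosen monomial contributes
  the same nonzero \<open>X\<close>.\<close>

theorem lead_star:
  assumes lead: "lead \<phi> u" "lead \<psi> v"
    and size: "\<And>M. \<phi> M \<noteq> 0 \<Longrightarrow> size M = length u" "\<And>M. \<psi> M \<noteq> 0 \<Longrightarrow> size M = length v"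
    and max: "\<And>w. w \<in> shuffles u v \<Longrightarrow> w \<le> u @ v"
  shows "lead (\<phi> \<star> \<psi>) (u @ v)"
  unfolding lead_def
proof (intro conjI allI impI)
  fix zs assume nz: "(\<phi> \<star> \<psi>) (mset zs) \<noteq> 0"
  let ?A = "{0..<0 + length zs}"
  define e where "e = Poly_Mapping.nth (map snd zs)"
  define c where "c = (\<lambda>i. fst (zs ! i))"
  have look: "lookup e k = (if k < length zs then snd (zs ! k) else 0)" for k
    by (simp add: e_def nth.rep_eq nth_default_def)
  have list: "label_list c ?A e = zs" by (rule label_list_shift) (auto simp: c_def look)
  have keys: "keys e \<subseteq> ?A" by (auto simp: in_keys_iff look split: if_splits)
  have "mcoeff (conv \<phi> \<psi> c ?A) e = (\<phi> \<star> \<psi>) (mset zs)"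
    using keys mset_label_list[of ?A c e] list
    by (simp add: mcoeff_realize flip: realize_star)
  with nz obtain S where S: "S \<subseteq> ?A"
    "mcoeff (realize \<phi> c S * realize \<psi> c (?A - S) * kernel c S (?A - S)) e \<noteq> 0"
    by (metis conv_nonzero)
  then obtain e1 e2 k where *: "e = e1 + e2 + k" "keys e1 \<subseteq> S" "keys e2 \<subseteq> ?A - S"
    "\<phi> (letters c S e1) \<noteq> 0" "\<psi> (letters c (?A - S) e2) \<noteq> 0" "mcoeff (kernel c S (?A - S)) k \<noteq> 0"
    by (metis conv_term_nonzero)
  have fin: "finite S" "finite (?A - S)" "S \<inter> (?A - S) = {}" "S \<union> (?A - S) = ?A"
    using S finite_subset by auto
  have "label_word c ?A e \<le> u @ v"
    using label_word_le_max_shuffle(1)[OF fin(1-3) lead size max *(2-6)] *(1) fin(4) by simp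
  moreover have "label_word c ?A e = encn zs" using encn_label_list[of ?A c e] list by simp
  ultimately show "encn zs \<le> u @ v" by simp
next
  obtain xs where xs: "\<phi> (mset xs) \<noteq> 0" "encn xs = u" using lead(1) by (auto simp: lead_def)
  obtain ys where ys: "\<psi> (mset ys) \<noteq> 0" "encn ys = v" using lead(2) by (auto simp: lead_def)
  let ?k = "length xs"
  \<comment> \<open>Labels follow the order of \<open>xs @ ys\<close>, so that the shuffle produced
    by the splitting into \<open>?S\<close> and \<open>?T\<close> is \<open>u @ v\<close>
    itself.\<close>
  let ?S = "{..<?k}" and ?T = "{?k..<?k + length ys}"
  define c where "c = (\<lambda>i. fst ((xs @ ys) ! i))"
  define e1 where "e1 = Poly_Mapping.nth (map snd xs)"
  define e2 where "e2 = Poly_Mapping.nth (replicate ?k 0 @ map snd ys)"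
  have look1: "lookup e1 a = (if a < ?k then snd (xs ! a) else 0)" for a
    by (simp add: e1_def nth.rep_eq nth_default_def)
  have look2: "lookup e2 a = (if ?k \<le> a \<and> a < ?k + length ys then snd (ys ! (a - ?k)) else 0)" for a
    by (auto simp: e2_def nth.rep_eq nth_default_def nth_append)
  have keys: "keys e1 \<subseteq> ?S" "keys e2 \<subseteq> ?T"
    by (auto simp: in_keys_iff look1 look2 split: if_splits)
  have fin: "finite ?S" "finite ?T" "?S \<inter> ?T = {}" by auto
  have "label_list c {0..<0 + ?k} e1 = xs"
    by (rule label_list_shift) (auto simp: look1 c_def nth_append)
  hence "label_list c ?S e1 = xs" by (simp add: lessThan_atLeast0)
  hence w1: "label_word c ?S e1 = u" using encn_label_list[of ?S c e1] xs by simp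
  have "label_list c ?T e2 = ys"
    by (rule label_list_shift) (auto simp: look2 c_def nth_append)
  hence w2: "label_word c ?T e2 = v" using encn_label_list[of ?T c e2] ys by simp
  define e where "e = e1 + e2 + cross_exp c ?S ?T"
  define A where "A = ?S \<union> ?T"
  have A: "finite A" by (simp add: A_def)
  have w: "label_word c A e = u @ v"
    unfolding e_def A_def using label_word_lessThan_append[OF keys, of c] w1 w2 by simp
  define X where "X = \<phi> (mset xs) * \<psi> (mset ys) *
    (word_sgn (map snd (u @ v)) * word_sgn (map snd u) * word_sgn (map snd v))"
  have "word_sgn vs \<noteq> 0" for vs using word_sgn_square[of vs] by auto
  hence X: "X \<noteq> 0" using xs ys by (auto simp: X_def)
  define t where "t = (\<lambda>S. mcoeff (realize \<phi> c S * realize \<psi> c (A - S) * kernel c S (A - S)) e)"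
  have t0: "t ?S = X"
  proof -
    have "A - ?S = ?T" by (auto simp: A_def)
    thus ?thesis unfolding t_def X_def
      using conv_term_eq[OF fin lead size max keys e_def w1 w2 w[unfolded A_def] xs(2) ys(2)] by simp
  qed
  have t: "t S = X" if nonzero: "t S \<noteq> 0" and S: "S \<subseteq> A" for S
  proof -
    have fin': "finite S" "finite (A - S)" "S \<inter> (A - S) = {}" "S \<union> (A - S) = A"
      using S A by (auto intro: finite_subset)
    obtain d1 d2 k where d: "e = d1 + d2 + k" "keys d1 \<subseteq> S" "keys d2 \<subseteq> A - S"
      "\<phi> (letters c S d1) \<noteq> 0" "\<psi> (letters c (A - S) d2) \<noteq> 0" "mcoeff (kernel c S (A - S)) k \<noteq> 0"
      using nonzero unfolding t_def by (rule conv_term_nonzero)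
    have "label_word c (S \<union> (A - S)) (d1 + d2 + k) = u @ v"
      by (simp only: fin'(4) w flip: d(1))
    from label_word_le_max_shuffle(2)[OF fin'(1-3) lead size max d(2-6) this]
    have d': "k = cross_exp c S (A - S)" "label_word c S d1 = u" "label_word c (A - S) d2 = v"
      by blast+
    have "e = d1 + d2 + cross_exp c S (A - S)" using d(1) by (simp only: d'(1))
    moreover have "label_word c (S \<union> (A - S)) e = u @ v" by (simp only: fin'(4) w)
    ultimately show ?thesis unfolding t_def X_def
      by (intro conv_term_eq[OF fin'(1-3) lead size max d(2,3) _ d'(2,3) _ xs(2) ys(2)])
  qed
  \<comment> \<open>The splitting into \<open>?S\<close> and \<open>?T\<close> is counted here, so
    \<open>n\<close> is positive, and characteristic 0 keeps \<open>of_nat n * X\<close>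
    nonzero.\<close>
  define n where "n = card {S\<in>Pow A. t S \<noteq> 0}"
  have "mcoeff (conv \<phi> \<psi> c A) e = (\<Sum>S\<in>Pow A. t S)"
    by (simp add: conv_def mcoeff_sum t_def)
  also have "\<dots> = (\<Sum>S\<in>{S\<in>Pow A. t S \<noteq> 0}. t S)"
    using A by (intro sum.mono_neutral_right) auto
  also have "\<dots> = (\<Sum>S\<in>{S\<in>Pow A. t S \<noteq> 0}. X)"
    by (intro sum.cong refl) (use t in auto)
  finally have sum: "mcoeff (conv \<phi> \<psi> c A) e = of_nat n * X" by (simp add: n_def)
  have "?S \<in> {S\<in>Pow A. t S \<noteq> 0}" using t0 X by (auto simp: A_def)
  moreover have "finite {S\<in>Pow A. t S \<noteq> 0}"
    by (rule finite_subset[of _ "Pow A"]) (use A in auto)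
  ultimately have "n \<noteq> 0" unfolding n_def by (metis card_0_eq empty_iff)
  hence nz: "mcoeff (realize (\<phi> \<star> \<psi>) c A) e \<noteq> 0" using X A sum by (simp add: realize_star)
  have "(\<phi> \<star> \<psi>) (letters c A e) \<noteq> 0" using nz by (auto simp: mcoeff_realize split: if_splits)
  hence "(\<phi> \<star> \<psi>) (mset (label_list c A e)) \<noteq> 0" using A by (simp add: mset_label_list)
  thus "\<exists>zs. (\<phi> \<star> \<psi>) (mset zs) \<noteq> 0 \<and> encn zs = u @ v"
    using w A encn_label_list[of A c e] by (intro exI[of _ "label_list c A e"]) auto
qed

end

section \<open>Freeness over Lyndon words\<close>

interpretation fvs: vector_space "fscale :: rat \<Rightarrow> ('x \<Rightarrow> rat) \<Rightarrow> 'x \<Rightarrow> rat"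
  by unfold_locales (auto simp: fscale_def fun_eq_iff algebra_simps)

lemma sum_fun_apply: "(\<Sum>i\<in>I. f i) x = (\<Sum>i\<in>I. f i x)"
  by (induction I rule: infinite_finite_induct) auto

text \<open>Independence of an indexed family forces \<open>v\<close> to be injective, after which
  the usual bound for sets of vectors applies.\<close>

lemma fvs_family_card_le:
  fixes v :: "'i \<Rightarrow> 'x \<Rightarrow> rat"
  assumes fin: "finite I" "finite T"
    and span: "\<And>i. i \<in> I \<Longrightarrow> v i \<in> fvs.span T"
    and indep: "\<And>c i. (\<Sum>i\<in>I. fscale (c i) (v i)) = 0 \<Longrightarrow> i \<in> I \<Longrightarrow> c i = 0"
  shows "card I \<le> card T"
proof -
  have inj: "inj_on v I"
  proof (rule inj_onI, rule ccontr)
    fix i j assume ij: "i \<in> I" "j \<in> I" "v i = v j" "i \<noteq> j"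
    define c where "c = (\<lambda>k. if k = i then 1 else if k = j then -1 else 0 :: rat)"
    have "(\<Sum>k\<in>I. fscale (c k) (v k)) = (\<Sum>k\<in>{i, j}. fscale (c k) (v k))"
      using fin ij by (intro sum.mono_neutral_right) (auto simp: c_def fscale_def fun_eq_iff)
    also have "\<dots> = 0" using ij by (simp add: c_def fscale_def fun_eq_iff)
    finally have "c i = 0" using indep ij(1) by blast
    thus False by (simp add: c_def)
  qed
  have "fvs.independent (v ` I)"
  proof (rule ccontr)
    assume "\<not> fvs.independent (v ` I)"
    then obtain c x where c: "x \<in> v ` I" "c x \<noteq> 0" "(\<Sum>x\<in>v ` I. fscale (c x) x) = 0"
      using fin fvs.dependent_finite[of "v ` I"] by auto
    hence "(\<Sum>i\<in>I. fscale (c (v i)) (v i)) = 0" using inj by (simp add: sum.reindex)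
    thus False using indep[of "\<lambda>i. c (v i)"] c by auto
  qed
  hence "card (v ` I) \<le> card T"
    using fvs.independent_span_bound[of T "v ` I"] fin span by auto
  thus ?thesis using inj by (simp add: card_image)
qed

lemma fvs_span_image_obtain:
  fixes v :: "'i \<Rightarrow> 'x \<Rightarrow> rat"
  assumes "finite I" "x \<in> fvs.span (v ` I)"
  obtains c where "x = (\<Sum>i\<in>I. fscale (c i) (v i))"
proof -
  from assms(2) have "\<exists>c. x = (\<Sum>i\<in>I. fscale (c i) (v i))"
  proof (induction rule: fvs.span_induct_alt)
    case base
    show ?case by (rule exI[of _ "\<lambda>_. 0"]) (auto simp: fscale_def fun_eq_iff sum_fun_apply)
  next
    case (step r x y)
    then obtain i c where i: "i \<in> I" "x = v i" and c: "y = (\<Sum>i\<in>I. fscale (c i) (v i))" by auto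
    have "(\<Sum>j\<in>I. fscale (if j = i then r else 0) (v j)) = (\<Sum>j\<in>{i}. fscale (if j = i then r else 0) (v j))"
      using i assms(1) by (intro sum.mono_neutral_right) (auto simp: fscale_def fun_eq_iff)
    hence "fscale r x + y = (\<Sum>j\<in>I. fscale (if j = i then r else 0) (v j)) + (\<Sum>j\<in>I. fscale (c j) (v j))"
      by (simp add: i c)
    also have "\<dots> = (\<Sum>j\<in>I. fscale ((if j = i then r else 0) + c j) (v j))"
      by (simp add: fvs.scale_left_distrib sum.distrib)
    finally show ?case by (rule exI[where x = "\<lambda>j. (if j = i then r else 0) + c j"])
  qed
  thus ?thesis using that by blast
qed

lemma sum_mset_nonzero_obtain:
  assumes "(\<Sum>l\<in>#M. f l) \<noteq> 0"
  obtains l where "l \<in># M" "f l \<noteq> 0"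
proof -
  have "\<exists>l\<in>#M. f l \<noteq> 0" using assms by (induction M) auto
  thus ?thesis using that by blast
qed

lemma raise_deg_add: "raise_deg (\<phi> + \<psi>) = raise_deg \<phi> + raise_deg \<psi>"
proof
  fix M
  show "raise_deg (\<phi> + \<psi>) M = (raise_deg \<phi> + raise_deg \<psi>) M"
    unfolding raise_deg_def plus_fun_apply sum_mset.distrib[symmetric]
    by (intro arg_cong[where f = sum_mset] image_mset_cong) simp
qed

lemma raise_deg_scale: "raise_deg (fscale r \<phi>) = fscale r (raise_deg \<phi>)"
proof
  fix M
  show "raise_deg (fscale r \<phi>) M = fscale r (raise_deg \<phi>) M"
    unfolding raise_deg_def fscale_def sum_mset_distrib_left
    by (intro arg_cong[where f = sum_mset] image_mset_cong) simp
qed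

lemma lower_deg_add: "lower_deg (\<phi> + \<psi>) = lower_deg \<phi> + lower_deg \<psi>"
  by (simp add: fun_eq_iff lower_deg_def distrib_left sum_mset.distrib)

lemma lower_deg_scale: "lower_deg (fscale r \<phi>) = fscale r (lower_deg \<phi>)"
  by (simp add: fun_eq_iff lower_deg_def fscale_def sum_mset_distrib_left mult.left_commute)

lemma raise_deg_0: "raise_deg 0 = 0"
  using raise_deg_add[of 0 0] by simp

lemma raise_deg_sum: "finite I \<Longrightarrow> raise_deg (\<Sum>i\<in>I. f i) = (\<Sum>i\<in>I. raise_deg (f i))"
proof (induction I rule: finite_induct)
  case (insert x F)
  show ?case unfolding sum.insert[OF insert.hyps] raise_deg_add insert.IH ..
qed (simp only: sum.empty raise_deg_0)

lemma finite_msets_of_size: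
  assumes "finite X"
  shows "finite {M. set_mset M \<subseteq> X \<and> size M \<le> n}"
proof (rule finite_subset)
  show "{M. set_mset M \<subseteq> X \<and> size M \<le> n} \<subseteq> mset ` {xs. set xs \<subseteq> X \<and> length xs \<le> n}"
  proof
    fix M assume M: "M \<in> {M. set_mset M \<subseteq> X \<and> size M \<le> n}"
    obtain xs where "mset xs = M" using ex_mset by blast
    thus "M \<in> mset ` {xs. set xs \<subseteq> X \<and> length xs \<le> n}" using M by force
  qed
  show "finite (mset ` {xs. set xs \<subseteq> X \<and> length xs \<le> n})"
    using finite_lists_length_le[OF assms] by simp
qed

text \<open>\<open>Qf\<close> is a quadratic function of the colour content with polarisation
  \<open>m\<close>. Subtracting it from the total degree absorbs the degree of the kernel.\<close>

locale graded_link = link +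
  fixes Qf :: "'a multiset \<Rightarrow> int"
  assumes Qf_add: "Qf (\<gamma> + \<gamma>') = Qf \<gamma> + Qf \<gamma>' + int (\<Sum>i\<in>#\<gamma>. \<Sum>j\<in>#\<gamma>'. m i j)"
begin

section \<open>The grading by colour content and shifted degree\<close>

lemma Qf_empty [simp]: "Qf {#} = 0"
  using Qf_add[of "{#}" "{#}"] by simp

definition grade :: "('a \<times> nat) multiset \<Rightarrow> int" where
  "grade M = int (\<Sum>l\<in>#M. snd l) - Qf (image_mset fst M)"

definition wcont :: "(int \<times> 'a) list \<Rightarrow> 'a multiset" where
  "wcont w = image_mset snd (mset w)"

text \<open>The grade read off letter by letter, see \<open>wgrade_encn\<close>: the shifts in the
  letters add up to the mixed terms of \<open>Qf\<close>, so that only its values on single colours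
  remain to be subtracted. This makes the grade additive under concatenation.\<close>

definition wgrade :: "(int \<times> 'a) list \<Rightarrow> int" where
  "wgrade w = (\<Sum>x\<leftarrow>w. - fst x - Qf {#snd x#})"

definition homs :: "'a multiset \<Rightarrow> int \<Rightarrow> (('a \<times> nat) multiset \<Rightarrow> rat) set" where
  "homs \<gamma> s = {\<phi>. \<forall>M. \<phi> M \<noteq> 0 \<longrightarrow> image_mset fst M = \<gamma> \<and> grade M = s}"

lemma homsD: "\<phi> \<in> homs \<gamma> s \<Longrightarrow> \<phi> M \<noteq> 0 \<Longrightarrow> image_mset fst M = \<gamma> \<and> grade M = s"
  by (simp add: homs_def)

lemma wcont_append [simp]: "wcont (u @ v) = wcont u + wcont v"
  by (simp add: wcont_def)

lemma wgrade_append [simp]: "wgrade (u @ v) = wgrade u + wgrade v"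
  by (simp add: wgrade_def)

lemma wcont_encn: "wcont (encn xs) = image_mset fst (mset xs)"
  by (metis map_snd_encn mset_map wcont_def)

lemma wgrade_enc: "wgrade (enc xs) = (\<Sum>x\<leftarrow>xs. snd x) - Qf (mset (map fst xs))"
proof (induction xs rule: rev_induct)
  case (snoc x xs)
  obtain v e where x: "x = (v, e)" by (cases x)
  have "weight xs v = int (\<Sum>i\<in>#mset (map fst xs). m i v)"
  proof (induction xs)
    case (Cons y ys)
    have "weight (y # ys) v = int (m (fst y) v) + weight ys v" by (simp add: weight_def)
    with Cons show ?case by simp
  qed (simp add: weight_def)
  hence "Qf (mset (map fst xs) + {#v#}) = Qf (mset (map fst xs)) + Qf {#v#} + weight xs v"
    using Qf_add[of "mset (map fst xs)" "{#v#}"] by simp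
  moreover have "enc (xs @ [x]) = enc xs @ [(weight xs v - e, v)]"
    by (simp add: enc_append x)
  hence "wgrade (enc (xs @ [x])) = wgrade (enc xs) + (e - weight xs v - Qf {#v#})"
    by (simp add: wgrade_def)
  ultimately show ?case using snoc by (simp add: x)
qed (simp add: wgrade_def)

lemma wgrade_encn: "wgrade (encn xs) = grade (mset xs)"
proof -
  have "(\<Sum>x\<leftarrow>map (apsnd int) xs. snd x) = int (\<Sum>l\<in>#mset xs. snd l)"
    by (induction xs) auto
  thus ?thesis by (simp add: encn_def wgrade_enc grade_def comp_def)
qed

lemma grade_letters:
  assumes "finite A" "keys e \<subseteq> A"
  shows "grade (letters c A e) = int (mdeg e) - Qf (image_mset c (mset_set A))"
proof -
  have "(\<Sum>l\<in>#letters c A e. snd l) = mdeg e"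
    using mdeg_eq_sum[OF assms] by (simp add: sum_mset_letters)
  thus ?thesis by (simp add: grade_def letters_def multiset.map_comp comp_def)
qed

lemma sum_mset_image_mset_set: "(\<Sum>i\<in>#image_mset c (mset_set S). f i) = (\<Sum>s\<in>S. f (c s))"
  by (simp add: multiset.map_comp comp_def sum_unfold_sum_mset)

lemma homog_kernel: "homog (\<Sum>s\<in>S. \<Sum>t\<in>T. m (c s) (c t)) (kernel c S T)"
proof -
  have "homog (m (c s) (c t)) (kernel1 c s t)" for s t
  proof -
    have "homog n ((mvar a - mvar b :: (nat, rat) mpseries) ^ n)" for a b n
      using homog_power[OF homog_mvar_diff, of n a b] by simp
    thus ?thesis by (simp add: kernel1_def)
  qed
  thus ?thesis unfolding kernel_def by (intro homog_prod)
qed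

text \<open>The kernel is homogeneous, and its degree is precisely the mixed term by which
  \<open>Qf\<close> fails to be additive.\<close>

lemma star_homs:
  assumes "\<phi> \<in> homs \<gamma> s" "\<psi> \<in> homs \<gamma>' s'"
  shows "\<phi> \<star> \<psi> \<in> homs (\<gamma> + \<gamma>') (s + s')"
  unfolding homs_def
proof (intro CollectI allI impI)
  fix M assume nz: "(\<phi> \<star> \<psi>) M \<noteq> 0"
  obtain c A e where A: "finite A" "keys e \<subseteq> A" "letters c A e = M" by (rule letters_exists)
  have "mcoeff (conv \<phi> \<psi> c A) e = (\<phi> \<star> \<psi>) M"
    using A by (simp add: mcoeff_realize flip: realize_star)
  with nz obtain S where S: "S \<subseteq> A"
    "mcoeff (realize \<phi> c S * realize \<psi> c (A - S) * kernel c S (A - S)) e \<noteq> 0"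
    by (metis conv_nonzero)
  define T where "T = A - S"
  from S(2) obtain e1 e2 k where *: "e = e1 + e2 + k" "keys e1 \<subseteq> S" "keys e2 \<subseteq> T"
    "\<phi> (letters c S e1) \<noteq> 0" "\<psi> (letters c T e2) \<noteq> 0" "mcoeff (kernel c S T) k \<noteq> 0"
    unfolding T_def by (rule conv_term_nonzero)
  have fin: "finite S" "finite T" "S \<inter> T = {}" "A = S \<union> T"
    using S(1) A(1) finite_subset by (auto simp: T_def)
  have cont: "image_mset c (mset_set S) = \<gamma>" "image_mset c (mset_set T) = \<gamma>'"
    using homsD[OF assms(1) *(4)] homsD[OF assms(2) *(5)]
    by (simp_all add: letters_def multiset.map_comp comp_def)
  have g1: "int (mdeg e1) - Qf \<gamma> = s"
    using homsD[OF assms(1) *(4)] grade_letters[OF fin(1) *(2), of c] cont by simp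
  have g2: "int (mdeg e2) - Qf \<gamma>' = s'"
    using homsD[OF assms(2) *(5)] grade_letters[OF fin(2) *(3), of c] cont by simp
  have mset: "image_mset c (mset_set A) = \<gamma> + \<gamma>'"
    unfolding fin(4) using fin(1-3) cont by (simp add: mset_set_Union)
  have "mdeg k = (\<Sum>s\<in>S. \<Sum>t\<in>T. m (c s) (c t))"
    using homog_kernel[where c = c and S = S and T = T] *(6) by (simp add: homog_def)
  also have "\<dots> = (\<Sum>i\<in>#\<gamma>. \<Sum>j\<in>#\<gamma>'. m i j)"
    unfolding cont[symmetric] by (simp only: sum_mset_image_mset_set)
  finally have "int (mdeg e) - Qf (\<gamma> + \<gamma>') = s + s'"
    using g1 g2 by (simp add: *(1) mdeg_add Qf_add)
  hence "grade M = s + s'" using grade_letters[OF A(1,2), of c] A(3) mset by simp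
  moreover have "image_mset fst M = \<gamma> + \<gamma>'"
    unfolding A(3)[symmetric] letters_def using mset by (simp add: multiset.map_comp comp_def)
  ultimately show "image_mset fst M = \<gamma> + \<gamma>' \<and> grade M = s + s'" by blast
qed

lemma raise_deg_homs:
  assumes "\<phi> \<in> homs \<gamma> s"
  shows "raise_deg \<phi> \<in> homs \<gamma> (s + 1)"
  unfolding homs_def
proof (intro CollectI allI impI)
  fix M assume "raise_deg \<phi> M \<noteq> 0"
  then obtain l where l: "l \<in># M" "snd l \<noteq> 0" "\<phi> (add_mset (fst l, snd l - 1) (M - {#l#})) \<noteq> 0"
    unfolding raise_deg_def by (rule sum_mset_nonzero_obtain) (auto split: if_splits)
  obtain N where N: "M = add_mset l N" using l(1) by (meson multi_member_split)
  obtain v e where ve: "l = (v, Suc e)" using l(2) by (cases l; cases "snd l") auto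
  have "\<phi> (add_mset (v, e) N) \<noteq> 0" using l(3) by (simp add: N ve)
  from homsD[OF assms this] show "image_mset fst M = \<gamma> \<and> grade M = s + 1"
    by (auto simp: N ve grade_def)
qed

lemma lower_deg_homs:
  assumes "\<phi> \<in> homs \<gamma> s"
  shows "lower_deg \<phi> \<in> homs \<gamma> (s - 1)"
  unfolding homs_def
proof (intro CollectI allI impI)
  fix M assume "lower_deg \<phi> M \<noteq> 0"
  then obtain l where l: "l \<in># M" "\<phi> (add_mset (fst l, Suc (snd l)) (M - {#l#})) \<noteq> 0"
    unfolding lower_deg_def by (rule sum_mset_nonzero_obtain) auto
  obtain N where N: "M = add_mset l N" using l(1) by (meson multi_member_split)
  obtain v e where ve: "l = (v, e)" by (cases l)
  have "\<phi> (add_mset (v, Suc e) N) \<noteq> 0" using l(2) by (simp add: N ve)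
  from homsD[OF assms this] show "image_mset fst M = \<gamma> \<and> grade M = s - 1"
    by (auto simp: N ve grade_def)
qed

lemma homs_eq_0:
  assumes "\<phi> \<in> homs \<gamma> s" "s < - Qf \<gamma>"
  shows "\<phi> = 0"
proof
  fix M
  show "\<phi> M = 0 M"
  proof (rule ccontr)
    assume "\<phi> M \<noteq> 0 M"
    hence "image_mset fst M = \<gamma>" "grade M = s" using homsD[OF assms(1), of M] by auto
    hence "s = int (\<Sum>l\<in>#M. snd l) - Qf \<gamma>" by (simp only: grade_def)
    thus False using assms(2) of_nat_0_le_iff[of "\<Sum>l\<in>#M. snd l"] by linarith
  qed
qed

section \<open>Generators attached to words, and their products\<close>

definition dec :: "(int \<times> 'a) list \<Rightarrow> ('a \<times> nat) multiset" where
  "dec w = mset (THE xs. encn xs = w)"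

text \<open>The indicator of one multiset of letters, that is, a coloured monomial symmetric
  polynomial; its leading word is found in \<open>lead_gen\<close>.\<close>

definition gen :: "(int \<times> 'a) list \<Rightarrow> ('a \<times> nat) multiset \<Rightarrow> rat" where
  "gen w M = (if M = dec w then 1 else 0)"

lemma dec_encn [simp]: "dec (encn xs) = mset xs"
  unfolding dec_def by (simp add: encn_inject)

lemma lead_gen:
  assumes "w \<in> Lwords"
  shows "lead (gen w) w"
proof -
  obtain xs where xs: "w = encn xs" "best (map (apsnd int) xs)" using assms by (auto simp: Lwords_def)
  have "encn ys \<le> encn xs" if "mset ys = mset xs" for ys
  proof -
    have "mset (map (apsnd int) ys) = mset (map (apsnd int) xs)" using that by simp
    thus ?thesis using xs(2) unfolding best_def encn_def by blast
  qed
  thus ?thesis using xs(1) by (auto simp: lead_def gen_def)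
qed

lemma gen_homs: "w \<in> Lwords \<Longrightarrow> gen w \<in> homs (wcont w) (wgrade w)"
  by (auto simp: Lwords_def homs_def gen_def wcont_encn wgrade_encn split: if_splits)

sublocale star: comm_monoid_mset star unit
proof unfold_locales
  fix \<phi> \<psi> \<rho> :: "('a \<times> nat) multiset \<Rightarrow> rat"
  show "\<phi> \<star> \<psi> \<star> \<rho> = \<phi> \<star> (\<psi> \<star> \<rho>)" by (rule star_assoc)
  show "\<phi> \<star> \<psi> = \<psi> \<star> \<phi>" by (rule star_commute)
  show "\<phi> \<star> unit = \<phi>" using star_unit[of \<phi>] by (simp only: star_commute[of \<phi> unit])
qed

definition gen_prod :: "(int \<times> 'a) list multiset \<Rightarrow> ('a \<times> nat) multiset \<Rightarrow> rat" where
  "gen_prod Y = star.F (image_mset gen Y)"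

lemma gen_prod_empty: "gen_prod {#} = unit"
  by (simp add: gen_prod_def)

lemma gen_prod_single: "gen_prod {#l#} = gen l"
  by (simp add: gen_prod_def)

lemma gen_prod_union: "gen_prod (Y + Z) = gen_prod Y \<star> gen_prod Z"
  by (simp add: gen_prod_def)

text \<open>Multiply by the factors in nonincreasing order. Each new factor is least so far, so
  concatenation is the maximal shuffle by \<open>lyndon_seq_shuffles_le\<close>, and
  \<open>lead_star\<close> applies.\<close>

lemma gen_prod_lead:
  assumes "lyndon_seq ls" "set ls \<subseteq> Lwords"
  shows "lead (gen_prod (mset ls)) (concat ls) \<and>
         gen_prod (mset ls) \<in> homs (wcont (concat ls)) (wgrade (concat ls))"
  using assms
proof (induction ls rule: rev_induct)
  case Nil
  have "lead unit []" by (auto simp: lead_def unit_def encn_def)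
  moreover have "unit \<in> homs (wcont []) (wgrade [])"
    by (auto simp: homs_def unit_def wcont_def wgrade_def grade_def split: if_splits)
  ultimately show ?case by (simp add: gen_prod_empty)
next
  case (snoc l ls)
  have ls: "lyndon_seq ls" and l: "l \<in> Lwords" using snoc.prems by (auto simp: lyndon_seq_snoc)
  have IH: "lead (gen_prod (mset ls)) (concat ls)"
    "gen_prod (mset ls) \<in> homs (wcont (concat ls)) (wgrade (concat ls))"
    using snoc.IH ls snoc.prems by auto
  have size: "size M = length w" if "\<phi> \<in> homs (wcont w) (wgrade w)" "\<phi> M \<noteq> 0" for \<phi> M w
  proof -
    have "image_mset fst M = wcont w" using homsD[OF that] by simp
    hence "size M = size (wcont w)" by (metis size_image_mset)
    thus ?thesis by (simp add: wcont_def)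
  qed
  have eq: "gen_prod (mset (ls @ [l])) = gen_prod (mset ls) \<star> gen l"
    using gen_prod_union[of "mset ls" "{#l#}"] by (simp add: gen_prod_single)
  have "lead (gen_prod (mset ls) \<star> gen l) (concat ls @ l)"
    by (rule lead_star[OF IH(1) lead_gen[OF l]])
       (use size[OF IH(2)] size[OF gen_homs[OF l]] lyndon_seq_shuffles_le[OF snoc.prems(1)] in auto)
  moreover have "gen_prod (mset ls) \<star> gen l \<in> homs (wcont (concat ls @ l)) (wgrade (concat ls @ l))"
    unfolding wcont_append wgrade_append by (rule star_homs[OF IH(2) gen_homs[OF l]])
  ultimately show ?case unfolding eq by simp
qed

end

context graded_link
begin

section \<open>The monomial basis indexed by multisets of Lyndon words\<close>

definition LLwords :: "(int \<times> 'a) list set" where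
  "LLwords = {w\<in>Lwords. lyndon w}"

definition mseq :: "(int \<times> 'a) list multiset \<Rightarrow> (int \<times> 'a) list list" where
  "mseq Y = rev (sorted_list_of_multiset Y)"

definition mword :: "(int \<times> 'a) list multiset \<Rightarrow> (int \<times> 'a) list" where
  "mword Y = concat (mseq Y)"

lemma mset_mseq [simp]: "mset (mseq Y) = Y"
  by (simp add: mseq_def)

lemma set_mseq [simp]: "set (mseq Y) = set_mset Y"
  by (simp add: mseq_def)

lemma lyndon_seq_mseq: "set_mset Y \<subseteq> LLwords \<Longrightarrow> lyndon_seq (mseq Y)"
  unfolding lyndon_seq_def
  by (auto simp: LLwords_def mseq_def sorted_wrt_rev)

lemma mseq_mset:
  assumes "lyndon_seq ls"
  shows "mseq (mset ls) = ls"
proof -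
  have "sorted (rev ls)" using assms by (simp add: lyndon_seq_def sorted_wrt_rev)
  hence "sort ls = rev ls" by (intro properties_for_sort) auto
  thus ?thesis by (simp add: mseq_def)
qed

lemma wcont_concat: "wcont (concat ls) = (\<Sum>l\<in>#mset ls. wcont l)"
  by (induction ls) (auto simp: wcont_def)

lemma wgrade_concat: "wgrade (concat ls) = (\<Sum>l\<in>#mset ls. wgrade l)"
  by (induction ls) (auto simp: wgrade_def)

lemma wcont_mword: "wcont (mword Y) = (\<Sum>l\<in>#Y. wcont l)"
  by (simp add: mword_def wcont_concat)

lemma wgrade_mword: "wgrade (mword Y) = (\<Sum>l\<in>#Y. wgrade l)"
  by (simp add: mword_def wgrade_concat)

lemma lead_gen_prod:
  assumes "set_mset Y \<subseteq> LLwords"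
  shows "lead (gen_prod Y) (mword Y)" "gen_prod Y \<in> homs (wcont (mword Y)) (wgrade (mword Y))"
  using gen_prod_lead[OF lyndon_seq_mseq[OF assms]] assms
  by (auto simp: mword_def LLwords_def)

text \<open>Unique Lyndon factorization, restricted to \<open>Lwords\<close>. A word
  \<open>mword Y\<close> lies there because it is the leading word of \<open>gen_prod Y\<close>;
  conversely the factors stay there by \<open>Lwords_lyndon_factor\<close>.\<close>

lemma bij_betw_mword: "bij_betw mword {Y. set_mset Y \<subseteq> LLwords} Lwords"
  unfolding bij_betw_def
proof
  show "inj_on mword {Y. set_mset Y \<subseteq> LLwords}"
  proof (rule inj_onI)
    fix Y Z assume *: "Y \<in> {Y. set_mset Y \<subseteq> LLwords}" "Z \<in> {Y. set_mset Y \<subseteq> LLwords}" "mword Y = mword Z"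
    hence "mseq Y = mseq Z"
      unfolding mword_def by (intro lyndon_seq_concat_inj) (auto intro: lyndon_seq_mseq)
    thus "Y = Z" by (metis mset_mseq)
  qed
  show "mword ` {Y. set_mset Y \<subseteq> LLwords} = Lwords"
  proof
    show "mword ` {Y. set_mset Y \<subseteq> LLwords} \<subseteq> Lwords"
      using lead_gen_prod(1) lead_in_Lwords by blast
    show "Lwords \<subseteq> mword ` {Y. set_mset Y \<subseteq> LLwords}"
    proof
      fix w assume w: "w \<in> Lwords"
      obtain ls where ls: "lyndon_seq ls" "concat ls = w" using lyndon_seq_exists by blast
      have "set ls \<subseteq> LLwords"
        using ls w Lwords_lyndon_factor[of ls] by (auto simp: LLwords_def lyndon_seq_def)
      moreover have "mword (mset ls) = w" using ls by (simp add: mword_def mseq_mset)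
      ultimately show "w \<in> mword ` {Y. set_mset Y \<subseteq> LLwords}"
        by (intro image_eqI[of _ _ "mset ls"]) auto
    qed
  qed
qed

text \<open>Each multiset has finitely many arrangements, and exactly one word is the largest among
  theirs.\<close>

lemma bij_betw_dec: "bij_betw dec Lwords UNIV"
  unfolding bij_betw_def
proof
  show "inj_on dec Lwords"
  proof (rule inj_onI)
    fix w w' assume *: "w \<in> Lwords" "w' \<in> Lwords" "dec w = dec w'"
    obtain xs where xs: "w = encn xs" "best (map (apsnd int) xs)" using *(1) by (auto simp: Lwords_def)
    obtain ys where ys: "w' = encn ys" "best (map (apsnd int) ys)" using *(2) by (auto simp: Lwords_def)
    have "mset xs = mset ys" using *(3) xs(1) ys(1) by simp
    hence "mset (map (apsnd int) xs) = mset (map (apsnd int) ys)" by simp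
    hence "w \<le> w'" "w' \<le> w" using xs ys unfolding best_def encn_def by metis+
    thus "w = w'" by simp
  qed
  have "M \<in> dec ` Lwords" for M
  proof -
    define X where "X = encn ` {xs. mset xs = M}"
    have "{xs. mset xs = M} \<subseteq> {xs. set xs \<subseteq> set_mset M \<and> length xs = size M}" by auto
    hence fin: "finite X" unfolding X_def
      by (intro finite_imageI) (rule finite_subset[OF _ finite_lists_length_eq[OF finite_set_mset]])
    have "X \<noteq> {}" unfolding X_def using ex_mset[of M] by auto
    hence "Max X \<in> X" using fin by (rule Max_in[rotated])
    then obtain xs where xs: "mset xs = M" "encn xs = Max X" by (auto simp: X_def)
    have "best (map (apsnd int) xs)" unfolding best_def
    proof (intro allI impI)
      fix ys assume ys: "mset ys = mset (map (apsnd int) xs)"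
      define zs where "zs = map (apsnd nat) ys"
      have "mset zs = mset xs"
        unfolding zs_def mset_map ys
        by (simp add: multiset.map_comp comp_def apsnd_def map_prod_def case_prod_unfold)
      moreover have "map (apsnd int) zs = ys"
      proof -
        have "snd y \<ge> 0" if "y \<in> set ys" for y
        proof -
          have "y \<in># mset (map (apsnd int) xs)" using that ys by (metis set_mset_mset)
          thus ?thesis by auto
        qed
        thus ?thesis unfolding zs_def map_map by (intro map_idI) auto
      qed
      ultimately have "enc ys \<in> X" using xs(1) unfolding X_def encn_def by (metis (mono_tags) image_eqI mem_Collect_eq)
      hence "enc ys \<le> Max X" using fin by simp
      thus "enc ys \<le> enc (map (apsnd int) xs)" using xs(2) by (simp add: encn_def)
    qed
    hence "encn xs \<in> Lwords" by (auto simp: Lwords_def)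
    thus ?thesis using xs(1) by (intro image_eqI[of _ _ "encn xs"]) simp_all
  qed
  thus "dec ` Lwords = UNIV" by blast
qed

lemma dec_cont_grade:
  assumes "w \<in> Lwords"
  shows "image_mset fst (dec w) = wcont w" "grade (dec w) = wgrade w"
  using assms by (auto simp: Lwords_def wcont_encn wgrade_encn)

definition msets_of :: "'a multiset \<Rightarrow> int \<Rightarrow> ('a \<times> nat) multiset set" where
  "msets_of \<gamma> s = {M. image_mset fst M = \<gamma> \<and> grade M = s}"

definition basis :: "'a multiset \<Rightarrow> int \<Rightarrow> (int \<times> 'a) list multiset set" where
  "basis \<gamma> s = {Y. set_mset Y \<subseteq> LLwords \<and> wcont (mword Y) = \<gamma> \<and> wgrade (mword Y) = s}"

definition LL :: "'a multiset \<Rightarrow> int \<Rightarrow> (int \<times> 'a) list set" where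
  "LL \<gamma> s = {w\<in>LLwords. wcont w = \<gamma> \<and> wgrade w = s}"

lemma finite_msets_of: "finite (msets_of \<gamma> s)"
proof (rule finite_subset)
  let ?d = "nat (s + Qf \<gamma>)"
  show "msets_of \<gamma> s \<subseteq> {M. set_mset M \<subseteq> set_mset \<gamma> \<times> {..?d} \<and> size M \<le> size \<gamma>}"
  proof
    fix M assume "M \<in> msets_of \<gamma> s"
    hence M: "image_mset fst M = \<gamma>" "grade M = s" by (auto simp: msets_of_def)
    have "snd l \<le> ?d" if l: "l \<in># M" for l
    proof -
      obtain N where N: "M = add_mset l N" using l by (meson multi_member_split)
      have "int (\<Sum>l\<in>#M. snd l) = s + Qf \<gamma>" using M by (simp only: grade_def)
      hence "(\<Sum>l\<in>#M. snd l) = ?d" by linarith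
      moreover have "(\<Sum>l\<in>#M. snd l) = snd l + (\<Sum>l\<in>#N. snd l)" unfolding N by simp
      ultimately show ?thesis by linarith
    qed
    moreover have "size M = size \<gamma>" using M(1) by (metis size_image_mset)
    moreover have "fst l \<in># \<gamma>" if "l \<in># M" for l using that M(1) by auto
    ultimately show "M \<in> {M. set_mset M \<subseteq> set_mset \<gamma> \<times> {..?d} \<and> size M \<le> size \<gamma>}"
      by (auto simp: mem_Times_iff)
  qed
qed (intro finite_msets_of_size finite_cartesian_product finite_set_mset finite_atMost)

lemma bij_betw_basis: "bij_betw (\<lambda>Y. dec (mword Y)) (basis \<gamma> s) (msets_of \<gamma> s)"
proof -
  have bij: "bij_betw (dec \<circ> mword) {Y. set_mset Y \<subseteq> LLwords} UNIV"
    by (rule bij_betw_trans[OF bij_betw_mword bij_betw_dec])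
  have "bij_betw (dec \<circ> mword) {Y\<in>{Y. set_mset Y \<subseteq> LLwords}. (dec \<circ> mword) Y \<in> msets_of \<gamma> s}
      {M\<in>UNIV. M \<in> msets_of \<gamma> s}"
    using bij unfolding bij_betw_def by (auto intro: inj_on_subset)
  moreover have "{Y\<in>{Y. set_mset Y \<subseteq> LLwords}. (dec \<circ> mword) Y \<in> msets_of \<gamma> s} = basis \<gamma> s"
  proof -
    have "mword Y \<in> Lwords" if "set_mset Y \<subseteq> LLwords" for Y
      using that lead_gen_prod(1) lead_in_Lwords by blast
    thus ?thesis by (auto simp: basis_def msets_of_def dec_cont_grade)
  qed
  ultimately show ?thesis by (simp add: comp_def)
qed

lemma finite_basis: "finite (basis \<gamma> s)"
  using bij_betw_finite[OF bij_betw_basis] finite_msets_of by blast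

lemma card_basis: "card (basis \<gamma> s) = card (msets_of \<gamma> s)"
  using bij_betw_same_card[OF bij_betw_basis] .

lemma gen_prod_basis_homs: "Y \<in> basis \<gamma> s \<Longrightarrow> gen_prod Y \<in> homs \<gamma> s"
  using lead_gen_prod(2) by (auto simp: basis_def)

text \<open>Among the products with nonzero coefficient take the one with the largest word. Words of
  distinct basis elements are distinct, so no other product contains its leading monomial.\<close>

lemma gen_prod_independent:
  assumes "(\<Sum>Y\<in>basis \<gamma> s. fscale (c Y) (gen_prod Y)) = 0" "Y \<in> basis \<gamma> s"
  shows "c Y = 0"
proof (rule ccontr)
  assume "c Y \<noteq> 0"
  define N where "N = {Y\<in>basis \<gamma> s. c Y \<noteq> 0}"
  have fin: "finite (mword ` N)" using finite_basis by (simp add: N_def)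
  have "N \<noteq> {}" using \<open>c Y \<noteq> 0\<close> assms(2) by (auto simp: N_def)
  hence "Max (mword ` N) \<in> mword ` N" using fin by (intro Max_in) auto
  then obtain Z where Z: "Z \<in> N" "mword Z = Max (mword ` N)" by auto
  have LL: "set_mset X \<subseteq> LLwords" if "X \<in> N" for X using that by (auto simp: N_def basis_def)
  obtain xs where xs: "gen_prod Z (mset xs) \<noteq> 0" "encn xs = mword Z"
    using lead_gen_prod(1)[OF LL[OF Z(1)]] by (auto simp: lead_def)
  have zero: "c X * gen_prod X (mset xs) = 0" if X: "X \<in> basis \<gamma> s" "X \<noteq> Z" for X
  proof (rule ccontr)
    assume nz: "c X * gen_prod X (mset xs) \<noteq> 0"
    hence "X \<in> N" using X by (auto simp: N_def)
    have "encn xs \<le> mword X"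
      using lead_gen_prod(1)[OF LL[OF \<open>X \<in> N\<close>]] nz by (auto simp: lead_def)
    moreover have "mword X \<le> mword Z" using fin \<open>X \<in> N\<close> Z(2) by simp
    ultimately have "mword X = mword Z" using xs(2) by simp
    hence "X = Z" using bij_betw_mword LL \<open>X \<in> N\<close> Z(1) by (auto simp: bij_betw_def inj_on_def)
    thus False using X by simp
  qed
  have "(\<Sum>X\<in>basis \<gamma> s. c X * gen_prod X (mset xs)) = (\<Sum>X\<in>{Z}. c X * gen_prod X (mset xs))"
    using finite_basis Z(1) zero by (intro sum.mono_neutral_right) (auto simp: N_def)
  moreover have "(\<Sum>X\<in>basis \<gamma> s. c X * gen_prod X (mset xs)) = 0"
    using fun_cong[OF assms(1), of "mset xs"] by (simp add: sum_fun_apply fscale_def)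
  ultimately show False using xs(1) Z(1) by (simp add: N_def)
qed

definition delta :: "('a \<times> nat) multiset \<Rightarrow> ('a \<times> nat) multiset \<Rightarrow> rat" where
  "delta M N = (if N = M then 1 else 0)"

lemma homs_in_span_delta:
  assumes "\<phi> \<in> homs \<gamma> s"
  shows "\<phi> \<in> fvs.span (delta ` msets_of \<gamma> s)"
proof -
  have "\<phi> N = (\<Sum>M\<in>msets_of \<gamma> s. \<phi> M * delta M N)" for N
  proof (cases "N \<in> msets_of \<gamma> s")
    case True
    have "(\<Sum>M\<in>msets_of \<gamma> s. \<phi> M * delta M N) = (\<Sum>M\<in>{N}. \<phi> M * delta M N)"
      using True finite_msets_of by (intro sum.mono_neutral_right) (auto simp: delta_def)
    thus ?thesis by (simp add: delta_def)
  next
    case False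
    hence "\<phi> N = 0" using homsD[OF assms, of N] by (auto simp: msets_of_def)
    moreover have "(\<Sum>M\<in>msets_of \<gamma> s. \<phi> M * delta M N) = 0"
      using False by (intro sum.neutral) (auto simp: delta_def)
    ultimately show ?thesis by simp
  qed
  hence eq: "\<phi> = (\<Sum>M\<in>msets_of \<gamma> s. fscale (\<phi> M) (delta M))"
    unfolding fun_eq_iff sum_fun_apply fscale_def by blast
  show ?thesis
    by (subst eq) (intro fvs.span_sum fvs.span_scale fvs.span_base imageI)
qed

lemma family_card_le_msets_of:
  assumes "finite I" "\<And>i. i \<in> I \<Longrightarrow> v i \<in> homs \<gamma> s"
    and "\<And>c i. (\<Sum>i\<in>I. fscale (c i) (v i)) = 0 \<Longrightarrow> i \<in> I \<Longrightarrow> c i = 0"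
  shows "card I \<le> card (msets_of \<gamma> s)"
proof -
  have "card I \<le> card (delta ` msets_of \<gamma> s)"
    using assms finite_msets_of homs_in_span_delta
    by (intro fvs_family_card_le[of I "delta ` msets_of \<gamma> s" v]) blast+
  also have "\<dots> \<le> card (msets_of \<gamma> s)" using finite_msets_of by (rule card_image_le)
  finally show ?thesis .
qed

text \<open>The independent products are as many as the multisets that span
  \<open>homs \<gamma> s\<close>. If \<open>\<phi>\<close> were outside their span, adding it under
  the index \<open>None\<close> would give one independent vector too many.\<close>

lemma homs_expand:
  assumes "\<phi> \<in> homs \<gamma> s"
  obtains c where "\<phi> = (\<Sum>Y\<in>basis \<gamma> s. fscale (c Y) (gen_prod Y))"
proof (rule ccontr)
  assume no: "\<not> thesis"
  define v where "v = (\<lambda>i. case i of None \<Rightarrow> \<phi> | Some Y \<Rightarrow> gen_prod Y)"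
  define I where "I = insert None (Some ` basis \<gamma> s)"
  have fin: "finite I" by (simp add: I_def finite_basis)
  have "card I \<le> card (msets_of \<gamma> s)"
  proof (rule family_card_le_msets_of[OF fin])
    fix i assume "i \<in> I"
    thus "v i \<in> homs \<gamma> s" using assms gen_prod_basis_homs by (auto simp: I_def v_def)
  next
    fix c i assume sum: "(\<Sum>i\<in>I. fscale (c i) (v i)) = 0" and i: "i \<in> I"
    have sum': "fscale (c None) \<phi> + (\<Sum>Y\<in>basis \<gamma> s. fscale (c (Some Y)) (gen_prod Y)) = 0"
      using sum finite_basis by (simp add: I_def v_def sum.reindex)
    have c0: "c None = 0"
    proof (rule ccontr)
      assume nz: "c None \<noteq> 0"
      have "\<phi> M = (\<Sum>Y\<in>basis \<gamma> s. (- c (Some Y) / c None) * gen_prod Y M)" for M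
      proof -
        have "c None * \<phi> M + (\<Sum>Y\<in>basis \<gamma> s. c (Some Y) * gen_prod Y M) = 0"
          using fun_cong[OF sum', of M] by (simp add: fscale_def sum_fun_apply)
        hence "\<phi> M = - (\<Sum>Y\<in>basis \<gamma> s. c (Some Y) * gen_prod Y M) / c None"
          using nz by (simp add: field_simps)
        thus ?thesis by (simp add: sum_negf sum_divide_distrib)
      qed
      hence "\<phi> = (\<Sum>Y\<in>basis \<gamma> s. fscale (- c (Some Y) / c None) (gen_prod Y))"
        unfolding fun_eq_iff sum_fun_apply fscale_def by blast
      hence thesis by (rule that)
      thus False using no by blast
    qed
    hence "(\<Sum>Y\<in>basis \<gamma> s. fscale (c (Some Y)) (gen_prod Y)) = 0" using sum' by simp
    hence "c (Some Y) = 0" if "Y \<in> basis \<gamma> s" for Y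
      using gen_prod_independent[of "\<lambda>Y. c (Some Y)"] that by blast
    thus "c i = 0" using i c0 by (auto simp: I_def)
  qed
  moreover have "card I = Suc (card (basis \<gamma> s))"
    unfolding I_def using finite_basis by (subst card_insert_disjoint) (auto simp: card_image)
  ultimately show False by (simp add: card_basis)
qed

subsection \<open>Decomposable elements\<close>

definition basis2 :: "'a multiset \<Rightarrow> int \<Rightarrow> (int \<times> 'a) list multiset set" where
  "basis2 \<gamma> s = {Y\<in>basis \<gamma> s. size Y \<ge> 2}"

definition decomp :: "'a multiset \<Rightarrow> int \<Rightarrow> (('a \<times> nat) multiset \<Rightarrow> rat) set" where
  "decomp \<gamma> s = fvs.span (gen_prod ` basis2 \<gamma> s)"

lemma star_sum_left: "finite I \<Longrightarrow> (\<Sum>i\<in>I. f i) \<star> \<psi> = (\<Sum>i\<in>I. f i \<star> \<psi>)"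
proof (induction I rule: finite_induct)
  case empty
  have "(0 :: ('a \<times> nat) multiset \<Rightarrow> rat) = fscale 0 0" by (simp add: fscale_def fun_eq_iff)
  hence "0 \<star> \<psi> = fscale 0 (0 \<star> \<psi>)" by (metis star_scale_left)
  thus ?case by (simp add: fscale_def zero_fun_def)
next
  case (insert x F)
  show ?case unfolding sum.insert[OF insert.hyps] star_add_left insert.IH ..
qed

lemma decomp_sum: "(\<And>i. i \<in> I \<Longrightarrow> f i \<in> decomp \<gamma> s) \<Longrightarrow> (\<Sum>i\<in>I. f i) \<in> decomp \<gamma> s"
  unfolding decomp_def by (rule fvs.span_sum)

lemma decomp_scale: "x \<in> decomp \<gamma> s \<Longrightarrow> fscale r x \<in> decomp \<gamma> s"
  unfolding decomp_def by (rule fvs.span_scale)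

lemma decomp_add: "x \<in> decomp \<gamma> s \<Longrightarrow> y \<in> decomp \<gamma> s \<Longrightarrow> x + y \<in> decomp \<gamma> s"
  unfolding decomp_def by (rule fvs.span_add)

lemma decomp_diff: "x \<in> decomp \<gamma> s \<Longrightarrow> y \<in> decomp \<gamma> s \<Longrightarrow> x - y \<in> decomp \<gamma> s"
  unfolding decomp_def by (rule fvs.span_diff)

lemma basis_add:
  assumes "Y \<in> basis \<gamma> s" "Z \<in> basis \<gamma>' s'"
  shows "Y + Z \<in> basis (\<gamma> + \<gamma>') (s + s')"
  using assms unfolding basis_def by (simp add: wcont_mword wgrade_mword)

lemma basis_nonempty: "Y \<in> basis \<gamma> s \<Longrightarrow> \<gamma> \<noteq> {#} \<Longrightarrow> Y \<noteq> {#}"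
  by (auto simp: basis_def wcont_mword)

lemma star_in_decomp:
  assumes "\<phi> \<in> homs \<gamma> s" "\<psi> \<in> homs \<gamma>' s'" "\<gamma> \<noteq> {#}" "\<gamma>' \<noteq> {#}"
  shows "\<phi> \<star> \<psi> \<in> decomp (\<gamma> + \<gamma>') (s + s')"
proof -
  obtain c where c: "\<phi> = (\<Sum>Y\<in>basis \<gamma> s. fscale (c Y) (gen_prod Y))"
    using assms(1) by (rule homs_expand)
  obtain d where d: "\<psi> = (\<Sum>Z\<in>basis \<gamma>' s'. fscale (d Z) (gen_prod Z))"
    using assms(2) by (rule homs_expand)
  have mem: "gen_prod Z \<star> gen_prod Y \<in> decomp (\<gamma> + \<gamma>') (s + s')"
    if "Y \<in> basis \<gamma> s" "Z \<in> basis \<gamma>' s'" for Y Z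
  proof -
    have "size Y \<ge> 1" "size Z \<ge> 1"
      using basis_nonempty that assms(3,4) by (auto simp: Suc_le_eq nonempty_has_size)
    hence "Y + Z \<in> basis2 (\<gamma> + \<gamma>') (s + s')"
      using basis_add[OF that] by (simp add: basis2_def)
    hence "gen_prod (Y + Z) \<in> decomp (\<gamma> + \<gamma>') (s + s')"
      unfolding decomp_def by (intro fvs.span_base imageI)
    thus ?thesis by (simp add: gen_prod_union star_commute)
  qed
  have "\<psi> \<star> gen_prod Y \<in> decomp (\<gamma> + \<gamma>') (s + s')" if "Y \<in> basis \<gamma> s" for Y
    unfolding d star_sum_left[OF finite_basis] star_scale_left
    by (intro decomp_sum decomp_scale mem that)
  hence "gen_prod Y \<star> \<psi> \<in> decomp (\<gamma> + \<gamma>') (s + s')" if "Y \<in> basis \<gamma> s" for Y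
    using that by (simp only: star_commute[of "gen_prod Y"])
  thus ?thesis
    unfolding c star_sum_left[OF finite_basis] star_scale_left
    by (intro decomp_sum decomp_scale)
qed

text \<open>Split off one generator. Neither part has empty colour content and \<open>D\<close>
  preserves that content, so both terms of the product rule are decomposable by
  \<open>star_in_decomp\<close>.\<close>

lemma basis2_derivation:
  assumes Y: "Y \<in> basis2 \<gamma> s"
    and D: "\<And>\<phi> \<psi>. D (\<phi> \<star> \<psi>) = D \<phi> \<star> \<psi> + \<phi> \<star> D \<psi>"
    and Dh: "\<And>\<phi> \<gamma> s. \<phi> \<in> homs \<gamma> s \<Longrightarrow> D \<phi> \<in> homs \<gamma> (s + r)"
  shows "D (gen_prod Y) \<in> decomp \<gamma> (s + r)"
proof -
  have LL: "set_mset Y \<subseteq> LLwords" "wcont (mword Y) = \<gamma>" "wgrade (mword Y) = s" "size Y \<ge> 2"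
    using Y by (auto simp: basis2_def basis_def)
  then obtain l Z where YZ: "Y = add_mset l Z" by (cases Y) auto
  let ?l = "{#l#}"
  have Z: "Z \<noteq> {#}" using LL(4) YZ by auto
  define \<gamma>1 \<gamma>2 where "\<gamma>1 = wcont (mword ?l)" and "\<gamma>2 = wcont (mword Z)"
  define s1 s2 where "s1 = wgrade (mword ?l)" and "s2 = wgrade (mword Z)"
  have ne: "wcont k \<noteq> {#}" if "k \<in># Y" for k
    using that LL(1) by (auto simp: LLwords_def lyndon_def wcont_def)
  have ne1: "\<gamma>1 \<noteq> {#}" using ne[of l] by (simp add: \<gamma>1_def wcont_mword YZ)
  obtain k Z' where "Z = add_mset k Z'" using Z by (cases Z) auto
  hence ne2: "\<gamma>2 \<noteq> {#}" using ne[of k] by (simp add: \<gamma>2_def wcont_mword YZ)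
  have h1: "gen_prod ?l \<in> homs \<gamma>1 s1"
    unfolding \<gamma>1_def s1_def using LL(1) YZ by (intro lead_gen_prod) auto
  have h2: "gen_prod Z \<in> homs \<gamma>2 s2"
    unfolding \<gamma>2_def s2_def using LL(1) YZ by (intro lead_gen_prod) auto
  have eq: "\<gamma>1 + \<gamma>2 = \<gamma>" "s1 + s2 = s"
    using LL(2,3) by (auto simp: \<gamma>1_def \<gamma>2_def s1_def s2_def wcont_mword wgrade_mword YZ)
  have "gen_prod Y = gen_prod ?l \<star> gen_prod Z"
    using gen_prod_union[of ?l Z] YZ by simp
  hence "D (gen_prod Y) = D (gen_prod ?l) \<star> gen_prod Z + gen_prod ?l \<star> D (gen_prod Z)"
    by (simp only: D)
  moreover have "D (gen_prod ?l) \<star> gen_prod Z \<in> decomp \<gamma> (s + r)"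
    using star_in_decomp[OF Dh[OF h1] h2 ne1 ne2] eq by (simp add: add_ac)
  moreover have "gen_prod ?l \<star> D (gen_prod Z) \<in> decomp \<gamma> (s + r)"
    using star_in_decomp[OF h1 Dh[OF h2] ne1 ne2] eq by (simp add: add_ac)
  ultimately show ?thesis by (simp only: decomp_add)
qed

lemma raise_deg_decomp:
  assumes "\<phi> \<in> decomp \<gamma> s"
  shows "raise_deg \<phi> \<in> decomp \<gamma> (s + 1)"
  using assms unfolding decomp_def[of \<gamma> s]
proof (induction rule: fvs.span_induct_alt)
  case base
  show ?case unfolding raise_deg_0 decomp_def by (rule fvs.span_zero)
next
  case (step c x y)
  have "raise_deg x \<in> decomp \<gamma> (s + 1)"
    using step(1) basis2_derivation[of _ \<gamma> s raise_deg 1] raise_deg_star raise_deg_homs by blast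
  thus ?case unfolding raise_deg_add raise_deg_scale by (intro decomp_add decomp_scale step)
qed

lemma lower_deg_decomp:
  assumes "\<phi> \<in> decomp \<gamma> s"
  shows "lower_deg \<phi> \<in> decomp \<gamma> (s - 1)"
  using assms unfolding decomp_def[of \<gamma> s]
proof (induction rule: fvs.span_induct_alt)
  case base
  have "lower_deg (0 :: ('a \<times> nat) multiset \<Rightarrow> rat) = 0" using lower_deg_add[of 0 0] by simp
  thus ?case unfolding decomp_def by (simp only: fvs.span_zero)
next
  case (step c x y)
  have "lower_deg \<phi> \<in> homs \<gamma> (s + (- 1))" if "\<phi> \<in> homs \<gamma> s" for \<phi> \<gamma> s
    using lower_deg_homs[OF that] by simp
  hence "lower_deg x \<in> decomp \<gamma> (s + (- 1))"
    using step(1) basis2_derivation[of _ \<gamma> s lower_deg "- 1"] lower_deg_star by blast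
  hence "lower_deg x \<in> decomp \<gamma> (s - 1)" by simp
  thus ?case unfolding lower_deg_add lower_deg_scale by (intro decomp_add decomp_scale step)
qed

lemma lower_raise_homs:
  assumes "\<phi> \<in> homs \<gamma> s"
  shows "lower_deg (raise_deg \<phi>) = raise_deg (lower_deg \<phi>) + fscale (of_nat (size \<gamma>)) \<phi>"
proof
  fix M
  have "of_nat (size M) * \<phi> M = of_nat (size \<gamma>) * \<phi> M"
  proof (cases "\<phi> M = 0")
    case False
    hence "size M = size \<gamma>" using homsD[OF assms False] by (metis size_image_mset)
    thus ?thesis by simp
  qed simp
  thus "lower_deg (raise_deg \<phi>) M = (raise_deg (lower_deg \<phi>) + fscale (of_nat (size \<gamma>)) \<phi>) M"
    by (simp add: lower_raise_commutator fscale_def)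
qed

text \<open>Modulo decomposables, \<^term>\<open>lower_deg\<close> and \<^term>\<open>raise_deg\<close> satisfy the Heisenberg
  relation and \<^term>\<open>lower_deg\<close> is locally nilpotent, which makes \<^term>\<open>raise_deg\<close> injective.\<close>

lemma heisenberg_aux:
  assumes "\<phi> \<in> homs \<gamma> s" "\<gamma> \<noteq> {#}" "k \<ge> 1"
    "raise_deg (lower_deg \<phi>) + fscale (of_nat (size \<gamma> * k)) \<phi> \<in> decomp \<gamma> s"
  shows "\<phi> \<in> decomp \<gamma> s"
  using assms
\<comment> \<open>The induction is on the height above the lowest grade
  \<open>- Qf \<gamma>\<close>. The factor \<open>k\<close> must vary, because applying
  \<open>lower_deg\<close> to the hypothesis and commuting it past \<open>raise_deg\<close> yields
  the same hypothesis for \<open>lower_deg \<phi>\<close> with \<open>Suc k\<close>.\<close>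
proof (induction "nat (s + Qf \<gamma> + 1)" arbitrary: \<phi> s k)
  case 0
  hence "\<phi> = 0" by (intro homs_eq_0[of \<phi> \<gamma> s]) auto
  show ?case unfolding \<open>\<phi> = 0\<close> decomp_def by (rule fvs.span_zero)
next
  case (Suc j)
  let ?n = "size \<gamma>"
  define \<psi> where "\<psi> = lower_deg \<phi>"
  have \<psi>: "\<psi> \<in> homs \<gamma> (s - 1)" unfolding \<psi>_def by (rule lower_deg_homs[OF Suc.prems(1)])
  have "lower_deg (raise_deg \<psi> + fscale (of_nat (?n * k)) \<phi>) \<in> decomp \<gamma> (s - 1)"
    using lower_deg_decomp[OF Suc.prems(4)] by (simp only: \<psi>_def)
  also have "lower_deg (raise_deg \<psi> + fscale (of_nat (?n * k)) \<phi>) =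
      raise_deg (lower_deg \<psi>) + fscale (of_nat ?n) \<psi> + fscale (of_nat (?n * k)) \<psi>"
    unfolding lower_deg_add lower_deg_scale lower_raise_homs[OF \<psi>] by (simp only: \<psi>_def)
  also have "\<dots> = raise_deg (lower_deg \<psi>) + fscale (of_nat (?n * Suc k)) \<psi>"
    by (simp add: fun_eq_iff fscale_def algebra_simps)
  finally have *: "raise_deg (lower_deg \<psi>) + fscale (of_nat (?n * Suc k)) \<psi> \<in> decomp \<gamma> (s - 1)" .
  have "\<psi> \<in> decomp \<gamma> (s - 1)"
  proof (rule Suc.hyps(1)[OF _ \<psi> Suc.prems(2) _ *])
    show "j = nat (s - 1 + Qf \<gamma> + 1)" using Suc.hyps(2) by simp
  qed simp
  hence "raise_deg \<psi> \<in> decomp \<gamma> s" using raise_deg_decomp[of \<psi> \<gamma> "s - 1"] by simp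
  hence "raise_deg \<psi> + fscale (of_nat (?n * k)) \<phi> - raise_deg \<psi> \<in> decomp \<gamma> s"
    using Suc.prems(4) unfolding \<psi>_def by (intro decomp_diff)
  hence "fscale (of_nat (?n * k)) \<phi> \<in> decomp \<gamma> s" by (simp only: add_diff_cancel_left')
  hence "fscale (1 / of_nat (?n * k)) (fscale (of_nat (?n * k)) \<phi>) \<in> decomp \<gamma> s"
    by (rule decomp_scale)
  moreover have "?n * k \<noteq> 0" using Suc.prems(2,3) by simp
  hence "(1 / of_nat (?n * k)) * of_nat (?n * k) = (1 :: rat)"
    by (metis divide_self_if of_nat_eq_0_iff times_divide_eq_left mult_1)
  hence "fscale (1 / of_nat (?n * k)) (fscale (of_nat (?n * k)) \<phi>) = \<phi>"
    by (simp only: fvs.scale_scale fvs.scale_one)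
  ultimately show ?case by simp
qed

text \<open>Applying \<open>lower_deg\<close> and the commutation relation gives the hypothesis of
  \<open>heisenberg_aux\<close> with \<open>k = 1\<close>.\<close>

lemma raise_deg_injective:
  assumes "\<phi> \<in> homs \<gamma> s" "\<gamma> \<noteq> {#}" "raise_deg \<phi> \<in> decomp \<gamma> (s + 1)"
  shows "\<phi> \<in> decomp \<gamma> s"
proof (rule heisenberg_aux[OF assms(1,2), of 1])
  have "lower_deg (raise_deg \<phi>) \<in> decomp \<gamma> s" using lower_deg_decomp[OF assms(3)] by simp
  thus "raise_deg (lower_deg \<phi>) + fscale (of_nat (size \<gamma> * 1)) \<phi> \<in> decomp \<gamma> s"
    unfolding lower_raise_homs[OF assms(1)] by simp
qed simp

lemma basis_split:
  assumes "\<gamma> \<noteq> {#}"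
  shows "basis \<gamma> s = (\<lambda>l. {#l#}) ` LL \<gamma> s \<union> basis2 \<gamma> s"
    "(\<lambda>l. {#l#}) ` LL \<gamma> s \<inter> basis2 \<gamma> s = {}"
proof -
  have "Y \<in> (\<lambda>l. {#l#}) ` LL \<gamma> s" if "Y \<in> basis \<gamma> s" "Y \<notin> basis2 \<gamma> s" for Y
  proof -
    have "Y \<noteq> {#}" by (rule basis_nonempty[OF that(1) assms])
    moreover have "size Y < 2" using that by (simp add: basis2_def)
    ultimately have "size Y = 1" by (cases Y) auto
    then obtain l where l: "Y = {#l#}" using size_1_singleton_mset by blast
    hence "l \<in> LL \<gamma> s" using that(1) by (auto simp: basis_def LL_def wcont_mword wgrade_mword)
    thus ?thesis using l by blast
  qed
  moreover have "(\<lambda>l. {#l#}) ` LL \<gamma> s \<subseteq> basis \<gamma> s"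
    by (auto simp: basis_def LL_def wcont_mword wgrade_mword)
  ultimately show "basis \<gamma> s = (\<lambda>l. {#l#}) ` LL \<gamma> s \<union> basis2 \<gamma> s"
    by (auto simp: basis2_def)
  show "(\<lambda>l. {#l#}) ` LL \<gamma> s \<inter> basis2 \<gamma> s = {}" by (auto simp: basis2_def)
qed

lemma finite_LL:
  assumes "\<gamma> \<noteq> {#}"
  shows "finite (LL \<gamma> s)"
proof -
  have "finite ((\<lambda>l. {#l#}) ` LL \<gamma> s)"
    using finite_basis[of \<gamma> s] unfolding basis_split(1)[OF assms] by blast
  thus ?thesis by (rule finite_imageD) (simp add: inj_on_def)
qed

lemma card_basis_split:
  assumes "\<gamma> \<noteq> {#}"
  shows "card (basis \<gamma> s) = card (LL \<gamma> s) + card (basis2 \<gamma> s)"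
proof -
  have "finite (basis2 \<gamma> s)" using finite_basis by (simp add: basis2_def)
  hence "card (basis \<gamma> s) = card ((\<lambda>l. {#l#}) ` LL \<gamma> s) + card (basis2 \<gamma> s)"
    unfolding basis_split(1)[OF assms]
    using finite_LL[OF assms] basis_split(2)[OF assms] by (intro card_Un_disjoint) auto
  thus ?thesis by (simp add: card_image inj_on_def)
qed

text \<open>By \<open>raise_deg_injective\<close> the images of the generators of grade
  \<open>s\<close> stay independent modulo decomposables in grade \<open>s + 1\<close>. Together
  with the decomposable basis products they form an independent family there, and
  \<open>card_basis_split\<close> counts the room for it.\<close>

theorem card_LL_mono:
  assumes "\<gamma> \<noteq> {#}"
  shows "card (LL \<gamma> s) \<le> card (LL \<gamma> (s + 1))"
proof -
  define I where "I = Inl ` LL \<gamma> s \<union> Inr ` basis2 \<gamma> (s + 1)"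
  define v where "v = (\<lambda>i. case i of Inl l \<Rightarrow> raise_deg (gen l) | Inr Y \<Rightarrow> gen_prod Y)"
  have fin2: "finite (basis2 \<gamma> s)" for s using finite_basis by (simp add: basis2_def)
  have fin: "finite I" using finite_LL[OF assms] fin2 by (simp add: I_def)
  have gen_homs': "gen l \<in> homs \<gamma> s" if "l \<in> LL \<gamma> s" for l
    using that gen_homs by (auto simp: LL_def LLwords_def)
  have "card I \<le> card (msets_of \<gamma> (s + 1))"
  proof (rule family_card_le_msets_of[OF fin])
    fix i assume "i \<in> I"
    thus "v i \<in> homs \<gamma> (s + 1)"
      using gen_homs' raise_deg_homs gen_prod_basis_homs by (auto simp: I_def v_def basis2_def)
  next
    fix c i assume sum: "(\<Sum>i\<in>I. fscale (c i) (v i)) = 0" and i: "i \<in> I"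
    define x where "x = (\<Sum>l\<in>LL \<gamma> s. fscale (c (Inl l)) (gen l))"
    define y where "y = (\<Sum>Y\<in>basis2 \<gamma> (s + 1). fscale (c (Inr Y)) (gen_prod Y))"
    have "(\<Sum>i\<in>I. fscale (c i) (v i)) =
        (\<Sum>i\<in>Inl ` LL \<gamma> s. fscale (c i) (v i)) + (\<Sum>i\<in>Inr ` basis2 \<gamma> (s + 1). fscale (c i) (v i))"
      unfolding I_def using finite_LL[OF assms] fin2 by (intro sum.union_disjoint) auto
    also have "(\<Sum>i\<in>Inl ` LL \<gamma> s. fscale (c i) (v i)) = raise_deg x"
      unfolding x_def raise_deg_sum[OF finite_LL[OF assms]] raise_deg_scale
      by (subst sum.reindex) (auto simp: inj_on_def v_def)
    also have "(\<Sum>i\<in>Inr ` basis2 \<gamma> (s + 1). fscale (c i) (v i)) = y"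
      unfolding y_def by (subst sum.reindex) (auto simp: inj_on_def v_def)
    finally have xy: "raise_deg x + y = 0" unfolding sum by (rule sym)
    have y: "y \<in> decomp \<gamma> (s + 1)"
      unfolding y_def decomp_def by (intro fvs.span_sum fvs.span_scale fvs.span_base imageI)
    have "raise_deg x = fscale (- 1) y"
      using xy by (simp add: fun_eq_iff fscale_def eq_neg_iff_add_eq_0)
    hence "raise_deg x \<in> decomp \<gamma> (s + 1)"
      by (rule ssubst[where P = "\<lambda>z. z \<in> decomp \<gamma> (s + 1)"]) (rule decomp_scale[OF y])
    moreover have "x \<in> homs \<gamma> s"
    proof -
      have "x M = 0" if "\<not> (image_mset fst M = \<gamma> \<and> grade M = s)" for M
      proof -
        have "gen l M = 0" if "l \<in> LL \<gamma> s" for l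
          using homsD[OF gen_homs'[OF that], of M] \<open>\<not> (image_mset fst M = \<gamma> \<and> grade M = s)\<close> by blast
        thus ?thesis by (simp add: x_def sum_fun_apply fscale_def)
      qed
      thus ?thesis by (auto simp: homs_def)
    qed
    ultimately have "x \<in> decomp \<gamma> s" using raise_deg_injective[OF _ assms] by blast
    then obtain d where d: "x = (\<Sum>Y\<in>basis2 \<gamma> s. fscale (d Y) (gen_prod Y))"
      unfolding decomp_def using fvs_span_image_obtain[OF fin2] by blast
    \<comment> \<open>Writes the equality of the two expansions of \<open>x\<close> as one relation
      in the basis: coefficients \<open>c\<close> on single generators and \<open>- d\<close> on
      decomposable products. \<open>SOME\<close> recovers the generator from its singleton.\<close>
    define e where "e = (\<lambda>Y. if size Y \<ge> 2 then - d Y else c (Inl (SOME l. Y = {#l#})))"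
    have "(\<Sum>Y\<in>basis \<gamma> s. fscale (e Y) (gen_prod Y)) =
       (\<Sum>Y\<in>(\<lambda>l. {#l#}) ` LL \<gamma> s. fscale (e Y) (gen_prod Y)) + (\<Sum>Y\<in>basis2 \<gamma> s. fscale (e Y) (gen_prod Y))"
      unfolding basis_split(1)[OF assms]
      using finite_LL[OF assms] fin2 basis_split(2)[OF assms] by (intro sum.union_disjoint) auto
    also have "(\<Sum>Y\<in>(\<lambda>l. {#l#}) ` LL \<gamma> s. fscale (e Y) (gen_prod Y)) = x"
      unfolding x_def by (subst sum.reindex) (auto simp: inj_on_def e_def gen_prod_single)
    also have "(\<Sum>Y\<in>basis2 \<gamma> s. fscale (e Y) (gen_prod Y)) = (\<Sum>Y\<in>basis2 \<gamma> s. fscale (- 1) (fscale (d Y) (gen_prod Y)))"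
      by (intro sum.cong) (auto simp: basis2_def e_def fscale_def)
    also have "\<dots> = fscale (- 1) x" unfolding d by (rule fvs.scale_sum_right[symmetric])
    also have "x + fscale (- 1) x = 0" by (simp add: fun_eq_iff fscale_def)
    finally have e0: "e Y = 0" if "Y \<in> basis \<gamma> s" for Y
      using gen_prod_independent that by blast
    have c1: "c (Inl l) = 0" if "l \<in> LL \<gamma> s" for l
      using e0[of "{#l#}"] that unfolding basis_split(1)[OF assms] by (auto simp: e_def)
    hence "x = 0" by (simp add: x_def fscale_def fun_eq_iff sum_fun_apply)
    hence "y = 0" using xy by (simp add: raise_deg_0)
    define f where "f = (\<lambda>Y. if size Y \<ge> 2 then c (Inr Y) else 0)"
    have "(\<Sum>Y\<in>basis \<gamma> (s + 1). fscale (f Y) (gen_prod Y)) = (\<Sum>Y\<in>basis2 \<gamma> (s + 1). fscale (f Y) (gen_prod Y))"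
      using finite_basis by (intro sum.mono_neutral_right) (auto simp: basis2_def f_def fscale_def fun_eq_iff)
    also have "\<dots> = y" unfolding y_def by (intro sum.cong) (auto simp: basis2_def f_def)
    finally have f0: "f Y = 0" if "Y \<in> basis \<gamma> (s + 1)" for Y
      using gen_prod_independent[of f] that \<open>y = 0\<close> by simp
    have "c (Inr Y) = 0" if "Y \<in> basis2 \<gamma> (s + 1)" for Y
      using f0[of Y] that by (auto simp: basis2_def f_def)
    thus "c i = 0" using i c1 by (auto simp: I_def)
  qed
  also have "card (msets_of \<gamma> (s + 1)) = card (LL \<gamma> (s + 1)) + card (basis2 \<gamma> (s + 1))"
    using card_basis[of \<gamma> "s + 1"] card_basis_split[OF assms] by simp
  also have "card I = card (LL \<gamma> s) + card (basis2 \<gamma> (s + 1))"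
    unfolding I_def using finite_LL[OF assms] fin2
    by (subst card_Un_disjoint) (auto simp: card_image)
  finally show ?thesis by simp
qed

end

section \<open>The differential equation of the plethystic exponential\<close>

definition mdvd :: "nat \<Rightarrow> ('r \<Rightarrow>\<^sub>0 nat) \<Rightarrow> bool" where
  "mdvd n \<alpha> \<longleftrightarrow> (\<forall>i. n dvd lookup \<alpha> i)"

definition mdiv :: "nat \<Rightarrow> ('r \<Rightarrow>\<^sub>0 nat) \<Rightarrow> 'r \<Rightarrow>\<^sub>0 nat" where
  "mdiv n \<alpha> = Poly_Mapping.map (\<lambda>k. k div n) \<alpha>"

lemma lookup_mdiv: "lookup (mdiv n \<alpha>) i = lookup \<alpha> i div n"
  by (simp add: mdiv_def Poly_Mapping.map.rep_eq when_def)

lemma mdiv_1 [simp]: "mdiv (Suc 0) \<alpha> = \<alpha>"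
  by (rule poly_mapping_eqI) (simp add: lookup_mdiv)

lemma mdvd_1 [simp]: "mdvd (Suc 0) \<alpha>"
  by (simp add: mdvd_def)

lemma mdeg_pos_iff [simp]: "0 < mdeg \<alpha> \<longleftrightarrow> \<alpha> \<noteq> 0"
  by (metis mdeg_eq_0_iff neq0_conv)

lemma mdeg_mdiv:
  assumes "mdvd n \<alpha>" "n \<ge> 1"
  shows "mdeg \<alpha> = n * mdeg (mdiv n \<alpha>)"
proof -
  have "mdeg (mdiv n \<alpha>) = (\<Sum>i\<in>keys \<alpha>. lookup \<alpha> i div n)"
  proof -
    have "keys (mdiv n \<alpha>) \<subseteq> keys \<alpha>"
    proof
      fix x assume "x \<in> keys (mdiv n \<alpha>)"
      hence "lookup \<alpha> x div n \<noteq> 0" by (simp add: in_keys_iff lookup_mdiv)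
      hence "lookup \<alpha> x \<noteq> 0" by (metis div_0)
      thus "x \<in> keys \<alpha>" by (simp add: in_keys_iff)
    qed
    thus ?thesis by (simp add: mdeg_eq_sum[of "keys \<alpha>"] lookup_mdiv)
  qed
  hence "n * mdeg (mdiv n \<alpha>) = (\<Sum>i\<in>keys \<alpha>. n * (lookup \<alpha> i div n))"
    by (simp add: sum_distrib_left)
  also have "\<dots> = mdeg \<alpha>"
    unfolding mdeg_def using assms by (intro sum.cong) (auto simp: mdvd_def)
  finally show ?thesis by simp
qed

text \<open>This is why the sum over divisors in \<open>log_deriv\<close> below may stop at
  \<open>mdeg \<alpha>\<close>.\<close>

lemma mdvd_le_mdeg:
  assumes "mdvd n \<alpha>" "\<alpha> \<noteq> 0"
  shows "n \<le> mdeg \<alpha>"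
proof (cases "n \<ge> 1")
  case True
  have "mdeg (mdiv n \<alpha>) \<noteq> 0" using mdeg_mdiv[OF assms(1) True] assms(2) by (metis mdeg_eq_0_iff mult_0_right)
  hence "n * 1 \<le> n * mdeg (mdiv n \<alpha>)" by (intro mult_le_mono2) linarith
  thus ?thesis using mdeg_mdiv[OF assms(1) True] by simp
qed simp

lemma mdiv_nonzero: "mdvd n \<alpha> \<Longrightarrow> n \<ge> 1 \<Longrightarrow> \<alpha> \<noteq> 0 \<Longrightarrow> mdiv n \<alpha> \<noteq> 0"
  using mdeg_mdiv[of n \<alpha>] by (metis mdeg_0 mdeg_eq_0_iff mult_0_right)

lemma mdeg_mdiv_less: "mdvd n \<alpha> \<Longrightarrow> n \<ge> 2 \<Longrightarrow> \<alpha> \<noteq> 0 \<Longrightarrow> mdeg (mdiv n \<alpha>) < mdeg \<alpha>"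
proof -
  assume *: "mdvd n \<alpha>" "n \<ge> 2" "\<alpha> \<noteq> 0"
  hence "0 < mdeg (mdiv n \<alpha>)" using mdiv_nonzero[of n \<alpha>] by simp
  hence "1 * mdeg (mdiv n \<alpha>) < n * mdeg (mdiv n \<alpha>)" using * by (intro mult_strict_right_mono) auto
  thus "mdeg (mdiv n \<alpha>) < mdeg \<alpha>" using mdeg_mdiv[of n \<alpha>] * by simp
qed

lemma mdeg_mdiv_le: "mdvd n \<alpha> \<Longrightarrow> n \<ge> 1 \<Longrightarrow> mdeg (mdiv n \<alpha>) \<le> mdeg \<alpha>"
  using mdeg_mdiv[of n \<alpha>] by (cases n) auto

text \<open>The coefficient of \<open>x\<^sup>\<alpha>\<close> in \<open>x\<^sub>i \<partial>/\<partial>x\<^sub>i\<close> applied to \<open>\<Sum>\<^sub>n \<psi>\<^sub>n(f)/n\<close>.\<close>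

definition log_deriv ::
    "(nat \<Rightarrow> 'k \<Rightarrow> 'k::field_char_0) \<Rightarrow> 'r \<Rightarrow> (('r \<Rightarrow>\<^sub>0 nat) \<Rightarrow> 'k) \<Rightarrow> ('r \<Rightarrow>\<^sub>0 nat) \<Rightarrow> 'k" where
  "log_deriv \<psi> i f \<alpha> =
     (\<Sum>n\<in>{1..mdeg \<alpha>}. if mdvd n \<alpha> then of_nat (lookup \<alpha> i div n) * \<psi> n (f (mdiv n \<alpha>)) else 0)"

text \<open>The plethystic exponential characterized by its Euler equations instead of its series.
  In this form it makes sense for any operations in the role of the Adams operations, and it is
  applied both over \<open>qfield\<close> and over Laurent series.\<close>

definition pleth_exp ::
    "(nat \<Rightarrow> 'k \<Rightarrow> 'k::field_char_0) \<Rightarrow> (('r \<Rightarrow>\<^sub>0 nat) \<Rightarrow> 'k) \<Rightarrow> (('r \<Rightarrow>\<^sub>0 nat) \<Rightarrow> 'k) \<Rightarrow> bool" where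
  "pleth_exp \<psi> f F \<longleftrightarrow> F 0 = 1 \<and>
     (\<forall>\<alpha> i. of_nat (lookup \<alpha> i) * F \<alpha> = (\<Sum>(\<beta>, \<gamma>)\<in>splits \<alpha>. log_deriv \<psi> i f \<beta> * F \<gamma>))"

lemma pleth_exp_0: "pleth_exp \<psi> f F \<Longrightarrow> F 0 = 1"
  by (simp add: pleth_exp_def)

lemma pleth_exp_deriv:
  "pleth_exp \<psi> f F \<Longrightarrow>
     of_nat (lookup \<alpha> i) * F \<alpha> = (\<Sum>(\<beta>, \<gamma>)\<in>splits \<alpha>. log_deriv \<psi> i f \<beta> * F \<gamma>)"
  by (simp add: pleth_exp_def)

lemma log_deriv_0 [simp]: "log_deriv \<psi> i f 0 = 0"
  by (simp add: log_deriv_def)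

lemma log_deriv_cong:
  assumes "\<And>\<beta>. \<beta> \<noteq> 0 \<Longrightarrow> mdeg \<beta> \<le> mdeg \<alpha> \<Longrightarrow> f \<beta> = g \<beta>"
  shows "log_deriv \<psi> i f \<alpha> = log_deriv \<psi> i g \<alpha>"
  unfolding log_deriv_def
proof (rule sum.cong)
  fix n assume n: "n \<in> {1..mdeg \<alpha>}"
  hence "\<alpha> \<noteq> 0" by auto
  have "f (mdiv n \<alpha>) = g (mdiv n \<alpha>)" if "mdvd n \<alpha>"
    using that n \<open>\<alpha> \<noteq> 0\<close> by (intro assms mdiv_nonzero mdeg_mdiv_le) auto
  thus "(if mdvd n \<alpha> then of_nat (lookup \<alpha> i div n) * \<psi> n (f (mdiv n \<alpha>)) else 0) =
        (if mdvd n \<alpha> then of_nat (lookup \<alpha> i div n) * \<psi> n (g (mdiv n \<alpha>)) else 0)" by simp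
qed simp

lemma log_deriv_split:
  assumes "\<alpha> \<noteq> 0"
  shows "log_deriv \<psi> i f \<alpha> = of_nat (lookup \<alpha> i) * \<psi> 1 (f \<alpha>) +
    (\<Sum>n\<in>{2..mdeg \<alpha>}. if mdvd n \<alpha> then of_nat (lookup \<alpha> i div n) * \<psi> n (f (mdiv n \<alpha>)) else 0)"
proof -
  have "mdeg \<alpha> \<ge> 1" using assms by (simp add: Suc_le_eq)
  hence "{1..mdeg \<alpha>} = insert 1 {2..mdeg \<alpha>}" by auto
  thus ?thesis by (simp add: log_deriv_def)
qed

lemma splits_nonzero_mdeg_less:
  assumes "(\<beta>, \<gamma>) \<in> splits \<alpha>"
  shows "\<beta> \<noteq> 0 \<Longrightarrow> mdeg \<gamma> < mdeg \<alpha>" "\<gamma> \<noteq> 0 \<Longrightarrow> mdeg \<beta> < mdeg \<alpha>"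
proof -
  have "mdeg \<alpha> = mdeg \<beta> + mdeg \<gamma>" using assms by (auto simp: mdeg_add)
  thus "\<beta> \<noteq> 0 \<Longrightarrow> mdeg \<gamma> < mdeg \<alpha>" "\<gamma> \<noteq> 0 \<Longrightarrow> mdeg \<beta> < mdeg \<alpha>"
    by (metis add_cancel_left_left le_add2 le_neq_implies_less mdeg_eq_0_iff,
        metis add_cancel_right_right le_add1 le_neq_implies_less mdeg_eq_0_iff)
qed

lemma splits_0: "splits (0 :: 'r \<Rightarrow>\<^sub>0 nat) = {(0, 0)}"
proof -
  have *: "\<beta> = 0 \<and> \<gamma> = 0" if "(\<beta>, \<gamma>) \<in> splits 0" for \<beta> \<gamma> :: "'r \<Rightarrow>\<^sub>0 nat"
  proof -
    have "mdeg \<beta> + mdeg \<gamma> = 0" unfolding mdeg_add[symmetric] using that by simp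
    thus ?thesis by simp
  qed
  have "splits 0 \<subseteq> {(0 :: 'r \<Rightarrow>\<^sub>0 nat, 0)}" using * by (intro subrelI) blast
  moreover have "(0 :: 'r \<Rightarrow>\<^sub>0 nat, 0) \<in> splits 0" by simp
  ultimately show ?thesis by blast
qed

lemma nonzero_lookup_obtain:
  assumes "\<alpha> \<noteq> (0 :: 'r \<Rightarrow>\<^sub>0 nat)"
  obtains i where "lookup \<alpha> i \<noteq> 0"
  using assms by (metis lookup_zero poly_mapping_eqI)

text \<open>A set closed under the operations occurring in the recursion contains the coefficients of the
  exponential as soon as it contains those of the argument; the converse is
  \<open>pleth_exp_closed_arg\<close>.\<close>

locale pleth_closed =
  fixes \<psi> :: "nat \<Rightarrow> 'k \<Rightarrow> 'k::field_char_0" and P :: "'k set"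
  assumes zero: "0 \<in> P" and one: "1 \<in> P"
    and add: "x \<in> P \<Longrightarrow> y \<in> P \<Longrightarrow> x + y \<in> P"
    and mult: "x \<in> P \<Longrightarrow> y \<in> P \<Longrightarrow> x * y \<in> P"
    and uminus: "x \<in> P \<Longrightarrow> - x \<in> P"
    and inverse_nat: "inverse (of_nat (Suc n)) \<in> P"
    and adams: "n \<ge> 1 \<Longrightarrow> x \<in> P \<Longrightarrow> \<psi> n x \<in> P"
    and adams_1: "\<psi> 1 x = x"
begin

lemma closed_sum: "(\<And>x. x \<in> X \<Longrightarrow> f x \<in> P) \<Longrightarrow> (\<Sum>x\<in>X. f x) \<in> P"
  by (induction X rule: infinite_finite_induct) (auto simp: zero add)

lemma closed_of_nat: "of_nat n \<in> P"
  by (induction n) (auto simp: zero one add)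

lemma closed_diff: "x \<in> P \<Longrightarrow> y \<in> P \<Longrightarrow> x - y \<in> P"
  using add uminus by (metis diff_conv_add_uminus)

lemma closed_cancel:
  assumes "of_nat n * x \<in> P" "n \<noteq> 0"
  shows "x \<in> P"
proof -
  obtain k where k: "n = Suc k" using assms(2) by (cases n) auto
  have "inverse (of_nat (Suc k)) * (of_nat n * x) = x"
    unfolding k by (simp add: field_simps del: of_nat_Suc)
  thus ?thesis using mult[OF inverse_nat assms(1)] by metis
qed

lemma closed_log_deriv:
  assumes "\<And>\<beta>. \<beta> \<noteq> 0 \<Longrightarrow> mdeg \<beta> \<le> mdeg \<alpha> \<Longrightarrow> f \<beta> \<in> P"
  shows "log_deriv \<psi> i f \<alpha> \<in> P"
  unfolding log_deriv_def
proof (rule closed_sum)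
  fix n assume n: "n \<in> {1..mdeg \<alpha>}"
  hence "\<alpha> \<noteq> 0" by auto
  have "f (mdiv n \<alpha>) \<in> P" if "mdvd n \<alpha>"
    using that n \<open>\<alpha> \<noteq> 0\<close> by (intro assms mdiv_nonzero mdeg_mdiv_le) auto
  thus "(if mdvd n \<alpha> then of_nat (lookup \<alpha> i div n) * \<psi> n (f (mdiv n \<alpha>)) else 0) \<in> P"
    using n by (auto intro!: zero mult closed_of_nat adams)
qed

text \<open>The summand with \<open>\<beta> = 0\<close> vanishes and the others involve only lower
  coefficients of \<open>F\<close>, so the equation for an index with nonzero exponent can be solved
  for \<open>F \<alpha>\<close> by dividing by that exponent.\<close>

lemma pleth_exp_closed:
  assumes F: "pleth_exp \<psi> f F" and f: "\<And>\<beta>. \<beta> \<noteq> 0 \<Longrightarrow> mdeg \<beta> \<le> d \<Longrightarrow> f \<beta> \<in> P"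
  shows "mdeg \<alpha> \<le> d \<Longrightarrow> F \<alpha> \<in> P"
proof (induction "mdeg \<alpha>" arbitrary: \<alpha> rule: less_induct)
  case less
  show ?case
  proof (cases "\<alpha> = 0")
    case True
    thus ?thesis using pleth_exp_0[OF F] one by simp
  next
    case False
    then obtain i where i: "lookup \<alpha> i \<noteq> 0" by (rule nonzero_lookup_obtain)
    have "(\<Sum>(\<beta>, \<gamma>)\<in>splits \<alpha>. log_deriv \<psi> i f \<beta> * F \<gamma>) \<in> P"
    proof (rule closed_sum)
      fix x assume x: "x \<in> splits \<alpha>"
      obtain \<beta> \<gamma> where bg: "x = (\<beta>, \<gamma>)" by (cases x)
      show "(case x of (\<beta>, \<gamma>) \<Rightarrow> log_deriv \<psi> i f \<beta> * F \<gamma>) \<in> P"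
      proof (cases "\<beta> = 0")
        case False
        hence lt: "mdeg \<gamma> < mdeg \<alpha>" using splits_nonzero_mdeg_less(1) x bg by blast
        hence "F \<gamma> \<in> P" using less.prems by (intro less.hyps) auto
        moreover have "mdeg \<beta> \<le> mdeg \<alpha>" using x bg by (auto simp: mdeg_add)
        hence "log_deriv \<psi> i f \<beta> \<in> P" using less.prems by (intro closed_log_deriv f) auto
        ultimately show ?thesis by (simp add: bg mult)
      qed (simp add: bg zero)
    qed
    thus ?thesis using closed_cancel[OF _ i] pleth_exp_deriv[OF F, of \<alpha> i] by metis
  qed
qed

text \<open>In the equation for \<open>\<alpha>\<close>, the coefficient \<open>f \<alpha>\<close>
  enters only through the summand with \<open>\<beta> = \<alpha>\<close> and there only through the
  divisor \<open>n = 1\<close>, so it can be isolated.\<close>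

lemma pleth_exp_closed_arg:
  assumes F: "pleth_exp \<psi> f F" and FP: "\<And>\<alpha>. mdeg \<alpha> \<le> d \<Longrightarrow> F \<alpha> \<in> P"
  shows "\<alpha> \<noteq> 0 \<Longrightarrow> mdeg \<alpha> \<le> d \<Longrightarrow> f \<alpha> \<in> P"
proof (induction "mdeg \<alpha>" arbitrary: \<alpha> rule: less_induct)
  case less
  from less.prems(1) obtain i where i: "lookup \<alpha> i \<noteq> 0" by (rule nonzero_lookup_obtain)
  let ?t = "\<lambda>(\<beta>, \<gamma>). log_deriv \<psi> i f \<beta> * F \<gamma>"
  have fin: "finite (splits \<alpha>)" "(\<alpha>, 0) \<in> splits \<alpha>" by auto
  have "(\<Sum>x\<in>splits \<alpha> - {(\<alpha>, 0)}. ?t x) \<in> P"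
  proof (rule closed_sum)
    fix x assume x: "x \<in> splits \<alpha> - {(\<alpha>, 0)}"
    obtain \<beta> \<gamma> where bg: "x = (\<beta>, \<gamma>)" by (cases x)
    have "\<gamma> \<noteq> 0" using x bg by auto
    hence *: "mdeg \<beta> < mdeg \<alpha>" using splits_nonzero_mdeg_less(2) x bg by blast
    have "f \<delta> \<in> P" if "\<delta> \<noteq> 0" "mdeg \<delta> \<le> mdeg \<beta>" for \<delta>
      using that * less.prems by (intro less(1)) auto
    hence "log_deriv \<psi> i f \<beta> \<in> P" by (rule closed_log_deriv)
    moreover have "mdeg \<gamma> \<le> mdeg \<alpha>" using x bg by (auto simp: mdeg_add)
    hence "F \<gamma> \<in> P" using less.prems by (intro FP) auto
    ultimately show "?t x \<in> P" by (simp add: bg mult)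
  qed
  moreover have "of_nat (lookup \<alpha> i) * F \<alpha> = ?t (\<alpha>, 0) + (\<Sum>x\<in>splits \<alpha> - {(\<alpha>, 0)}. ?t x)"
    unfolding pleth_exp_deriv[OF F] using fin by (rule sum.remove)
  hence "log_deriv \<psi> i f \<alpha> = of_nat (lookup \<alpha> i) * F \<alpha> - (\<Sum>x\<in>splits \<alpha> - {(\<alpha>, 0)}. ?t x)"
    using pleth_exp_0[OF F] by simp
  ultimately have "log_deriv \<psi> i f \<alpha> \<in> P"
    using less.prems by (simp only: closed_diff mult closed_of_nat FP)
  moreover have "(\<Sum>n\<in>{2..mdeg \<alpha>}. if mdvd n \<alpha> then of_nat (lookup \<alpha> i div n) * \<psi> n (f (mdiv n \<alpha>)) else 0) \<in> P"
    (is "?R \<in> P")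
  proof (rule closed_sum)
    fix n assume n: "n \<in> {2..mdeg \<alpha>}"
    have "f (mdiv n \<alpha>) \<in> P" if "mdvd n \<alpha>"
    proof (rule less(1))
      show lt: "mdeg (mdiv n \<alpha>) < mdeg \<alpha>" using that n less.prems by (intro mdeg_mdiv_less) auto
      show "mdiv n \<alpha> \<noteq> 0" using that n less.prems by (intro mdiv_nonzero) auto
      show "mdeg (mdiv n \<alpha>) \<le> d" using lt less.prems by simp
    qed
    thus "(if mdvd n \<alpha> then of_nat (lookup \<alpha> i div n) * \<psi> n (f (mdiv n \<alpha>)) else 0) \<in> P"
      using n by (auto intro!: zero mult closed_of_nat adams)
  qed
  moreover have "of_nat (lookup \<alpha> i) * f \<alpha> = log_deriv \<psi> i f \<alpha> - ?R"
    using log_deriv_split[OF less.prems(1), of \<psi> i f] by (simp only: adams_1 add_diff_cancel)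
  ultimately have "of_nat (lookup \<alpha> i) * f \<alpha> \<in> P" by (simp only: closed_diff)
  thus ?case using i by (rule closed_cancel)
qed

end

lemma pleth_exp_unique:
  assumes F: "pleth_exp \<psi> f F" and F': "pleth_exp \<psi> f' F'"
    and f: "\<And>\<beta>. \<beta> \<noteq> 0 \<Longrightarrow> f \<beta> = f' \<beta>"
  shows "F \<alpha> = F' \<alpha>"
proof (induction "mdeg \<alpha>" arbitrary: \<alpha> rule: less_induct)
  case less
  show ?case
  proof (cases "\<alpha> = 0")
    case True
    thus ?thesis using pleth_exp_0[OF F] pleth_exp_0[OF F'] by simp
  next
    case False
    then obtain i where i: "lookup \<alpha> i \<noteq> 0" by (rule nonzero_lookup_obtain)
    have "(\<Sum>(\<beta>, \<gamma>)\<in>splits \<alpha>. log_deriv \<psi> i f \<beta> * F \<gamma>) =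
          (\<Sum>(\<beta>, \<gamma>)\<in>splits \<alpha>. log_deriv \<psi> i f' \<beta> * F' \<gamma>)"
    proof (rule sum.cong)
      fix x assume x: "x \<in> splits \<alpha>"
      obtain \<beta> \<gamma> where bg: "x = (\<beta>, \<gamma>)" by (cases x)
      have "F \<gamma> = F' \<gamma>" if "\<beta> \<noteq> 0"
        using splits_nonzero_mdeg_less(1) x bg that less by blast
      moreover have "log_deriv \<psi> i f \<beta> = log_deriv \<psi> i f' \<beta>" by (rule log_deriv_cong) (rule f)
      ultimately show "(case x of (\<beta>, \<gamma>) \<Rightarrow> log_deriv \<psi> i f \<beta> * F \<gamma>) =
          (case x of (\<beta>, \<gamma>) \<Rightarrow> log_deriv \<psi> i f' \<beta> * F' \<gamma>)"
        by (cases "\<beta> = 0") (simp_all add: bg)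
    qed simp
    hence "of_nat (lookup \<alpha> i) * F \<alpha> = of_nat (lookup \<alpha> i) * F' \<alpha>"
      unfolding pleth_exp_deriv[OF F] pleth_exp_deriv[OF F'] .
    thus ?thesis using i by simp
  qed
qed

text \<open>The same isolation of \<open>f \<alpha>\<close> as in
  \<open>pleth_exp_closed_arg\<close>, used to compare two arguments degree by degree.\<close>

lemma pleth_exp_inject:
  assumes F: "pleth_exp \<psi> f F" and F': "pleth_exp \<psi> f' F"
    and 1: "\<And>x. \<psi> 1 x = x"
  shows "\<alpha> \<noteq> 0 \<Longrightarrow> f \<alpha> = f' \<alpha>"
proof (induction "mdeg \<alpha>" arbitrary: \<alpha> rule: less_induct)
  case less
  then obtain i where i: "lookup \<alpha> i \<noteq> 0" by (meson nonzero_lookup_obtain)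
  let ?t = "\<lambda>f (\<beta>, \<gamma>). log_deriv \<psi> i f \<beta> * F \<gamma>"
  let ?R = "\<lambda>f. \<Sum>n\<in>{2..mdeg \<alpha>}. if mdvd n \<alpha> then of_nat (lookup \<alpha> i div n) * \<psi> n (f (mdiv n \<alpha>)) else 0"
  have fin: "finite (splits \<alpha>)" "(\<alpha>, 0) \<in> splits \<alpha>" by auto
  have "(\<Sum>x\<in>splits \<alpha> - {(\<alpha>, 0)}. ?t f x) = (\<Sum>x\<in>splits \<alpha> - {(\<alpha>, 0)}. ?t f' x)"
  proof (rule sum.cong)
    fix x assume x: "x \<in> splits \<alpha> - {(\<alpha>, 0)}"
    obtain \<beta> \<gamma> where bg: "x = (\<beta>, \<gamma>)" by (cases x)
    have "\<gamma> \<noteq> 0" using x bg by auto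
    hence *: "mdeg \<beta> < mdeg \<alpha>" using splits_nonzero_mdeg_less(2) x bg by blast
    have "log_deriv \<psi> i f \<beta> = log_deriv \<psi> i f' \<beta>"
      by (rule log_deriv_cong) (rule less(1), use * in auto)
    thus "?t f x = ?t f' x" by (simp add: bg)
  qed simp
  moreover have "(\<Sum>x\<in>splits \<alpha>. ?t f x) = (\<Sum>x\<in>splits \<alpha>. ?t f' x)"
    unfolding pleth_exp_deriv[OF F, symmetric] pleth_exp_deriv[OF F', symmetric] ..
  ultimately have "?t f (\<alpha>, 0) = ?t f' (\<alpha>, 0)"
    using sum.remove[OF fin, of "?t f"] sum.remove[OF fin, of "?t f'"] by simp
  hence "log_deriv \<psi> i f \<alpha> = log_deriv \<psi> i f' \<alpha>" using pleth_exp_0[OF F] by simp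
  moreover have "?R f = ?R f'"
  proof (rule sum.cong)
    fix n assume n: "n \<in> {2..mdeg \<alpha>}"
    have "f (mdiv n \<alpha>) = f' (mdiv n \<alpha>)" if "mdvd n \<alpha>"
      using that n less.prems by (intro less(1) mdiv_nonzero mdeg_mdiv_less) auto
    thus "(if mdvd n \<alpha> then of_nat (lookup \<alpha> i div n) * \<psi> n (f (mdiv n \<alpha>)) else 0) =
        (if mdvd n \<alpha> then of_nat (lookup \<alpha> i div n) * \<psi> n (f' (mdiv n \<alpha>)) else 0)" by simp
  qed simp
  ultimately have "of_nat (lookup \<alpha> i) * f \<alpha> = of_nat (lookup \<alpha> i) * f' \<alpha>"
    unfolding log_deriv_split[OF less.prems] 1 by simp
  thus ?case using i by simp
qed

text \<open>Used with \<open>expand\<close>, which carries the Adams operations to substitutions of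
  powers in Laurent series.\<close>

lemma pleth_exp_hom:
  fixes \<iota> :: "'k::field_char_0 \<Rightarrow> 'l::field_char_0"
  assumes F: "pleth_exp \<psi> f F"
    and \<iota>: "\<And>x y. \<iota> (x + y) = \<iota> x + \<iota> y" "\<And>x y. \<iota> (x * y) = \<iota> x * \<iota> y" "\<iota> 0 = 0" "\<iota> 1 = 1"
    and \<psi>: "\<And>n x. n \<ge> 1 \<Longrightarrow> \<iota> (\<psi> n x) = \<psi>' n (\<iota> x)"
  shows "pleth_exp \<psi>' (\<lambda>\<beta>. \<iota> (f \<beta>)) (\<lambda>\<beta>. \<iota> (F \<beta>))"
proof -
  have sum: "\<iota> (\<Sum>x\<in>X. g x) = (\<Sum>x\<in>X. \<iota> (g x))" for X :: "'z set" and g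
    by (induction X rule: infinite_finite_induct) (auto simp: \<iota>)
  have of_nat: "\<iota> (of_nat n) = of_nat n" for n by (induction n) (auto simp: \<iota>)
  have ld: "\<iota> (log_deriv \<psi> i f \<beta>) = log_deriv \<psi>' i (\<lambda>\<beta>. \<iota> (f \<beta>)) \<beta>" for i \<beta>
    unfolding log_deriv_def sum
    by (intro sum.cong refl) (auto simp: \<iota> \<psi> of_nat)
  have "of_nat (lookup \<alpha> i) * \<iota> (F \<alpha>) = (\<Sum>(\<beta>, \<gamma>)\<in>splits \<alpha>. log_deriv \<psi>' i (\<lambda>\<beta>. \<iota> (f \<beta>)) \<beta> * \<iota> (F \<gamma>))" for \<alpha> i
  proof -
    have "of_nat (lookup \<alpha> i) * \<iota> (F \<alpha>) = \<iota> (of_nat (lookup \<alpha> i) * F \<alpha>)" by (simp add: \<iota> of_nat)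
    also have "\<dots> = \<iota> (\<Sum>x\<in>splits \<alpha>. log_deriv \<psi> i f (fst x) * F (snd x))"
      unfolding pleth_exp_deriv[OF F] by (simp add: case_prod_unfold)
    also have "\<dots> = (\<Sum>x\<in>splits \<alpha>. log_deriv \<psi>' i (\<lambda>\<beta>. \<iota> (f \<beta>)) (fst x) * \<iota> (F (snd x)))"
      unfolding sum by (simp add: \<iota> ld)
    finally show ?thesis by (simp add: case_prod_unfold)
  qed
  thus ?thesis using pleth_exp_0[OF F] \<iota> by (simp add: pleth_exp_def)
qed

lemma pleth_exp_iff_euler:
  "pleth_exp \<psi> f F \<longleftrightarrow> F 0 = 1 \<and>
     (\<forall>i. euler i (Abs_mpseries F) = Abs_mpseries (log_deriv \<psi> i f) * Abs_mpseries F)"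
proof -
  have "euler i (Abs_mpseries F) = Abs_mpseries (log_deriv \<psi> i f) * Abs_mpseries F \<longleftrightarrow>
    (\<forall>\<alpha>. of_nat (lookup \<alpha> i) * F \<alpha> = (\<Sum>(\<beta>, \<gamma>)\<in>splits \<alpha>. log_deriv \<psi> i f \<beta> * F \<gamma>))" for i
    by (simp add: mcoeff_inject[symmetric] fun_eq_iff mcoeff_times)
  thus ?thesis unfolding pleth_exp_def by auto
qed

text \<open>Logarithmic derivatives add under multiplication, and \<open>log_deriv\<close> is
  additive in its argument.\<close>

lemma pleth_exp_times:
  assumes F: "pleth_exp \<psi> f F" and G: "pleth_exp \<psi> g G"
    and \<psi>: "\<And>n x y. n \<ge> 1 \<Longrightarrow> \<psi> n (x + y) = \<psi> n x + \<psi> n y"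
  shows "pleth_exp \<psi> (\<lambda>\<beta>. f \<beta> + g \<beta>) (mcoeff (Abs_mpseries F * Abs_mpseries G))"
proof -
  have "log_deriv \<psi> i (\<lambda>\<beta>. f \<beta> + g \<beta>) \<beta> = log_deriv \<psi> i f \<beta> + log_deriv \<psi> i g \<beta>" for i \<beta>
    unfolding log_deriv_def sum.distrib[symmetric]
    by (intro sum.cong refl) (auto simp: \<psi> distrib_left)
  hence ld: "Abs_mpseries (log_deriv \<psi> i (\<lambda>\<beta>. f \<beta> + g \<beta>)) =
      Abs_mpseries (log_deriv \<psi> i f) + Abs_mpseries (log_deriv \<psi> i g)" for i
    by (intro mpseries_eqI) simp
  let ?F = "Abs_mpseries F" and ?G = "Abs_mpseries G"
  have "euler i (?F * ?G) = Abs_mpseries (log_deriv \<psi> i (\<lambda>\<beta>. f \<beta> + g \<beta>)) * (?F * ?G)" for i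
    using F G unfolding pleth_exp_iff_euler ld euler_times by (simp add: algebra_simps)
  moreover have "mcoeff (?F * ?G) 0 = 1"
  proof -
    show ?thesis using pleth_exp_0[OF F] pleth_exp_0[OF G] by (simp add: mcoeff_times splits_0)
  qed
  ultimately show ?thesis unfolding pleth_exp_iff_euler mcoeff_inverse by blast
qed

lemma euler_1: "euler i 1 = 0"
  by (rule mpseries_eqI) (simp add: mcoeff_one)

lemma euler_power: "euler i (g ^ Suc k) = mscale (of_nat (Suc k)) (g ^ k * euler i g)"
proof (induction k)
  case 0
  show ?case by (rule mpseries_eqI) simp
next
  case (Suc k)
  have scale: "x * mscale c y = mscale c (x * y)" for c :: 'b and x y :: "('a, 'b) mpseries"
    by (rule mpseries_eqI) (simp add: mcoeff_times sum_distrib_left case_prod_unfold mult.left_commute)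
  have "euler i (g ^ Suc (Suc k)) = euler i g * g ^ Suc k + g * euler i (g ^ Suc k)"
    using euler_times[of i g "g ^ Suc k"] by simp
  also have "\<dots> = g ^ Suc k * euler i g + mscale (of_nat (Suc k)) (g ^ Suc k * euler i g)"
    unfolding Suc scale by (simp add: mult_ac)
  also have "\<dots> = mscale (of_nat (Suc (Suc k))) (g ^ Suc k * euler i g)"
    by (rule mpseries_eqI) (simp add: algebra_simps)
  finally show ?case .
qed

lemma mcoeff_mexp:
  assumes "mcoeff g 0 = 0" "mdeg \<alpha> \<le> N"
  shows "mcoeff (mexp g) \<alpha> = (\<Sum>k\<le>N. 1 / fact k * mcoeff (g ^ k) \<alpha>)"
proof -
  have "{k. 1 / fact k * mcoeff (g ^ k) \<alpha> \<noteq> 0} \<subseteq> {..N}"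
  proof
    fix k assume "k \<in> {k. 1 / fact k * mcoeff (g ^ k) \<alpha> \<noteq> 0}"
    hence "mcoeff (g ^ k) \<alpha> \<noteq> 0" by auto
    hence "\<not> mdeg \<alpha> < k" using mcoeff_power_eq_0[OF assms(1)] unfolding mdeg_def by blast
    thus "k \<in> {..N}" using assms(2) by simp
  qed
  thus ?thesis
    by (simp add: mexp_def msum.rep_eq mscale.rep_eq Sum_any.expand_superset[of "{..N}"])
qed

text \<open>In a fixed coefficient the exponential series is a finite sum and can be differentiated
  termwise. Truncating one term later on the left absorbs the index shift caused by
  differentiation.\<close>

lemma euler_mexp:
  fixes g :: "('r, 'b::field_char_0) mpseries"
  assumes "mcoeff g 0 = 0"
  shows "euler i (mexp g) = euler i g * mexp g"
proof (rule mpseries_eqI)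
  fix \<alpha> :: "'r \<Rightarrow>\<^sub>0 nat"
  let ?N = "mdeg \<alpha>"
  have "mcoeff (euler i (mexp g)) \<alpha> = (\<Sum>k\<le>Suc ?N. 1 / fact k * mcoeff (euler i (g ^ k)) \<alpha>)"
    using mcoeff_mexp[OF assms, of \<alpha> "Suc ?N"]
    by (simp add: sum_distrib_left mult.left_commute del: sum.atMost_Suc)
  also have "\<dots> = (\<Sum>k\<le>?N. 1 / fact (Suc k) * mcoeff (euler i (g ^ Suc k)) \<alpha>)"
    by (subst sum.atMost_Suc_shift) (simp add: euler_1 del: power_Suc)
  also have "\<dots> = (\<Sum>k\<le>?N. 1 / fact k * mcoeff (g ^ k * euler i g) \<alpha>)"
  proof (rule sum.cong)
    fix k
    have "1 / fact (Suc k) * (of_nat (Suc k) * x) = 1 / fact k * (x :: 'b)" for x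
      by (simp add: fact_Suc field_simps del: of_nat_Suc)
    thus "1 / fact (Suc k) * mcoeff (euler i (g ^ Suc k)) \<alpha> = 1 / fact k * mcoeff (g ^ k * euler i g) \<alpha>"
      by (simp only: euler_power mcoeff_scale)
  qed simp
  also have "\<dots> = (\<Sum>k\<le>?N. \<Sum>(\<beta>, \<gamma>)\<in>splits \<alpha>. 1 / fact k * mcoeff (g ^ k) \<beta> * mcoeff (euler i g) \<gamma>)"
    by (simp add: mcoeff_times sum_distrib_left case_prod_unfold mult.assoc)
  also have "\<dots> = (\<Sum>(\<beta>, \<gamma>)\<in>splits \<alpha>. (\<Sum>k\<le>?N. 1 / fact k * mcoeff (g ^ k) \<beta>) * mcoeff (euler i g) \<gamma>)"
    by (subst sum.swap) (simp add: sum_distrib_right case_prod_unfold)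
  also have "\<dots> = (\<Sum>(\<beta>, \<gamma>)\<in>splits \<alpha>. mcoeff (mexp g) \<beta> * mcoeff (euler i g) \<gamma>)"
  proof (rule sum.cong)
    fix x assume "x \<in> splits \<alpha>"
    moreover obtain \<beta> \<gamma> where x: "x = (\<beta>, \<gamma>)" by (cases x)
    ultimately have "mdeg \<beta> \<le> ?N" by (auto simp: mdeg_add)
    thus "(case x of (\<beta>, \<gamma>) \<Rightarrow> (\<Sum>k\<le>?N. 1 / fact k * mcoeff (g ^ k) \<beta>) * mcoeff (euler i g) \<gamma>) =
          (case x of (\<beta>, \<gamma>) \<Rightarrow> mcoeff (mexp g) \<beta> * mcoeff (euler i g) \<gamma>)"
      using mcoeff_mexp[OF assms] by (simp add: x)
  qed simp
  also have "\<dots> = mcoeff (euler i g * mexp g) \<alpha>"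
    by (simp only: mcoeff_times[symmetric] mult.commute[of "euler i g"])
  finally show "mcoeff (euler i (mexp g)) \<alpha> = mcoeff (euler i g * mexp g) \<alpha>" .
qed

text \<open>The Euler operator turns the factor \<open>1 / of_nat (Suc m)\<close> of the series
  under the exponential into the exact quotient of the exponent by \<open>Suc m\<close> that occurs
  in \<open>log_deriv\<close>; the rest is \<open>euler_mexp\<close>.\<close>

lemma pleth_exp_Exp:
  assumes "mcoeff f 0 = 0"
  shows "pleth_exp adams_scalar (mcoeff f) (mcoeff (Exp f))"
proof -
  define g where "g = msum (\<lambda>m. mscale (1 / of_nat (Suc m)) (psi (Suc m) f))"
  have psi: "mcoeff (psi n f) \<beta> = (if mdvd n \<beta> then adams_scalar n (mcoeff f (mdiv n \<beta>)) else 0)" for n \<beta>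
    by (simp add: psi_def mdvd_def mdiv_def)
  have g: "mcoeff g \<beta> = (\<Sum>m<mdeg \<beta>. 1 / of_nat (Suc m) * mcoeff (psi (Suc m) f) \<beta>)" for \<beta>
  proof -
    have "{m. 1 / of_nat (Suc m) * mcoeff (psi (Suc m) f) \<beta> \<noteq> 0} \<subseteq> {..<mdeg \<beta>}"
    proof (cases "\<beta> = 0")
      case True
      have "mdiv n (0 :: 'a \<Rightarrow>\<^sub>0 nat) = 0" for n by (rule poly_mapping_eqI) (simp add: lookup_mdiv)
      thus ?thesis using True assms by (simp add: psi)
    next
      case False
      show ?thesis
      proof
        fix k assume "k \<in> {m. 1 / of_nat (Suc m) * mcoeff (psi (Suc m) f) \<beta> \<noteq> 0}"
        hence "mcoeff (psi (Suc k) f) \<beta> \<noteq> 0" by auto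
        hence "mdvd (Suc k) \<beta>" unfolding psi by meson
        hence "Suc k \<le> mdeg \<beta>" using False by (rule mdvd_le_mdeg)
        thus "k \<in> {..<mdeg \<beta>}" by simp
      qed
    qed
    thus ?thesis unfolding g_def
      by (simp add: msum.rep_eq mscale.rep_eq Sum_any.expand_superset[of "{..<mdeg \<beta>}"] del: of_nat_Suc)
  qed
  have "of_nat (lookup \<beta> i) * mcoeff g \<beta> = log_deriv adams_scalar i (mcoeff f) \<beta>" for i \<beta>
  proof -
    have "log_deriv adams_scalar i (mcoeff f) \<beta> = (\<Sum>m<mdeg \<beta>. if mdvd (Suc m) \<beta>
        then of_nat (lookup \<beta> i div Suc m) * adams_scalar (Suc m) (mcoeff f (mdiv (Suc m) \<beta>)) else 0)"
      unfolding log_deriv_def One_nat_def by (rule sum.atLeast1_atMost_eq)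
    also have "\<dots> = (\<Sum>m<mdeg \<beta>. of_nat (lookup \<beta> i) * (1 / of_nat (Suc m) * mcoeff (psi (Suc m) f) \<beta>))"
    proof (rule sum.cong)
      fix m
      have "1 / of_nat (Suc m) * of_nat (lookup \<beta> i) = (of_nat (lookup \<beta> i div Suc m) :: qfield)"
        if "mdvd (Suc m) \<beta>"
      proof -
        have "lookup \<beta> i = Suc m * (lookup \<beta> i div Suc m)" using that unfolding mdvd_def by (metis dvd_mult_div_cancel)
        hence "(of_nat (lookup \<beta> i) :: qfield) = of_nat (Suc m) * of_nat (lookup \<beta> i div Suc m)"
          by (metis of_nat_mult)
        moreover have "1 / of_nat (Suc m) * (of_nat (Suc m) * x) = (x :: qfield)" for x
          by (simp del: of_nat_Suc)
        ultimately show ?thesis by (simp only:)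
      qed
      hence "of_nat (lookup \<beta> i div Suc m) * x = of_nat (lookup \<beta> i) * (1 / of_nat (Suc m) * x)"
        if "mdvd (Suc m) \<beta>" for x :: qfield
        using that by (metis mult.assoc mult.commute)
      thus "(if mdvd (Suc m) \<beta>
        then of_nat (lookup \<beta> i div Suc m) * adams_scalar (Suc m) (mcoeff f (mdiv (Suc m) \<beta>)) else 0) =
        of_nat (lookup \<beta> i) * (1 / of_nat (Suc m) * mcoeff (psi (Suc m) f) \<beta>)"
        unfolding psi by (cases "mdvd (Suc m) \<beta>") (simp_all only: if_True if_False mult_zero_right)
    qed simp
    finally show ?thesis by (simp add: g sum_distrib_left)
  qed
  hence "euler i g = Abs_mpseries (log_deriv adams_scalar i (mcoeff f))" for i
    by (intro mpseries_eqI) simp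
  moreover have "mcoeff g 0 = 0" by (simp add: g)
  moreover have "Exp f = mexp g" by (simp add: Exp_def g_def)
  moreover have "mcoeff (mexp g) 0 = 1"
    using mcoeff_mexp[OF \<open>mcoeff g 0 = 0\<close>, of 0 0] by (simp add: mcoeff_one)
  ultimately show ?thesis unfolding pleth_exp_iff_euler mcoeff_inverse by (metis euler_mexp)
qed

unbundle fps_syntax

section \<open>Expansion in powers of \<open>q\<^sup>-\<^sup>1\<^sup>/\<^sup>2\<close>\<close>

text \<open>The variable of the Laurent series is the inverse of \<open>qhalf\<close>, so powers of
  \<open>qhalf\<close> sit at nonpositive indices.\<close>

definition expand_poly :: "rat poly \<Rightarrow> rat fls" where
  "expand_poly p = Abs_fls (\<lambda>n. if n \<le> 0 then coeff p (nat (- n)) else 0)"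

lemma expand_poly_nth [simp]: "expand_poly p $$ n = (if n \<le> 0 then coeff p (nat (- n)) else 0)"
  unfolding expand_poly_def
proof (rule nth_Abs_fls_ex_lower_bound)
  show "\<exists>N. \<forall>n<N. (if n \<le> 0 then coeff p (nat (- n)) else 0) = 0"
    by (rule exI[of _ "- int (degree p)"]) (auto intro!: coeff_eq_0)
qed

lemma expand_poly_pCons: "expand_poly (pCons a p) = fls_const a + fls_X_inv * expand_poly p"
proof (rule fls_eqI)
  fix n :: int
  have "coeff (pCons a p) (nat (- n)) = coeff p (nat (- n - 1))" if "n < 0"
  proof -
    have "nat (- n) = Suc (nat (- n - 1))" using that by linarith
    thus ?thesis by simp
  qed
  thus "expand_poly (pCons a p) $$ n = (fls_const a + fls_X_inv * expand_poly p) $$ n"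
    by (cases "n < 0"; cases "n = 0") (auto simp: fls_X_inv_times_conv_shift)
qed

lemma expand_poly_add: "expand_poly (p + r) = expand_poly p + expand_poly r"
  by (rule fls_eqI) simp

lemma expand_poly_smult: "expand_poly (smult a p) = fls_const a * expand_poly p"
  by (rule fls_eqI) simp

lemma expand_poly_0 [simp]: "expand_poly 0 = 0"
  by (rule fls_eqI) simp

lemma expand_poly_1 [simp]: "expand_poly 1 = 1"
  by (rule fls_eqI) (auto simp: coeff_1)

lemma expand_poly_mult: "expand_poly (p * r) = expand_poly p * expand_poly r"
proof (induction p)
  case (pCons a p)
  have "expand_poly (pCons a p * r) = expand_poly (smult a r) + expand_poly (pCons 0 (p * r))"
    by (simp only: mult_pCons_left expand_poly_add)
  also have "\<dots> = (fls_const a + fls_X_inv * expand_poly p) * expand_poly r"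
    by (simp only: expand_poly_smult expand_poly_pCons pCons.IH distrib_right mult.assoc fls_const_0 add_0)
  finally show ?case by (simp only: expand_poly_pCons)
qed simp

lemma expand_poly_eq_0_iff [simp]: "expand_poly p = 0 \<longleftrightarrow> p = 0"
proof
  assume *: "expand_poly p = 0"
  show "p = 0"
  proof (rule poly_eqI)
    fix k
    have "expand_poly p $$ (- int k) = 0" using * by simp
    thus "coeff p k = coeff 0 k" by simp
  qed
qed simp

lemma expand_poly_pcompose:
  assumes "n \<ge> 1"
  shows "expand_poly (pcompose p (monom 1 n)) = fls_compose_power (expand_poly p) n"
proof (induction p)
  case (pCons a p)
  have X: "expand_poly (monom 1 n) = fls_compose_power fls_X_inv n"
    using assms by (intro fls_eqI) (auto simp: fls_nth_compose_power)
  have "expand_poly (pcompose (pCons a p) (monom 1 n)) =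
      fls_const a + expand_poly (monom 1 n) * expand_poly (pcompose p (monom 1 n))"
    unfolding pcompose_pCons expand_poly_add expand_poly_mult by (simp add: expand_poly_pCons)
  also have "\<dots> = fls_compose_power (expand_poly (pCons a p)) n"
    unfolding pCons.IH X expand_poly_pCons using assms
    by (simp add: fls_compose_power_const_left del: fls_compose_power_X_inv)
  finally show ?case .
qed simp

text \<open>An embedding of fields, independent of the chosen fraction by
  \<open>expand_Fract\<close>. In this direction \<open>1 / (q - 1)\<close> has nonnegative
  coefficients, which allows a counting interpretation.\<close>

definition expand :: "qfield \<Rightarrow> rat fls" where
  "expand x = (THE y. \<exists>a b. b \<noteq> 0 \<and> x = Fract a b \<and> y = expand_poly a / expand_poly b)"

lemma expand_Fract:
  assumes "b \<noteq> 0"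
  shows "expand (Fract a b) = expand_poly a / expand_poly b"
  unfolding expand_def
proof (rule the_equality)
  fix y assume "\<exists>c d. d \<noteq> 0 \<and> Fract a b = Fract c d \<and> y = expand_poly c / expand_poly d"
  then obtain c d where d: "d \<noteq> 0" "Fract a b = Fract c d" "y = expand_poly c / expand_poly d" by blast
  hence "a * d = c * b" using assms by (simp add: eq_fract)
  hence "expand_poly a * expand_poly d = expand_poly c * expand_poly b" by (metis expand_poly_mult)
  moreover have "expand_poly d \<noteq> 0" "expand_poly b \<noteq> 0" using assms d(1) by simp_all
  ultimately show "y = expand_poly a / expand_poly b" unfolding d(3) by (simp add: frac_eq_eq)
qed (use assms in blast)

lemma qfield_Fract_obtain:
  obtains a b where "(x :: qfield) = Fract a b" "b \<noteq> 0"
  by (cases x) auto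

lemma expand_add: "expand (x + y) = expand x + expand y"
proof -
  obtain a b where x: "x = Fract a b" "b \<noteq> 0" by (rule qfield_Fract_obtain)
  obtain c d where y: "y = Fract c d" "d \<noteq> 0" by (rule qfield_Fract_obtain)
  show ?thesis using x y
    by (simp add: expand_Fract expand_poly_add expand_poly_mult add_frac_eq)
qed

lemma expand_mult: "expand (x * y) = expand x * expand y"
proof -
  obtain a b where x: "x = Fract a b" "b \<noteq> 0" by (rule qfield_Fract_obtain)
  obtain c d where y: "y = Fract c d" "d \<noteq> 0" by (rule qfield_Fract_obtain)
  show ?thesis using x y by (simp add: expand_Fract expand_poly_mult)
qed

lemma expand_0 [simp]: "expand 0 = 0"
  by (simp add: Zero_fract_def expand_Fract)

lemma expand_1 [simp]: "expand 1 = 1"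
  by (simp add: One_fract_def expand_Fract)

lemma expand_inject: "expand x = expand y \<longleftrightarrow> x = y"
proof
  assume eq: "expand x = expand y"
  have "expand (x - y) + expand y = expand x" by (simp flip: expand_add)
  hence z: "expand (x - y) = 0" using eq by simp
  show "x = y"
  proof (rule ccontr)
    assume "x \<noteq> y"
    hence "expand (x - y) * expand (1 / (x - y)) = 1" by (simp flip: expand_mult)
    thus False using z by simp
  qed
qed simp

lemma expand_diff: "expand (x - y) = expand x - expand y"
proof -
  have "expand (x - y) + expand y = expand x" by (simp flip: expand_add)
  thus ?thesis by (simp add: eq_diff_eq)
qed

lemma expand_adams:
  assumes "n \<ge> 1"
  shows "expand (adams_scalar n x) = fls_compose_power (expand x) n"
proof -
  obtain a b where x: "x = Fract a b" "b \<noteq> 0" by (rule qfield_Fract_obtain)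
  have nz: "pcompose b (monom 1 n) \<noteq> 0" using pcompose_monom_neq_0 x assms by auto
  have b: "fls_compose_power (expand_poly b) n \<noteq> 0"
    using nz by (simp flip: expand_poly_pcompose[OF assms])
  have "fls_compose_power (expand x) n * fls_compose_power (expand_poly b) n =
      fls_compose_power (expand x * expand_poly b) n" using assms by simp
  also have "expand x * expand_poly b = expand_poly a" using x by (simp add: expand_Fract)
  finally show ?thesis using b nz assms
    by (simp add: x adams_scalar_Fract[OF assms] expand_Fract expand_poly_pcompose field_simps)
qed

lemma expand_q: "expand q = fls_X_inv ^ 2"
proof -
  have "expand qhalf = expand_poly [:0, 1:]"
    unfolding qhalf_def by (simp add: to_fract_def expand_Fract)
  also have "\<dots> = fls_X_inv" by (simp add: expand_poly_pCons)
  finally show ?thesis by (simp add: q_def power2_eq_square expand_mult)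
qed

lemma expand_power: "expand (x ^ n) = expand x ^ n"
  by (induction n) (auto simp: expand_mult)

lemma expand_sum: "expand (\<Sum>x\<in>X. f x) = (\<Sum>x\<in>X. expand (f x))"
  by (induction X rule: infinite_finite_induct) (auto simp: expand_add)

lemma expand_of_nat: "expand (of_nat n) = of_nat n"
  by (induction n) (auto simp: expand_add)

lemma adams_scalar_1: "adams_scalar 1 x = x"
proof -
  obtain a b where x: "x = Fract a b" "b \<noteq> 0" by (rule qfield_Fract_obtain)
  have "pcompose p (monom 1 1) = p" for p :: "rat poly"
  proof -
    have "monom 1 1 = [:0, 1 :: rat:]" by (simp add: monom_Suc monom_0)
    thus ?thesis using pcompose_idR[of p] by simp
  qed
  thus ?thesis using x by (simp add: adams_scalar_Fract)
qed

section \<open>Counting multisets of weighted objects\<close>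

lemma finite_le_imp_bdd_below:
  assumes "finite {x\<in>A. u x \<le> (0::int)}"
  obtains a where "a \<le> 0" "\<And>x. x \<in> A \<Longrightarrow> a \<le> u x"
proof -
  define a where "a = Min (insert 0 (u ` {x\<in>A. u x \<le> 0}))"
  have "a \<le> u x" if "x \<in> A" for x
  proof (cases "u x \<le> 0")
    case True
    thus ?thesis unfolding a_def using assms that by (intro Min_le) auto
  next
    case False
    moreover have "a \<le> 0" unfolding a_def using assms by (intro Min_le) auto
    ultimately show ?thesis by simp
  qed
  moreover have "a \<le> 0" unfolding a_def using assms by (intro Min_le) auto
  ultimately show ?thesis using that by blast
qed

lemma fls_times_nth_bounds:
  fixes f g :: "'k::field fls"
  assumes f: "\<And>i. i < a \<Longrightarrow> f $$ i = 0" and g: "\<And>i. i < b \<Longrightarrow> g $$ i = 0"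
  shows "(f * g) $$ n = (\<Sum>i\<in>{a..n - b}. f $$ i * g $$ (n - i))"
proof (cases "f = 0 \<or> g = 0")
  case False
  hence "f $$ fls_subdegree f \<noteq> 0" "g $$ fls_subdegree g \<noteq> 0" by simp_all
  hence "a \<le> fls_subdegree f" "b \<le> fls_subdegree g" using f g by (meson not_le)+
  hence "(\<Sum>i\<in>{fls_subdegree f..n - fls_subdegree g}. f $$ i * g $$ (n - i)) =
      (\<Sum>i\<in>{a..n - b}. f $$ i * g $$ (n - i))"
    by (intro sum.mono_neutral_left) auto
  thus ?thesis by (simp only: fls_times_nth(2))
qed auto

lemma fls_times_nth_card:
  fixes f g :: "rat fls"
  assumes f: "\<And>n. f $$ n = of_nat (card {x\<in>A. u x = n})"
    and g: "\<And>n. g $$ n = of_nat (card {y\<in>B. v y = n})"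
    and finA: "\<And>n. finite {x\<in>A. u x \<le> n}" and finB: "\<And>n. finite {y\<in>B. v y \<le> n}"
  shows "(f * g) $$ n = of_nat (card {z\<in>A \<times> B. u (fst z) + v (snd z) = n})"
    and "finite {z\<in>A \<times> B. u (fst z) + v (snd z) = n}"
proof -
  obtain a where a: "\<And>x. x \<in> A \<Longrightarrow> a \<le> u x" using finite_le_imp_bdd_below[OF finA] by metis
  obtain b where b: "\<And>y. y \<in> B \<Longrightarrow> b \<le> v y" using finite_le_imp_bdd_below[OF finB] by metis
  let ?C = "\<lambda>i. {x\<in>A. u x = i} \<times> {y\<in>B. v y = n - i}"
  have fin: "finite {x\<in>A. u x = i}" "finite {y\<in>B. v y = i}" for i
    by (rule finite_subset[OF _ finA[of i]], force) (rule finite_subset[OF _ finB[of i]], force)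
  have eq: "{z\<in>A \<times> B. u (fst z) + v (snd z) = n} = (\<Union>i\<in>{a..n - b}. ?C i)"
    using a b by (auto; smt (verit, best))
  show "finite {z\<in>A \<times> B. u (fst z) + v (snd z) = n}"
    unfolding eq using fin by (intro finite_UN_I finite_cartesian_product) auto
  have "card (\<Union>i\<in>{a..n - b}. ?C i) = (\<Sum>i\<in>{a..n - b}. card (?C i))"
    using fin by (intro card_UN_disjoint) auto
  also have "\<dots> = (\<Sum>i\<in>{a..n - b}. card {x\<in>A. u x = i} * card {y\<in>B. v y = n - i})"
    by (simp only: card_cartesian_product)
  finally have "of_nat (card {z\<in>A \<times> B. u (fst z) + v (snd z) = n}) =
      (\<Sum>i\<in>{a..n - b}. f $$ i * g $$ (n - i))"
    unfolding eq f g by (simp only: of_nat_sum of_nat_mult)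
  moreover have "f $$ i = 0" if "i < a" for i
  proof -
    have "{x\<in>A. u x = i} = {}" using a that by force
    thus ?thesis by (simp only: f card.empty of_nat_0)
  qed
  moreover have "g $$ i = 0" if "i < b" for i
  proof -
    have "{y\<in>B. v y = i} = {}" using b that by force
    thus ?thesis by (simp only: g card.empty of_nat_0)
  qed
  ultimately show "(f * g) $$ n = of_nat (card {z\<in>A \<times> B. u (fst z) + v (snd z) = n})"
    using fls_times_nth_bounds[of a f b g n] by simp
qed

text \<open>The finiteness needed for generating functions that are Laurent series:
  \<open>pw\<close> may take negative values, but for each weight only finitely many.\<close>

locale weighted =
  fixes X :: "'x set" and xw :: "'x \<Rightarrow> ('r \<Rightarrow>\<^sub>0 nat)" and pw :: "'x \<Rightarrow> int"
  assumes xw_nonzero: "x \<in> X \<Longrightarrow> xw x \<noteq> 0"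
    and finite_weight: "finite {x\<in>X. xw x = \<beta> \<and> pw x \<le> n}"
begin

definition msets :: "('r \<Rightarrow>\<^sub>0 nat) \<Rightarrow> 'x multiset set" where
  "msets \<alpha> = {M. set_mset M \<subseteq> X \<and> (\<Sum>x\<in>#M. xw x) = \<alpha>}"

definition mpw :: "'x multiset \<Rightarrow> int" where
  "mpw M = (\<Sum>x\<in>#M. pw x)"

lemma size_le_mdeg: "set_mset M \<subseteq> X \<Longrightarrow> size M \<le> mdeg (\<Sum>x\<in>#M. xw x)"
proof (induction M)
  case (add x M)
  have "xw x \<noteq> 0" using xw_nonzero add.prems by simp
  hence "0 < mdeg (xw x)" by simp
  moreover have "size M \<le> mdeg (\<Sum>x\<in>#M. xw x)" using add by simp
  ultimately show ?case
    unfolding size_add_mset image_mset_add_mset sum_mset.add_mset mdeg_add by linarith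
qed simp

text \<open>A multiset of weight \<alpha> has at most \<open>mdeg \<alpha>\<close> members, and
  their powers are at least some \<open>b \<le> 0\<close>. The members other than \<open>x\<close>
  therefore contribute at least \<open>int (mdeg \<alpha>) * b\<close>, which gives the bound on
  \<open>pw x\<close> used in \<open>E\<close>.\<close>

lemma finite_msets: "finite {M\<in>msets \<alpha>. mpw M \<le> n}"
proof -
  define B where "B = fst ` splits \<alpha>"
  have finB: "finite B" by (simp add: B_def)
  have fin: "finite {x\<in>X. xw x \<in> B \<and> pw x \<le> k}" for k
  proof -
    have "{x\<in>X. xw x \<in> B \<and> pw x \<le> k} = (\<Union>\<beta>\<in>B. {x\<in>X. xw x = \<beta> \<and> pw x \<le> k})" by auto
    thus ?thesis using finB finite_weight by simp
  qed
  have fin0: "finite {x\<in>{x\<in>X. xw x \<in> B}. pw x \<le> 0}" using fin[of 0] by (simp add: conj_assoc)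
  obtain b where b: "b \<le> 0" "\<And>x. x \<in> {x\<in>X. xw x \<in> B} \<Longrightarrow> b \<le> pw x"
    using finite_le_imp_bdd_below[OF fin0] by blast
  define E where "E = {x\<in>X. xw x \<in> B \<and> pw x \<le> n - int (mdeg \<alpha>) * b}"
  have "{M\<in>msets \<alpha>. mpw M \<le> n} \<subseteq> {M. set_mset M \<subseteq> E \<and> size M \<le> mdeg \<alpha>}"
  proof
    fix M assume M: "M \<in> {M\<in>msets \<alpha>. mpw M \<le> n}"
    have X: "set_mset M \<subseteq> X" and xwM: "(\<Sum>x\<in>#M. xw x) = \<alpha>" and pwM: "mpw M \<le> n"
      using M by (auto simp: msets_def)
    have size: "size M \<le> mdeg \<alpha>" using size_le_mdeg[OF X] xwM by simp
    have inB: "xw x \<in> B" if x: "x \<in># M" for x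
    proof -
      obtain N where N: "M = add_mset x N" using x by (meson multi_member_split)
      have "(xw x, \<Sum>y\<in>#N. xw y) \<in> splits \<alpha>" using xwM by (simp add: N)
      thus ?thesis unfolding B_def by (metis fst_conv imageI)
    qed
    have lower: "int (size N) * b \<le> mpw N" if "set_mset N \<subseteq> set_mset M" for N
      using that
    proof (induction N)
      case (add y N)
      have "b \<le> pw y" using add.prems X inB by (intro b(2)) auto
      with add show ?case by (simp add: mpw_def algebra_simps)
    qed (simp add: mpw_def)
    have "x \<in> E" if x: "x \<in># M" for x
    proof -
      obtain N where N: "M = add_mset x N" using x by (meson multi_member_split)
      have "int (mdeg \<alpha>) * b \<le> int (size N) * b"
        using size N b(1) by (intro mult_right_mono_neg) auto
      also have "\<dots> \<le> mpw N" by (rule lower) (auto simp: N)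
      finally have "pw x \<le> n - int (mdeg \<alpha>) * b" using pwM by (simp add: N mpw_def)
      thus ?thesis using x X inB by (auto simp: E_def)
    qed
    thus "M \<in> {M. set_mset M \<subseteq> E \<and> size M \<le> mdeg \<alpha>}" using size by auto
  qed
  moreover have "finite {M. set_mset M \<subseteq> E \<and> size M \<le> mdeg \<alpha>}"
    unfolding E_def by (rule finite_msets_of_size[OF fin])
  ultimately show ?thesis by (rule finite_subset)
qed

definition obj_gf :: "('r \<Rightarrow>\<^sub>0 nat) \<Rightarrow> rat fls" where
  "obj_gf \<beta> = Abs_fls (\<lambda>n. of_nat (card {x\<in>X. xw x = \<beta> \<and> pw x = n}))"

definition mset_gf :: "('r \<Rightarrow>\<^sub>0 nat) \<Rightarrow> rat fls" where
  "mset_gf \<alpha> = Abs_fls (\<lambda>n. of_nat (card {M\<in>msets \<alpha>. mpw M = n}))"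

lemma gf_nth:
  assumes "\<And>n. finite {x\<in>A. u x \<le> (n::int)}"
  shows "Abs_fls (\<lambda>n. of_nat (card {x\<in>A. u x = n})) $$ n = (of_nat (card {x\<in>A. u x = n}) :: rat)"
proof (rule nth_Abs_fls_ex_lower_bound)
  obtain a where a: "\<And>x. x \<in> A \<Longrightarrow> a \<le> u x" using finite_le_imp_bdd_below[OF assms] by metis
  show "\<exists>N. \<forall>n<N. (of_nat (card {x\<in>A. u x = n}) :: rat) = 0"
  proof (intro exI allI impI)
    fix k assume "k < a"
    hence "{x\<in>A. u x = k} = {}" using a by force
    thus "(of_nat (card {x\<in>A. u x = k}) :: rat) = 0" by (simp only: card.empty of_nat_0)
  qed
qed

lemma obj_gf_nth: "obj_gf \<beta> $$ n = of_nat (card {x\<in>X. xw x = \<beta> \<and> pw x = n})"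
  using gf_nth[of "{x\<in>X. xw x = \<beta>}" pw n] finite_weight by (simp add: obj_gf_def conj_assoc)

lemma mset_gf_nth: "mset_gf \<alpha> $$ n = of_nat (card {M\<in>msets \<alpha>. mpw M = n})"
  unfolding mset_gf_def by (rule gf_nth[OF finite_msets])

lemma compose_obj_gf_nth:
  assumes "m \<ge> 1"
  shows "fls_compose_power (obj_gf \<beta>) m $$ n =
    of_nat (card {x\<in>{x\<in>X. xw x = \<beta>}. int m * pw x = n})"
proof (cases "int m dvd n")
  case True
  then obtain k where k: "n = int m * k" by (elim dvdE)
  have "{x\<in>{x\<in>X. xw x = \<beta>}. int m * pw x = n} = {x\<in>X. xw x = \<beta> \<and> pw x = k}"
    using assms by (auto simp: k)
  thus ?thesis using assms by (simp add: fls_nth_compose_power k obj_gf_nth)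
next
  case False
  hence empty: "{x\<in>{x\<in>X. xw x = \<beta>}. int m * pw x = n} = {}" by auto
  show ?thesis unfolding empty using assms False by (simp add: fls_nth_compose_power)
qed

lemma finite_scaled_weight: "m \<ge> 1 \<Longrightarrow> finite {x\<in>{x\<in>X. xw x = \<beta>}. int m * pw x \<le> n}"
proof -
  assume m: "m \<ge> 1"
  have "pw x \<le> \<bar>n\<bar>" if "int m * pw x \<le> n" for x
  proof (rule ccontr)
    assume *: "\<not> pw x \<le> \<bar>n\<bar>"
    hence "1 * pw x \<le> int m * pw x" using m by (intro mult_right_mono) auto
    thus False using * that by simp
  qed
  hence "{x\<in>{x\<in>X. xw x = \<beta>}. int m * pw x \<le> n} \<subseteq> {x\<in>X. xw x = \<beta> \<and> pw x \<le> \<bar>n\<bar>}" by auto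
  thus ?thesis using finite_weight finite_subset by blast
qed

text \<open>A member \<open>x\<close> of \<open>M\<close> is listed once for each level up to its
  multiplicity, so summing \<open>lookup (xw x) i\<close> over these levels yields
  \<open>lookup \<alpha> i\<close> for every \<open>M\<close>.\<close>

definition marked :: "('r \<Rightarrow>\<^sub>0 nat) \<Rightarrow> int \<Rightarrow> (('x multiset \<times> 'x) \<times> nat) set" where
  "marked \<alpha> n = (SIGMA z : (SIGMA M : {M\<in>msets \<alpha>. mpw M = n}. set_mset M). {1..count (fst z) (snd z)})"

text \<open>The index set of the right side of the Euler equation: a splitting of the weight, a
  divisor \<open>k\<close> of its first part, an object whose weight is the quotient, and a multiset
  carrying the second part.\<close>

definition removed ::
    "('r \<Rightarrow>\<^sub>0 nat) \<Rightarrow> int \<Rightarrow> (((('r \<Rightarrow>\<^sub>0 nat) \<times> ('r \<Rightarrow>\<^sub>0 nat)) \<times> nat) \<times> ('x \<times> 'x multiset)) set" where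
  "removed \<alpha> n =
    (SIGMA y : (SIGMA s : splits \<alpha>. {k\<in>{1..mdeg (fst s)}. mdvd k (fst s)}).
      {z\<in>{x\<in>X. xw x = mdiv (snd y) (fst (fst y))} \<times> msets (snd (fst y)).
         int (snd y) * pw (fst z) + mpw (snd z) = n})"

lemma lookup_sum_mset: "lookup (\<Sum>x\<in>#M. xw x) i = (\<Sum>x\<in>#M. lookup (xw x) i)"
  by (induction M) (auto simp: lookup_add)

lemma lookup_sum_replicate: "lookup (\<Sum>x\<in>#replicate_mset k x. xw x) i = k * lookup (xw x) i"
  by (induction k) (auto simp: lookup_add)

text \<open>Removing \<open>k\<close> copies of \<open>x\<close> from a multiset containing at least \<open>k\<close> of them.\<close>

lemma marked_removed:
  fixes w :: "'x \<Rightarrow> rat"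
  shows "(\<Sum>z\<in>marked \<alpha> n. w (snd (fst z))) = (\<Sum>z\<in>removed \<alpha> n. w (fst (snd z)))"
proof -
  define j where "j = (\<lambda>z :: ('x multiset \<times> 'x) \<times> nat.
    let M = fst (fst z); x = snd (fst z); k = snd z; N = M - replicate_mset k x
    in (((\<Sum>y\<in>#replicate_mset k x. xw y, \<Sum>y\<in>#N. xw y), k), (x, N)))"
  define i where "i = (\<lambda>z :: ((('r \<Rightarrow>\<^sub>0 nat) \<times> ('r \<Rightarrow>\<^sub>0 nat)) \<times> nat) \<times> ('x \<times> 'x multiset).
    let x = fst (snd z); k = snd (fst z) in ((snd (snd z) + replicate_mset k x, x), k))"
  have ij: "i (j z) = z \<and> j z \<in> removed \<alpha> n" if z: "z \<in> marked \<alpha> n" for z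
  proof -
    obtain M x k where zM: "z = ((M, x), k)" by (metis prod.exhaust)
    have M: "set_mset M \<subseteq> X" "(\<Sum>y\<in>#M. xw y) = \<alpha>" "mpw M = n" "x \<in># M" "1 \<le> k" "k \<le> count M x"
      using z by (auto simp: zM marked_def msets_def)
    define N where "N = M - replicate_mset k x"
    have MN: "M = N + replicate_mset k x"
      using M(6) by (simp add: N_def count_le_replicate_mset_subset_eq)
    let ?b = "\<Sum>y\<in>#replicate_mset k x. xw y"
    have j: "j z = (((?b, \<Sum>y\<in>#N. xw y), k), (x, N))" by (simp add: j_def zM N_def Let_def)
    have "i (j z) = z" unfolding j by (simp add: i_def zM MN)
    have dvd: "mdvd k ?b" unfolding mdvd_def lookup_sum_replicate by simp
    have div: "mdiv k ?b = xw x"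
    proof (rule poly_mapping_eqI)
      fix l
      show "lookup (mdiv k ?b) l = lookup (xw x) l"
        unfolding lookup_mdiv lookup_sum_replicate using M(5) by simp
    qed
    have "x \<in> X" using M(1,4) by auto
    have "?b \<noteq> 0"
    proof
      assume b0: "?b = 0"
      have "mdiv k 0 = (0 :: 'r \<Rightarrow>\<^sub>0 nat)" by (rule poly_mapping_eqI) (simp add: lookup_mdiv)
      thus False using div xw_nonzero[OF \<open>x \<in> X\<close>] unfolding b0 by simp
    qed
    hence le: "k \<le> mdeg ?b" by (rule mdvd_le_mdeg[OF dvd])
    have sp: "(?b, \<Sum>y\<in>#N. xw y) \<in> splits \<alpha>"
      unfolding splits_iff M(2)[symmetric] MN image_mset_union sum_mset.union by (rule add.commute)
    have pn: "int k * pw x + mpw N = n"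
      unfolding M(3)[symmetric] MN by (simp add: mpw_def)
    have NX: "N \<in> msets (\<Sum>y\<in>#N. xw y)" using M(1) by (auto simp: msets_def MN)
    have "j z \<in> removed \<alpha> n"
      unfolding j removed_def using le sp pn NX dvd div \<open>x \<in> X\<close> M(5) by auto
    with \<open>i (j z) = z\<close> show ?thesis by blast
  qed
  have ji: "j (i z) = z \<and> i z \<in> marked \<alpha> n" if z: "z \<in> removed \<alpha> n" for z
  proof -
    obtain \<beta> \<gamma> k x N where zN: "z = (((\<beta>, \<gamma>), k), (x, N))" by (metis prod.exhaust)
    have s: "\<beta> + \<gamma> = \<alpha>" "1 \<le> k" "mdvd k \<beta>" "x \<in> X" "xw x = mdiv k \<beta>" "N \<in> msets \<gamma>"
      "int k * pw x + mpw N = n"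
      using z by (auto simp: zN removed_def)
    have \<beta>: "(\<Sum>y\<in>#replicate_mset k x. xw y) = \<beta>"
    proof (rule poly_mapping_eqI)
      fix l
      show "lookup (\<Sum>y\<in>#replicate_mset k x. xw y) l = lookup \<beta> l"
        unfolding lookup_sum_replicate s(5) lookup_mdiv using s(3) by (simp add: mdvd_def)
    qed
    have \<gamma>: "(\<Sum>y\<in>#N. xw y) = \<gamma>" "set_mset N \<subseteq> X" using s(6) by (auto simp: msets_def)
    have i: "i z = ((N + replicate_mset k x, x), k)" by (simp add: i_def zN Let_def)
    have "j (i z) = (((\<Sum>y\<in>#replicate_mset k x. xw y, \<Sum>y\<in>#N. xw y), k), (x, N))"
      unfolding i j_def Let_def fst_conv snd_conv add_diff_cancel_right' ..
    hence "j (i z) = z" unfolding \<beta> \<gamma>(1) zN .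
    have "(\<Sum>y\<in>#N + replicate_mset k x. xw y) = \<alpha>"
      unfolding image_mset_union sum_mset.union \<beta> \<gamma>(1) using s(1) by (simp only: add.commute)
    moreover have "mpw (N + replicate_mset k x) = n"
      unfolding s(7)[symmetric] by (simp add: mpw_def)
    moreover have "set_mset (N + replicate_mset k x) \<subseteq> X" using \<gamma>(2) s(4) by (auto split: if_splits)
    moreover have "x \<in># N + replicate_mset k x" using s(2) by simp
    moreover have "k \<in> {1..count (N + replicate_mset k x) x}" using s(2) by simp
    ultimately have "i z \<in> marked \<alpha> n" unfolding i marked_def msets_def by simp
    with \<open>j (i z) = z\<close> show ?thesis by blast
  qed
  show ?thesis
    by (rule sum.reindex_bij_witness[where i = i and j = j])
       (use ij ji in blast, use ij in blast, use ji in blast, use ji in blast,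
        simp add: j_def Let_def)
qed

lemma sum_mset_count: "(\<Sum>x\<in>#M. g x) = (\<Sum>x\<in>set_mset M. count M x * g x)" for g :: "'x \<Rightarrow> nat"
proof -
  have "(\<Sum>x\<in>#M. g x) = (\<Sum>x\<in>S. count M x * g x)" if "finite S" "set_mset M \<subseteq> S" for S
    using that(2)
  proof (induction M)
    case (add y M)
    have "(\<Sum>x\<in>S. count (add_mset y M) x * g x) =
        (\<Sum>x\<in>S. count M x * g x + (if x = y then g y else 0))"
      by (intro sum.cong) auto
    also have "\<dots> = (\<Sum>x\<in>S. count M x * g x) + g y"
      using that(1) add.prems by (simp add: sum.distrib)
    finally show ?case using add by simp
  qed simp
  thus ?thesis by simp
qed

lemma finite_removed_fiber:
  assumes "k \<ge> 1"
  shows "finite {z\<in>{x\<in>X. xw x = \<beta>} \<times> msets \<gamma>. int k * pw (fst z) + mpw (snd z) = n}"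
  by (rule fls_times_nth_card(2)[OF compose_obj_gf_nth[OF assms] mset_gf_nth
        finite_scaled_weight[OF assms] finite_msets])

text \<open>Double counting: the two sides of the Euler equation sum \<open>lookup (xw x) i\<close>
  over \<open>marked\<close> and over \<open>removed\<close>. The \<open>k\<close> removed copies of
  \<open>x\<close> have power \<open>k\<close> times \<open>pw x\<close>, which is what
  \<open>fls_compose_power\<close> records.\<close>

theorem pleth_exp_mset_gf: "pleth_exp (\<lambda>k f. fls_compose_power f k) obj_gf mset_gf"
  unfolding pleth_exp_def
proof (intro conjI allI)
  show "mset_gf 0 = 1"
  proof (rule fls_eqI)
    fix n
    have "M = {#}" if "M \<in> msets 0" for M
    proof -
      have "size M \<le> mdeg (\<Sum>x\<in>#M. xw x)" using that by (intro size_le_mdeg) (simp add: msets_def)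
      thus ?thesis using that by (simp add: msets_def)
    qed
    hence "msets 0 = {{#}}" by (auto simp: msets_def)
    hence "{M\<in>msets 0. mpw M = n} = (if n = 0 then {{#}} else {})" by (auto simp: mpw_def)
    thus "mset_gf 0 $$ n = 1 $$ n" by (simp add: mset_gf_nth)
  qed
next
  fix \<alpha> :: "'r \<Rightarrow>\<^sub>0 nat" and i
  show "of_nat (lookup \<alpha> i) * mset_gf \<alpha> =
      (\<Sum>(\<beta>, \<gamma>)\<in>splits \<alpha>. log_deriv (\<lambda>k f. fls_compose_power f k) i obj_gf \<beta> * mset_gf \<gamma>)"
  proof (rule fls_eqI)
    fix n
    let ?w = "\<lambda>x. of_nat (lookup (xw x) i) :: rat"
    let ?MS = "{M\<in>msets \<alpha>. mpw M = n}"
    have finMS: "finite ?MS" by (rule finite_subset[OF _ finite_msets[of \<alpha> n]]) auto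
    have of_nat_nth: "(of_nat k * f) $$ n = of_nat k * f $$ n" for k and f :: "rat fls"
      by (simp add: fls_of_nat)
    have "(of_nat (lookup \<alpha> i) * mset_gf \<alpha>) $$ n = (\<Sum>M\<in>?MS. of_nat (lookup \<alpha> i))"
      by (simp add: of_nat_nth mset_gf_nth mult.commute)
    also have "\<dots> = (\<Sum>M\<in>?MS. \<Sum>x\<in>set_mset M. \<Sum>k\<in>{1..count M x}. ?w x)"
    proof (rule sum.cong)
      fix M assume "M \<in> ?MS"
      hence "lookup \<alpha> i = (\<Sum>x\<in>#M. lookup (xw x) i)" by (auto simp: msets_def lookup_sum_mset)
      thus "of_nat (lookup \<alpha> i) = (\<Sum>x\<in>set_mset M. \<Sum>k\<in>{1..count M x}. ?w x)"
        by (simp add: sum_mset_count)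
    qed simp
    also have "\<dots> = (\<Sum>z\<in>marked \<alpha> n. ?w (snd (fst z)))"
    proof -
      have f: "\<forall>M\<in>?MS. finite (set_mset M)" by simp
      have fS: "finite (Sigma ?MS set_mset)" using finMS by (intro finite_SigmaI) auto
      have f2: "\<forall>z\<in>Sigma ?MS set_mset. finite {1..count (fst z) (snd z)}" by simp
      have "(\<Sum>M\<in>?MS. \<Sum>x\<in>set_mset M. \<Sum>k\<in>{1..count M x}. ?w x) =
          (\<Sum>z\<in>Sigma ?MS set_mset. \<Sum>k\<in>{1..count (fst z) (snd z)}. ?w (snd z))"
        unfolding sum.Sigma[OF finMS f] by (simp only: case_prod_unfold)
      also have "\<dots> = (\<Sum>z\<in>marked \<alpha> n. ?w (snd (fst z)))"
        unfolding marked_def sum.Sigma[OF fS f2] by (simp only: case_prod_unfold)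
      finally show ?thesis .
    qed
    also have "\<dots> = (\<Sum>z\<in>removed \<alpha> n. ?w (fst (snd z)))"
      by (rule marked_removed)
    also have "\<dots> = (\<Sum>s\<in>splits \<alpha>. \<Sum>k\<in>{k\<in>{1..mdeg (fst s)}. mdvd k (fst s)}.
        \<Sum>z\<in>{z\<in>{x\<in>X. xw x = mdiv k (fst s)} \<times> msets (snd s). int k * pw (fst z) + mpw (snd z) = n}. ?w (fst z))"
    proof -
      let ?K = "\<lambda>s :: ('r \<Rightarrow>\<^sub>0 nat) \<times> ('r \<Rightarrow>\<^sub>0 nat). {k\<in>{1..mdeg (fst s)}. mdvd k (fst s)}"
      let ?Z = "\<lambda>(s :: ('r \<Rightarrow>\<^sub>0 nat) \<times> ('r \<Rightarrow>\<^sub>0 nat)) k. {z\<in>{x\<in>X. xw x = mdiv k (fst s)} \<times> msets (snd s). int k * pw (fst z) + mpw (snd z) = n}"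
      have f: "\<forall>s\<in>splits \<alpha>. finite (?K s)" by simp
      have fS: "finite (Sigma (splits \<alpha>) ?K)" by (intro finite_SigmaI) auto
      have f2: "\<forall>y\<in>Sigma (splits \<alpha>) ?K. finite (?Z (fst y) (snd y))"
      proof
        fix y assume "y \<in> Sigma (splits \<alpha>) ?K"
        hence "snd y \<ge> 1" by auto
        thus "finite (?Z (fst y) (snd y))" by (rule finite_removed_fiber)
      qed
      have "(\<Sum>s\<in>splits \<alpha>. \<Sum>k\<in>?K s. \<Sum>z\<in>?Z s k. ?w (fst z)) =
          (\<Sum>y\<in>Sigma (splits \<alpha>) ?K. \<Sum>z\<in>?Z (fst y) (snd y). ?w (fst z))"
        unfolding sum.Sigma[OF finite_splits f] by (simp only: case_prod_unfold)
      also have "\<dots> = (\<Sum>z\<in>removed \<alpha> n. ?w (fst (snd z)))"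
        unfolding removed_def sum.Sigma[OF fS f2] by (simp only: case_prod_unfold)
      finally show ?thesis by (rule sym)
    qed
    also have "\<dots> = (\<Sum>s\<in>splits \<alpha>. \<Sum>k\<in>{k\<in>{1..mdeg (fst s)}. mdvd k (fst s)}.
        (of_nat (lookup (fst s) i div k) * (fls_compose_power (obj_gf (mdiv k (fst s))) k * mset_gf (snd s))) $$ n)"
    proof (intro sum.cong refl)
      fix s :: "('r \<Rightarrow>\<^sub>0 nat) \<times> ('r \<Rightarrow>\<^sub>0 nat)" and k assume k: "k \<in> {k\<in>{1..mdeg (fst s)}. mdvd k (fst s)}"
      let ?Z = "{z\<in>{x\<in>X. xw x = mdiv k (fst s)} \<times> msets (snd s). int k * pw (fst z) + mpw (snd z) = n}"
      have k1: "k \<ge> 1" using k by simp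
      have "(\<Sum>z\<in>?Z. ?w (fst z)) = (\<Sum>z\<in>?Z. of_nat (lookup (fst s) i div k))"
        by (intro sum.cong refl) (auto simp: lookup_mdiv)
      also have "\<dots> = of_nat (lookup (fst s) i div k) * of_nat (card ?Z)" by simp
      also have "of_nat (card ?Z) = (fls_compose_power (obj_gf (mdiv k (fst s))) k * mset_gf (snd s)) $$ n"
        by (rule fls_times_nth_card(1)[OF compose_obj_gf_nth[OF k1] mset_gf_nth
              finite_scaled_weight[OF k1] finite_msets, symmetric])
      finally show "(\<Sum>z\<in>?Z. ?w (fst z)) = (of_nat (lookup (fst s) i div k) *
          (fls_compose_power (obj_gf (mdiv k (fst s))) k * mset_gf (snd s))) $$ n"
        by (simp only: of_nat_nth)
    qed
    also have "\<dots> = (\<Sum>s\<in>splits \<alpha>. log_deriv (\<lambda>k f. fls_compose_power f k) i obj_gf (fst s) * mset_gf (snd s)) $$ n"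
    proof -
      have nth_sum: "(\<Sum>x\<in>Y. h x) $$ n = (\<Sum>x\<in>Y. h x $$ n)" for Y :: "'z set" and h :: "'z \<Rightarrow> rat fls"
        by (induction Y rule: infinite_finite_induct) auto
      have "log_deriv (\<lambda>k f. fls_compose_power f k) i obj_gf \<beta> * g = (\<Sum>k\<in>{k\<in>{1..mdeg \<beta>}. mdvd k \<beta>}.
          of_nat (lookup \<beta> i div k) * (fls_compose_power (obj_gf (mdiv k \<beta>)) k * g))" for \<beta> g
        unfolding log_deriv_def sum.inter_filter[OF finite_atLeastAtMost] sum_distrib_right
        by (intro sum.cong refl) (simp add: mult.assoc)
      thus ?thesis by (simp only: nth_sum)
    qed
    finally show "(of_nat (lookup \<alpha> i) * mset_gf \<alpha>) $$ n =
      (\<Sum>(\<beta>, \<gamma>)\<in>splits \<alpha>. log_deriv (\<lambda>k f. fls_compose_power f k) i obj_gf \<beta> * mset_gf \<gamma>) $$ n"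
      by (simp only: case_prod_unfold)
  qed
qed

end

section \<open>Polynomiality\<close>

text \<open>The polynomials in \<open>q\<close> with rational coefficients: Laurent series are
  bounded below, so only finitely many nonpositive even indices can occur.\<close>

definition polyq :: "qfield set" where
  "polyq = {x. \<forall>n. expand x $$ n \<noteq> 0 \<longrightarrow> n \<le> 0 \<and> even n}"

lemma polyqI: "(\<And>n. expand x $$ n \<noteq> 0 \<Longrightarrow> n \<le> 0 \<and> even n) \<Longrightarrow> x \<in> polyq"
  unfolding polyq_def by blast

lemma polyqD:
  assumes "x \<in> polyq" "expand x $$ n \<noteq> 0"
  shows "n \<le> 0" "even n"
  using assms unfolding polyq_def by blast+

lemma fls_times_nonzero_obtain:
  assumes "(f * g :: rat fls) $$ n \<noteq> 0"
  obtains i where "f $$ i \<noteq> 0" "g $$ (n - i) \<noteq> 0"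
proof -
  have "(\<Sum>i\<in>{fls_subdegree f..n - fls_subdegree g}. f $$ i * g $$ (n - i)) \<noteq> 0"
    using assms unfolding fls_times_nth(2) .
  then obtain i where "f $$ i * g $$ (n - i) \<noteq> 0" by (meson sum.neutral)
  hence "f $$ i \<noteq> 0" "g $$ (n - i) \<noteq> 0" by auto
  thus ?thesis by (rule that)
qed

lemma expand_q_power: "expand (q ^ k) = fls_X_inv ^ (2 * k)"
  by (simp only: expand_power expand_q power_mult)

lemma q_neq_1: "q \<noteq> 1"
proof
  assume "q = 1"
  hence "fls_X_inv ^ 2 = (1 :: rat fls)" by (metis expand_q expand_1)
  hence "(fls_X_inv ^ 2 :: rat fls) $$ 0 = 1 $$ 0" by simp
  thus False by simp
qed

lemma adams_add: "n \<ge> 1 \<Longrightarrow> adams_scalar n (x + y) = adams_scalar n x + adams_scalar n y"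
  by (simp add: expand_adams expand_add flip: expand_inject)

lemma adams_mult: "n \<ge> 1 \<Longrightarrow> adams_scalar n (x * y) = adams_scalar n x * adams_scalar n y"
  by (simp add: expand_adams expand_mult flip: expand_inject)

lemma adams_q_power:
  assumes "n \<ge> 1"
  shows "adams_scalar n (q ^ k) = q ^ (n * k)"
proof -
  have "fls_compose_power (fls_X_inv ^ (2 * k)) n = (fls_X_inv ^ (2 * (n * k)) :: rat fls)"
  proof (rule fls_eqI)
    fix j :: int
    have n0: "n > 0" using assms by simp
    have "- int (2 * (n * k)) = int n * (- int (2 * k))" by simp
    moreover have "int n \<noteq> 0" using assms by simp
    ultimately have j: "int n dvd j \<and> j div int n = - int (2 * k) \<longleftrightarrow> j = - int (2 * (n * k))"
      by (smt (verit) dvd_mult_div_cancel dvd_triv_left nonzero_mult_div_cancel_left)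
    thus "fls_compose_power (fls_X_inv ^ (2 * k)) n $$ j = (fls_X_inv ^ (2 * (n * k)) :: rat fls) $$ j"
      unfolding fls_nth_compose_power[OF n0] fls_X_inv_power_nth using j by argo
  qed
  thus ?thesis using assms by (simp only: expand_adams expand_q_power flip: expand_inject)
qed

interpretation polyq: pleth_closed adams_scalar polyq
proof
  show "0 \<in> polyq" "1 \<in> polyq" by (auto simp: polyq_def)
  show "x + y \<in> polyq" if "x \<in> polyq" "y \<in> polyq" for x y
  proof (rule polyqI)
    fix n assume "expand (x + y) $$ n \<noteq> 0"
    hence "(expand x + expand y) $$ n \<noteq> 0" unfolding expand_add .
    hence "expand x $$ n \<noteq> 0 \<or> expand y $$ n \<noteq> 0" by auto
    thus "n \<le> 0 \<and> even n" using polyqD[OF that(1)] polyqD[OF that(2)] by blast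
  qed
  show "x * y \<in> polyq" if "x \<in> polyq" "y \<in> polyq" for x y
  proof (rule polyqI)
    fix n assume "expand (x * y) $$ n \<noteq> 0"
    hence "(expand x * expand y) $$ n \<noteq> 0" unfolding expand_mult .
    then obtain i where i: "expand x $$ i \<noteq> 0" "expand y $$ (n - i) \<noteq> 0"
      by (rule fls_times_nonzero_obtain)
    have "i \<le> 0" "n - i \<le> 0" "even i" "even (n - i)"
      using polyqD[OF that(1) i(1)] polyqD[OF that(2) i(2)] by blast+
    thus "n \<le> 0 \<and> even n" by presburger
  qed
  show "- x \<in> polyq" if "x \<in> polyq" for x
  proof -
    have "expand (- x) = - expand x" using expand_diff[of 0 x] by simp
    thus ?thesis using that unfolding polyq_def by simp
  qed
  show "inverse (of_nat (Suc n)) \<in> polyq" for n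
  proof -
    let ?x = "inverse (of_nat (Suc n)) :: qfield"
    have "expand (of_nat (Suc n) * ?x) = 1" by (simp del: of_nat_Suc)
    hence 1: "of_nat (Suc n) * expand ?x = 1" by (simp only: expand_mult expand_of_nat)
    have "expand ?x $$ k = 0" if "k \<noteq> 0" for k
    proof -
      have "(of_nat (Suc n) * expand ?x) $$ k = 0" unfolding 1 using that by simp
      thus ?thesis unfolding fls_of_nat by (simp del: of_nat_Suc)
    qed
    hence "k = 0" if "expand ?x $$ k \<noteq> 0" for k using that by blast
    thus ?thesis by (intro polyqI) (metis even_zero order_refl)
  qed
  show "adams_scalar n x \<in> polyq" if "n \<ge> 1" "x \<in> polyq" for n x
  proof (rule polyqI)
    fix k assume "expand (adams_scalar n x) $$ k \<noteq> 0"
    hence "fls_compose_power (expand x) n $$ k \<noteq> 0" unfolding expand_adams[OF that(1)] .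
    hence k: "int n dvd k" "expand x $$ (k div int n) \<noteq> 0"
      using that(1) fls_nth_compose_power[of n "expand x" k] by (metis not_one_le_zero gr0I)+
    obtain l where l: "k = int n * l" using k(1) by (rule dvdE)
    have "k div int n = l" using that(1) unfolding l by simp
    hence "l \<le> 0" "even l" using k(2) polyqD[OF that(2)] by blast+
    thus "k \<le> 0 \<and> even k" unfolding l by (simp add: mult_nonneg_nonpos)
  qed
  show "adams_scalar 1 x = x" for x by (rule adams_scalar_1)
qed

lemma q_power_polyq: "q ^ k \<in> polyq"
  by (rule polyqI) (auto simp: expand_q_power split: if_splits)

section \<open>q-integers and dilations of the variables\<close>

definition qint :: "nat \<Rightarrow> qfield" where
  "qint n = (q ^ n - 1) / (q - 1)"

lemma qint_eq_sum: "qint n = (\<Sum>j<n. q ^ j)"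
  unfolding qint_def by (rule geometric_sum[OF q_neq_1, symmetric])

lemma qint_polyq: "qint n \<in> polyq"
  unfolding qint_eq_sum by (intro polyq.closed_sum q_power_polyq)

lemma qint_add: "qint (k + l) = qint k + q ^ k * qint l"
  by (simp add: qint_def power_add diff_divide_distrib algebra_simps flip: add_divide_distrib)

lemma qint_0 [simp]: "qint 0 = 0"
  by (simp add: qint_def)

definition mdot :: "('r::finite \<Rightarrow> nat) \<Rightarrow> ('r \<Rightarrow>\<^sub>0 nat) \<Rightarrow> nat" where
  "mdot v \<alpha> = (\<Sum>i\<in>UNIV. v i * lookup \<alpha> i)"

lemma mdot_add: "mdot v (\<beta> + \<gamma>) = mdot v \<beta> + mdot v \<gamma>"
  by (simp add: mdot_def lookup_add distrib_left sum.distrib)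

lemma mdot_mdiv: "mdvd n \<beta> \<Longrightarrow> n * mdot v (mdiv n \<beta>) = mdot v \<beta>"
  unfolding mdot_def sum_distrib_left
  by (intro sum.cong refl) (simp add: lookup_mdiv mdvd_def mult.left_commute)

lemma mdot_unit: "mdot (\<lambda>j. if j = i then 1 else 0) \<alpha> = lookup \<alpha> i"
proof -
  have "mdot (\<lambda>j. if j = i then 1 else 0) \<alpha> = (\<Sum>j\<in>UNIV. if j = i then lookup \<alpha> j else 0)"
    unfolding mdot_def by (intro sum.cong) auto
  thus ?thesis by simp
qed

text \<open>Dilating each variable by a power of \<open>q\<close> commutes with the Adams
  operations, because \<open>adams_scalar n\<close> sends \<open>q ^ k\<close> to
  \<open>q ^ (n * k)\<close> while the exponents of the variables are also multiplied by
  \<open>n\<close>.\<close>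

lemma pleth_exp_scale:
  assumes "pleth_exp adams_scalar f F"
  shows "pleth_exp adams_scalar (\<lambda>\<beta>. q ^ mdot v \<beta> * f \<beta>) (\<lambda>\<alpha>. q ^ mdot v \<alpha> * F \<alpha>)"
proof -
  have ld: "log_deriv adams_scalar i (\<lambda>\<beta>. q ^ mdot v \<beta> * f \<beta>) \<beta> =
      q ^ mdot v \<beta> * log_deriv adams_scalar i f \<beta>" for i \<beta>
    unfolding log_deriv_def sum_distrib_left
  proof (rule sum.cong)
    fix n assume "n \<in> {1..mdeg \<beta>}"
    hence n: "n \<ge> 1" by simp
    have "adams_scalar n (q ^ mdot v (mdiv n \<beta>) * f (mdiv n \<beta>)) =
        q ^ mdot v \<beta> * adams_scalar n (f (mdiv n \<beta>))" if "mdvd n \<beta>"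
      by (simp only: adams_mult[OF n] adams_q_power[OF n] mdot_mdiv[OF that])
    thus "(if mdvd n \<beta> then of_nat (lookup \<beta> i div n) *
        adams_scalar n (q ^ mdot v (mdiv n \<beta>) * f (mdiv n \<beta>)) else 0) =
       q ^ mdot v \<beta> * (if mdvd n \<beta> then of_nat (lookup \<beta> i div n) * adams_scalar n (f (mdiv n \<beta>)) else 0)"
      by (simp add: mult.left_commute)
  qed simp
  show ?thesis unfolding pleth_exp_def ld
  proof (intro conjI allI)
    show "q ^ mdot v 0 * F 0 = 1" using pleth_exp_0[OF assms] by (simp add: mdot_def)
    fix \<alpha> i
    have "of_nat (lookup \<alpha> i) * (q ^ mdot v \<alpha> * F \<alpha>) = q ^ mdot v \<alpha> * (of_nat (lookup \<alpha> i) * F \<alpha>)"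
      by (rule mult.left_commute)
    also have "\<dots> = (\<Sum>(\<beta>, \<gamma>)\<in>splits \<alpha>. q ^ mdot v \<alpha> * (log_deriv adams_scalar i f \<beta> * F \<gamma>))"
      unfolding pleth_exp_deriv[OF assms] by (simp add: sum_distrib_left case_prod_unfold)
    also have "\<dots> = (\<Sum>(\<beta>, \<gamma>)\<in>splits \<alpha>. q ^ mdot v \<beta> * log_deriv adams_scalar i f \<beta> * (q ^ mdot v \<gamma> * F \<gamma>))"
      by (intro sum.cong refl) (auto simp: mdot_add power_add)
    finally show "of_nat (lookup \<alpha> i) * (q ^ mdot v \<alpha> * F \<alpha>) =
      (\<Sum>(\<beta>, \<gamma>)\<in>splits \<alpha>. q ^ mdot v \<beta> * log_deriv adams_scalar i f \<beta> * (q ^ mdot v \<gamma> * F \<gamma>))" .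
  qed
qed

text \<open>A series with constant coefficient 1 can be cancelled from a product, here by recursion
  on the degree.\<close>

lemma splits_cancel:
  fixes A B F :: "('r \<Rightarrow>\<^sub>0 nat) \<Rightarrow> 'k::comm_ring_1"
  assumes eq: "\<And>\<alpha>. (\<Sum>(\<beta>, \<gamma>)\<in>splits \<alpha>. A \<beta> * F \<gamma>) = (\<Sum>(\<beta>, \<gamma>)\<in>splits \<alpha>. B \<beta> * F \<gamma>)"
    and F0: "F 0 = 1"
  shows "A \<alpha> = B \<alpha>"
proof (induction "mdeg \<alpha>" arbitrary: \<alpha> rule: less_induct)
  case less
  have fin: "finite (splits \<alpha>)" "(\<alpha>, 0) \<in> splits \<alpha>" by auto
  have "(\<Sum>x\<in>splits \<alpha> - {(\<alpha>, 0)}. case x of (\<beta>, \<gamma>) \<Rightarrow> A \<beta> * F \<gamma>) =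
        (\<Sum>x\<in>splits \<alpha> - {(\<alpha>, 0)}. case x of (\<beta>, \<gamma>) \<Rightarrow> B \<beta> * F \<gamma>)"
  proof (rule sum.cong)
    fix x assume x: "x \<in> splits \<alpha> - {(\<alpha>, 0)}"
    obtain \<beta> \<gamma> where bg: "x = (\<beta>, \<gamma>)" by (cases x)
    have "\<gamma> \<noteq> 0" using x bg by auto
    hence "mdeg \<beta> < mdeg \<alpha>" using splits_nonzero_mdeg_less(2) x bg by blast
    hence "A \<beta> = B \<beta>" by (rule less)
    thus "(case x of (\<beta>, \<gamma>) \<Rightarrow> A \<beta> * F \<gamma>) = (case x of (\<beta>, \<gamma>) \<Rightarrow> B \<beta> * F \<gamma>)" by (simp add: bg)
  qed simp
  thus ?case using eq[of \<alpha>] unfolding sum.remove[OF fin] by (simp add: F0)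
qed

text \<open>Associativity of convolution with an inner factor that also depends on the outer index;
  in \<open>qint_polynomial\<close> the dilation vector depends on \<open>\<beta>\<close>.\<close>

lemma splits_assoc:
  fixes w :: "('r \<Rightarrow>\<^sub>0 nat) \<Rightarrow> 'k::comm_ring_1"
  shows "(\<Sum>(\<beta>, \<gamma>)\<in>splits \<alpha>. w \<beta> * (\<Sum>(\<delta>, \<epsilon>)\<in>splits \<gamma>. g \<beta> \<delta> * f \<epsilon>)) =
         (\<Sum>(\<rho>, \<epsilon>)\<in>splits \<alpha>. (\<Sum>(\<beta>, \<delta>)\<in>splits \<rho>. w \<beta> * g \<beta> \<delta>) * f \<epsilon>)"
proof -
  have "(\<Sum>(\<rho>, \<epsilon>)\<in>splits \<alpha>. (\<Sum>(\<beta>, \<delta>)\<in>splits \<rho>. w \<beta> * g \<beta> \<delta>) * f \<epsilon>)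
      = (\<Sum>p\<in>splits \<alpha>. \<Sum>p'\<in>splits (fst p). w (fst p') * g (fst p') (snd p') * f (snd p))"
    by (simp add: case_prod_unfold sum_distrib_right)
  also have "\<dots> = (\<Sum>(p, p')\<in>Sigma (splits \<alpha>) (\<lambda>p. splits (fst p)).
                     w (fst p') * g (fst p') (snd p') * f (snd p))"
    by (rule sum.Sigma) auto
  also have "\<dots> = (\<Sum>(p, p')\<in>Sigma (splits \<alpha>) (\<lambda>p. splits (snd p)).
                     w (fst p) * (g (fst p) (fst p') * f (snd p')))"
    by (rule sum.reindex_bij_witness
          [where i = "\<lambda>(p, p'). ((fst p + fst p', snd p'), (fst p, fst p'))"
             and j = "\<lambda>(p, p'). ((fst p', snd p' + snd p), (snd p', snd p))"])
       (auto simp: add.assoc mult.assoc)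
  also have "\<dots> = (\<Sum>p\<in>splits \<alpha>. \<Sum>p'\<in>splits (snd p). w (fst p) * (g (fst p) (fst p') * f (snd p')))"
    by (rule sum.Sigma[symmetric]) auto
  also have "\<dots> = (\<Sum>(\<beta>, \<gamma>)\<in>splits \<alpha>. w \<beta> * (\<Sum>(\<delta>, \<epsilon>)\<in>splits \<gamma>. g \<beta> \<delta> * f \<epsilon>))"
    by (simp add: case_prod_unfold sum_distrib_left)
  finally show ?thesis by (rule sym)
qed

section \<open>The polarised quadratic form\<close>

definition bil_form :: "nat ^ 'r ^ 'r \<Rightarrow> ('r::finite \<Rightarrow>\<^sub>0 nat) \<Rightarrow> ('r \<Rightarrow>\<^sub>0 nat) \<Rightarrow> nat" where
  "bil_form C \<beta> \<gamma> = (\<Sum>i\<in>UNIV. \<Sum>j\<in>UNIV. lookup \<beta> i * C $ i $ j * lookup \<gamma> j) +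
     (\<Sum>i\<in>UNIV. \<Sum>j\<in>UNIV. lookup \<gamma> i * C $ i $ j * lookup \<beta> j)"

lemma quad_form_add: "quad_form C (\<beta> + \<gamma>) = quad_form C \<beta> + quad_form C \<gamma> + bil_form C \<beta> \<gamma>"
  by (simp add: quad_form_def bil_form_def lookup_add distrib_left distrib_right sum.distrib)

lemma bil_form_sym: "bil_form C \<beta> \<gamma> = bil_form C \<gamma> \<beta>"
  by (simp add: bil_form_def)

lemma bil_form_self: "bil_form C \<beta> \<beta> = 2 * quad_form C \<beta>"
  by (simp add: bil_form_def quad_form_def)

lemma bil_form_add_left: "bil_form C (\<beta> + \<beta>') \<gamma> = bil_form C \<beta> \<gamma> + bil_form C \<beta>' \<gamma>"
  by (simp add: bil_form_def lookup_add distrib_left distrib_right sum.distrib)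

lemma bil_form_0_left [simp]: "bil_form C 0 \<gamma> = 0"
  by (simp add: bil_form_def)

lemma quad_form_0 [simp]: "quad_form C 0 = 0"
  by (simp add: quad_form_def)

text \<open>The form \<open>bil_form C \<beta>\<close> as a dilation vector, see
  \<open>bil_form_eq_mdot\<close>: the mixed term of the quadratic form acts on the second factor of
  a product as a dilation.\<close>

definition bil_vec :: "nat ^ 'r ^ 'r \<Rightarrow> ('r::finite \<Rightarrow>\<^sub>0 nat) \<Rightarrow> 'r \<Rightarrow> nat" where
  "bil_vec C \<beta> j = (\<Sum>i\<in>UNIV. lookup \<beta> i * C $ i $ j) + (\<Sum>i\<in>UNIV. C $ j $ i * lookup \<beta> i)"

lemma bil_form_eq_mdot: "bil_form C \<beta> \<gamma> = mdot (bil_vec C \<beta>) \<gamma>"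
proof -
  have "(\<Sum>i\<in>UNIV. \<Sum>j\<in>UNIV. lookup \<beta> i * C $ i $ j * lookup \<gamma> j) =
      (\<Sum>j\<in>UNIV. (\<Sum>i\<in>UNIV. lookup \<beta> i * C $ i $ j) * lookup \<gamma> j)"
    by (subst sum.swap) (simp add: sum_distrib_right)
  moreover have "(\<Sum>i\<in>UNIV. \<Sum>j\<in>UNIV. lookup \<gamma> i * C $ i $ j * lookup \<beta> j) =
      (\<Sum>j\<in>UNIV. (\<Sum>i\<in>UNIV. C $ j $ i * lookup \<beta> i) * lookup \<gamma> j)"
    unfolding sum_distrib_right by (intro sum.cong refl) (simp only: mult_ac)
  ultimately show ?thesis
    by (simp add: bil_form_def mdot_def bil_vec_def distrib_right sum.distrib)
qed

lemma bil_vec_0: "bil_vec C 0 = (\<lambda>_. 0)"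
  by (simp add: bil_vec_def fun_eq_iff)

text \<open>By \<open>qint_add\<close>, polynomiality for the coordinates of \<delta> passes to all
  their combinations with natural coefficients.\<close>

lemma qint_mult_closed:
  assumes "\<And>i. qint (lookup \<delta> i) * x \<in> polyq"
  shows "qint (mdot v \<delta>) * x \<in> polyq"
proof -
  have add: "qint (k + l) * x \<in> polyq" if "qint k * x \<in> polyq" "qint l * x \<in> polyq" for k l
    using polyq.add[OF that(1) polyq.mult[OF q_power_polyq that(2)]]
    unfolding qint_add distrib_right mult.assoc .
  have mult: "qint (k * lookup \<delta> i) * x \<in> polyq" for k i
  proof (induction k)
    case (Suc k)
    thus ?case unfolding mult_Suc by (intro add assms)
  qed (simp add: polyq.zero)
  have "qint (\<Sum>i\<in>J. v i * lookup \<delta> i) * x \<in> polyq" if "finite J" for J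
    using that by (induction J rule: finite_induct) (simp_all add: polyq.zero add mult)
  thus ?thesis by (simp add: mdot_def)
qed

text \<open>The recursion rests on \<open>GH\<close>. In \<open>H\<close> a summand with
  \<open>\<beta> \<noteq> 0\<close> involves the quotients for \<open>b\<close> only in smaller
  degree, where arbitrary dilation vectors are covered by \<open>qint_mult_closed\<close>; a summand
  with \<open>\<beta> = 0\<close> involves the trivial dilation. Finally
  \<open>pleth_exp_closed_arg\<close> passes from the quotient for one coordinate to its
  argument.\<close>

theorem qint_polynomial:
  fixes C :: "nat ^ 'r ^ ('r :: finite)"
  assumes a: "\<And>\<alpha>. \<alpha> \<noteq> 0 \<Longrightarrow> a \<alpha> \<in> polyq"
    and eq: "Exp (mscale (1 / (q - 1)) (series_without_const b)) =
           Tbar C (Exp (mscale (1 / (q - 1)) (series_without_const a)))"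
  shows "\<alpha> \<noteq> 0 \<Longrightarrow> qint (lookup \<alpha> i) * b \<alpha> \<in> polyq"
proof -
  define ser where "ser = (\<lambda>c :: ('r \<Rightarrow>\<^sub>0 nat) \<Rightarrow> qfield. mscale (1 / (q - 1)) (series_without_const c))"
  have ser: "mcoeff (ser c) \<beta> = (if \<beta> = 0 then 0 else c \<beta> / (q - 1))" for c \<beta>
    by (simp add: ser_def series_without_const_def)
  \<comment> \<open>The coefficients of the quotient of the exponential of \<open>ser c\<close>
    dilated by \<open>v\<close> and undilated. Its argument has no denominator, since
    \<open>q ^ mdot v \<beta> - 1\<close> divided by \<open>q - 1\<close> is
    \<open>qint (mdot v \<beta>)\<close>.\<close>
  define G where "G = (\<lambda>(c :: ('r \<Rightarrow>\<^sub>0 nat) \<Rightarrow> qfield) v. mcoeff (Exp (series_without_const (\<lambda>\<beta>. qint (mdot v \<beta>) * c \<beta>))))"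
  have pE: "pleth_exp adams_scalar (mcoeff (ser c)) (mcoeff (Exp (ser c)))" for c
    by (rule pleth_exp_Exp) (simp add: ser)
  have pG: "pleth_exp adams_scalar (mcoeff (series_without_const (\<lambda>\<beta>. qint (mdot v \<beta>) * c \<beta>))) (G c v)"
    for c v unfolding G_def by (rule pleth_exp_Exp) (simp add: series_without_const_def)
  define F where "F = (\<lambda>c. mcoeff (Exp (ser c)))"
  have F0: "F c 0 = 1" for c unfolding F_def by (rule pleth_exp_0[OF pE])
  have shift: "q ^ mdot v \<alpha> * F c \<alpha> = (\<Sum>(\<beta>, \<gamma>)\<in>splits \<alpha>. G c v \<beta> * F c \<gamma>)" for c v \<alpha>
  proof -
    have 1: "pleth_exp adams_scalar (\<lambda>\<beta>. q ^ mdot v \<beta> * mcoeff (ser c) \<beta>) (\<lambda>\<alpha>. q ^ mdot v \<alpha> * F c \<alpha>)"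
      unfolding F_def by (rule pleth_exp_scale[OF pE])
    have 2: "pleth_exp adams_scalar
        (\<lambda>\<beta>. mcoeff (series_without_const (\<lambda>\<beta>. qint (mdot v \<beta>) * c \<beta>)) \<beta> + mcoeff (ser c) \<beta>)
        (mcoeff (Abs_mpseries (G c v) * Abs_mpseries (F c)))"
      unfolding F_def by (rule pleth_exp_times[OF pG pE adams_add])
    have "q ^ mdot v \<alpha> * F c \<alpha> = mcoeff (Abs_mpseries (G c v) * Abs_mpseries (F c)) \<alpha>"
    proof (rule pleth_exp_unique[OF 1 2])
      fix \<beta> :: "'r \<Rightarrow>\<^sub>0 nat" assume "\<beta> \<noteq> 0"
      have "q - 1 \<noteq> 0" using q_neq_1 by simp
      thus "q ^ mdot v \<beta> * mcoeff (ser c) \<beta> =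
          mcoeff (series_without_const (\<lambda>\<beta>. qint (mdot v \<beta>) * c \<beta>)) \<beta> + mcoeff (ser c) \<beta>"
        using \<open>\<beta> \<noteq> 0\<close>
        by (simp add: ser series_without_const_def qint_def divide_simps) (simp add: algebra_simps)
    qed
    thus ?thesis by (simp add: mcoeff_times)
  qed
  have Fab: "F b \<alpha> = q ^ quad_form C \<alpha> * F a \<alpha>" for \<alpha>
    using eq unfolding F_def ser_def by (simp add: Tbar_def)
  define unit_vec where "unit_vec = (\<lambda>(i :: 'r) j. if j = i then 1 else (0 :: nat))"
  have dot_unit: "mdot (unit_vec i) \<alpha> = lookup \<alpha> i" for i \<alpha>
    unfolding unit_vec_def by (rule mdot_unit)
  define K where "K = (\<lambda>i. G a (unit_vec i))"
  have K: "K i \<alpha> \<in> polyq" for i \<alpha>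
    unfolding K_def
    by (rule polyq.pleth_exp_closed[OF pG _ order_refl])
       (auto simp: series_without_const_def intro!: polyq.mult qint_polyq a)
  \<comment> \<open>Obtained by applying \<open>Tbar\<close> to the dilation identity for
    \<open>a\<close>: the mixed term of the quadratic form dilates the factor \<open>F b\<close> by
    \<open>bil_vec C \<beta>\<close>, and that dilation is expressed through \<open>G b\<close>
    again.\<close>
  define H where "H = (\<lambda>i \<rho>. \<Sum>(\<beta>, \<delta>)\<in>splits \<rho>. K i \<beta> * q ^ quad_form C \<beta> * G b (bil_vec C \<beta>) \<delta>)"
  have GH: "G b (unit_vec i) \<alpha> = H i \<alpha>" for i \<alpha>
  proof (rule splits_cancel[where F = "F b"])
    fix \<alpha>
    have "(\<Sum>(\<beta>, \<gamma>)\<in>splits \<alpha>. G b (unit_vec i) \<beta> * F b \<gamma>) = q ^ lookup \<alpha> i * F b \<alpha>"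
      by (simp only: shift[symmetric] dot_unit)
    also have "\<dots> = q ^ quad_form C \<alpha> * (q ^ mdot (unit_vec i) \<alpha> * F a \<alpha>)"
      by (simp only: Fab dot_unit mult.left_commute)
    also have "\<dots> = (\<Sum>(\<beta>, \<gamma>)\<in>splits \<alpha>. q ^ quad_form C \<alpha> * (K i \<beta> * F a \<gamma>))"
      unfolding shift K_def by (simp add: sum_distrib_left case_prod_unfold)
    also have "\<dots> = (\<Sum>(\<beta>, \<gamma>)\<in>splits \<alpha>. K i \<beta> * q ^ quad_form C \<beta> *
        (\<Sum>(\<delta>, \<epsilon>)\<in>splits \<gamma>. G b (bil_vec C \<beta>) \<delta> * F b \<epsilon>))"
    proof (rule sum.cong)
      fix x assume x: "x \<in> splits \<alpha>"
      obtain \<beta> \<gamma> where bg: "x = (\<beta>, \<gamma>)" by (cases x)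
      have \<alpha>: "\<alpha> = \<beta> + \<gamma>" using x bg by simp
      have "q ^ quad_form C \<alpha> * (K i \<beta> * F a \<gamma>) =
          K i \<beta> * q ^ quad_form C \<beta> * (q ^ mdot (bil_vec C \<beta>) \<gamma> * F b \<gamma>)"
        unfolding \<alpha> quad_form_add power_add Fab bil_form_eq_mdot by (simp only: mult_ac)
      thus "(case x of (\<beta>, \<gamma>) \<Rightarrow> q ^ quad_form C \<alpha> * (K i \<beta> * F a \<gamma>)) =
          (case x of (\<beta>, \<gamma>) \<Rightarrow> K i \<beta> * q ^ quad_form C \<beta> *
            (\<Sum>(\<delta>, \<epsilon>)\<in>splits \<gamma>. G b (bil_vec C \<beta>) \<delta> * F b \<epsilon>))"
        unfolding shift[symmetric] by (simp only: bg case_prod_conv)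
    qed simp
    also have "\<dots> = (\<Sum>(\<rho>, \<epsilon>)\<in>splits \<alpha>. H i \<rho> * F b \<epsilon>)"
      unfolding H_def by (rule splits_assoc)
    finally show "(\<Sum>(\<beta>, \<gamma>)\<in>splits \<alpha>. G b (unit_vec i) \<beta> * F b \<gamma>) =
      (\<Sum>(\<beta>, \<gamma>)\<in>splits \<alpha>. H i \<beta> * F b \<gamma>)" .
  qed (rule F0)
  \<comment> \<open>Without dilation the argument is the zero series, since
    \<open>qint 0 = 0\<close>.\<close>
  have G0: "G b (\<lambda>_. 0) \<delta> \<in> polyq" for \<delta>
    by (rule polyq.pleth_exp_closed[OF pG _ order_refl])
       (auto simp: series_without_const_def mdot_def polyq.zero)
  have main: "\<forall>i. qint (lookup \<alpha> i) * b \<alpha> \<in> polyq" if "\<alpha> \<noteq> 0" for \<alpha>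
    using that
  proof (induction "mdeg \<alpha>" arbitrary: \<alpha> rule: less_induct)
    case less
    have G_low: "G b v \<delta> \<in> polyq" if \<delta>: "mdeg \<delta> < mdeg \<alpha>" for v \<delta>
    proof (rule polyq.pleth_exp_closed[OF pG _ order_refl])
      fix \<beta> :: "'r \<Rightarrow>\<^sub>0 nat" assume \<beta>: "\<beta> \<noteq> 0" "mdeg \<beta> \<le> mdeg \<delta>"
      have "qint (mdot v \<beta>) * b \<beta> \<in> polyq"
        by (rule qint_mult_closed) (use less.hyps[of \<beta>] \<beta> \<delta> in auto)
      thus "mcoeff (series_without_const (\<lambda>\<beta>. qint (mdot v \<beta>) * b \<beta>)) \<beta> \<in> polyq"
        using \<beta>(1) by (simp add: series_without_const_def)
    qed
    have G_unit: "G b (unit_vec i) \<rho> \<in> polyq" if \<rho>: "mdeg \<rho> \<le> mdeg \<alpha>" for i \<rho>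
      unfolding GH H_def
    proof (rule polyq.closed_sum)
      fix x assume x: "x \<in> splits \<rho>"
      obtain \<beta> \<delta> where bd: "x = (\<beta>, \<delta>)" by (cases x)
      have "G b (bil_vec C \<beta>) \<delta> \<in> polyq"
      proof (cases "\<beta> = 0")
        case True
        thus ?thesis using G0 by (simp add: bil_vec_0)
      next
        case False
        hence "mdeg \<delta> < mdeg \<rho>" using splits_nonzero_mdeg_less(1) x bd by blast
        thus ?thesis using \<rho> by (intro G_low) simp
      qed
      thus "(case x of (\<beta>, \<delta>) \<Rightarrow> K i \<beta> * q ^ quad_form C \<beta> * G b (bil_vec C \<beta>) \<delta>) \<in> polyq"
        unfolding bd case_prod_conv by (intro polyq.mult K q_power_polyq)
    qed
    show ?case
    proof
      fix i
      have "mcoeff (series_without_const (\<lambda>\<beta>. qint (mdot (unit_vec i) \<beta>) * b \<beta>)) \<alpha> \<in> polyq"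
        using less.prems by (intro polyq.pleth_exp_closed_arg[OF pG, where d = "mdeg \<alpha>"] G_unit) auto
      thus "qint (lookup \<alpha> i) * b \<alpha> \<in> polyq"
        using less.prems by (simp add: series_without_const_def dot_unit)
    qed
  qed
  show "\<alpha> \<noteq> 0 \<Longrightarrow> qint (lookup \<alpha> i) * b \<alpha> \<in> polyq" using main by blast
qed

section \<open>Counting Lyndon words\<close>

text \<open>Colours in \<open>V\<close> stand for the monomials of the given series, with
  coefficient many copies: \<open>wt v\<close> is the exponent vector of the variables and
  \<open>kk v\<close> the power of \<open>q\<close>.\<close>

locale coloured_link = graded_link m Qf
  for m :: "'a::linorder \<Rightarrow> 'a \<Rightarrow> nat" and Qf :: "'a multiset \<Rightarrow> int" +
  fixes V :: "'a set" and wt :: "'a \<Rightarrow> ('r \<Rightarrow>\<^sub>0 nat)" and kk :: "'a \<Rightarrow> nat"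
    and Q :: "('r \<Rightarrow>\<^sub>0 nat) \<Rightarrow> nat"
  assumes wt_nonzero: "v \<in> V \<Longrightarrow> wt v \<noteq> 0"
    and finite_wt: "finite {v\<in>V. wt v = \<beta>}"
    and Qf_eq: "Qf \<gamma> = int (Q (\<Sum>v\<in>#\<gamma>. wt v))"
begin

text \<open>Dividing the k-th power of \<open>q\<close> by \<open>q - 1\<close> gives the sum of the
  powers \<open>k - 1 - e\<close> over natural \<open>e\<close>. In the inverse of
  \<open>qhalf\<close> these have the exponents \<open>2 * (e + 1 - k)\<close>.\<close>

definition lpw :: "'a \<times> nat \<Rightarrow> int" where
  "lpw x = 2 * (int (snd x) + 1 - int (kk (fst x)))"

definition wwt :: "(int \<times> 'a) list \<Rightarrow> ('r \<Rightarrow>\<^sub>0 nat)" where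
  "wwt w = (\<Sum>v\<in>#wcont w. wt v)"

definition kks :: "'a multiset \<Rightarrow> int" where
  "kks \<gamma> = (\<Sum>v\<in>#\<gamma>. 1 - int (kk v))"

text \<open>As \<open>lpw\<close> summed over letters, but with the grade in place of the total
  degree; the difference between the two is the twist, see \<open>mset_gf_shift\<close>.\<close>

definition wpw :: "(int \<times> 'a) list \<Rightarrow> int" where
  "wpw w = 2 * (wgrade w + kks (wcont w))"

definition VL :: "(int \<times> 'a) list set" where
  "VL = {w\<in>LLwords. set_mset (wcont w) \<subseteq> V}"

sublocale letters: weighted "V \<times> UNIV" "\<lambda>x. wt (fst x)" lpw
proof
  show "wt (fst x) \<noteq> 0" if "x \<in> V \<times> UNIV" for x :: "'a \<times> nat" using that wt_nonzero by auto
  show "finite {x \<in> V \<times> (UNIV :: nat set). wt (fst x) = \<beta> \<and> lpw x \<le> n}" for \<beta> n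
  proof (rule finite_subset)
    show "{x \<in> V \<times> (UNIV :: nat set). wt (fst x) = \<beta> \<and> lpw x \<le> n} \<subseteq>
        (SIGMA v : {v\<in>V. wt v = \<beta>}. {..nat n + kk v})"
      by (auto simp: lpw_def)
    show "finite (SIGMA v : {v\<in>V. wt v = \<beta>}. {..nat n + kk v})"
      by (intro finite_SigmaI finite_wt) simp
  qed
qed

lemma letters_mpw: "letters.mpw M = 2 * (grade M + Qf (image_mset fst M) + kks (image_mset fst M))"
proof -
  have "letters.mpw M = 2 * (int (\<Sum>l\<in>#M. snd l) + kks (image_mset fst M))"
    unfolding letters.mpw_def kks_def by (induction M) (auto simp: lpw_def)
  thus ?thesis by (simp add: grade_def)
qed

lemma letters_msets:
  "M \<in> letters.msets \<alpha> \<longleftrightarrow>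
    set_mset (image_mset fst M) \<subseteq> V \<and> (\<Sum>v\<in>#image_mset fst M. wt v) = \<alpha>"
  unfolding letters.msets_def by (auto simp: multiset.map_comp o_def)

lemma wcont_nonempty:
  assumes "w \<in> LLwords"
  shows "wcont w \<noteq> {#}"
proof -
  have "w \<noteq> []" using assms by (auto simp: LLwords_def lyndon_def)
  thus ?thesis by (simp add: wcont_def)
qed

lemma dec_letters:
  assumes "w \<in> VL"
  shows "dec w \<in> letters.msets (wwt w)" "letters.mpw (dec w) = wpw w + 2 * int (Q (wwt w))"
proof -
  have w: "w \<in> Lwords" "set_mset (wcont w) \<subseteq> V" using assms by (auto simp: VL_def LLwords_def)
  show "dec w \<in> letters.msets (wwt w)"
    unfolding letters_msets dec_cont_grade(1)[OF w(1)] using w(2) by (simp add: wwt_def)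
  show "letters.mpw (dec w) = wpw w + 2 * int (Q (wwt w))"
    unfolding letters_mpw dec_cont_grade[OF w(1)] Qf_eq wpw_def wwt_def by (simp only: algebra_simps)
qed

sublocale words: weighted VL wwt wpw
proof
  fix w assume w: "w \<in> VL"
  have "wcont w \<noteq> {#}" using w by (intro wcont_nonempty) (simp add: VL_def)
  then obtain v where v: "v \<in># wcont w" by blast
  have "wt v \<noteq> 0" using v w by (intro wt_nonzero) (auto simp: VL_def)
  moreover obtain N where "wcont w = add_mset v N" using v by (meson multi_member_split)
  ultimately have "mdeg (wwt w) > 0" by (simp add: wwt_def mdeg_add)
  thus "wwt w \<noteq> 0" by auto
next
  fix \<beta> n
  let ?S = "{w\<in>VL. wwt w = \<beta> \<and> wpw w \<le> n}"
  have "inj_on dec ?S"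
    by (rule inj_on_subset[OF bij_betw_imp_inj_on[OF bij_betw_dec]]) (auto simp: VL_def LLwords_def)
  moreover have "dec ` ?S \<subseteq> {M\<in>letters.msets \<beta>. letters.mpw M \<le> n + 2 * int (Q \<beta>)}"
    using dec_letters by auto
  hence "finite (dec ` ?S)" using letters.finite_msets finite_subset by blast
  ultimately show "finite ?S" by (rule finite_imageD[rotated])
qed

text \<open>The map \<open>dec (mword Z)\<close> matches multisets of Lyndon words with multisets of
  letters of the same colour content. Degree and grade differ by \<open>Q \<alpha>\<close>, and
  shifting the index by \<open>2 * Q \<alpha>\<close> is multiplication by
  \<open>q ^ Q \<alpha>\<close>, the effect of \<open>Tbar\<close>.\<close>

lemma mset_gf_shift: "words.mset_gf \<alpha> $$ n = letters.mset_gf \<alpha> $$ (n + 2 * int (Q \<alpha>))"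
proof -
  define f where "f = (\<lambda>Z. dec (mword Z))"
  have bij: "bij_betw f {Z. set_mset Z \<subseteq> LLwords} UNIV"
    using bij_betw_trans[OF bij_betw_mword bij_betw_dec] by (simp add: f_def o_def)
  have iff: "Z \<in> words.msets \<alpha> \<and> words.mpw Z = n \<longleftrightarrow>
      f Z \<in> letters.msets \<alpha> \<and> letters.mpw (f Z) = n + 2 * int (Q \<alpha>)"
    if Z: "set_mset Z \<subseteq> LLwords" for Z
  proof -
    have L: "mword Z \<in> Lwords" using bij_betwE[OF bij_betw_mword] Z by blast
    define \<gamma> where "\<gamma> = (\<Sum>l\<in>#Z. wcont l)"
    have c: "image_mset fst (f Z) = \<gamma>" "grade (f Z) = (\<Sum>l\<in>#Z. wgrade l)"
      unfolding f_def dec_cont_grade[OF L] wcont_mword wgrade_mword \<gamma>_def by (rule refl)+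
    have 1: "set_mset Z \<subseteq> VL \<longleftrightarrow> set_mset \<gamma> \<subseteq> V" using Z by (auto simp: \<gamma>_def VL_def)
    have 2: "(\<Sum>w\<in>#Z. wwt w) = (\<Sum>v\<in>#\<gamma>. wt v)"
      unfolding \<gamma>_def by (induction Z) (auto simp: wwt_def)
    have 3: "words.mpw Z = 2 * ((\<Sum>l\<in>#Z. wgrade l) + kks \<gamma>)"
      unfolding \<gamma>_def words.mpw_def by (induction Z) (auto simp: wpw_def kks_def)
    show ?thesis
      unfolding words.msets_def letters_msets letters_mpw c 3 mem_Collect_eq 1 2 Qf_eq
      by (auto simp: algebra_simps)
  qed
  define S where "S = {Z\<in>words.msets \<alpha>. words.mpw Z = n}"
  have sub: "S \<subseteq> {Z. set_mset Z \<subseteq> LLwords}"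
    unfolding S_def words.msets_def by (auto simp: VL_def)
  have "f ` S = {M\<in>letters.msets \<alpha>. letters.mpw M = n + 2 * int (Q \<alpha>)}" (is "_ = ?T")
  proof
    show "f ` S \<subseteq> ?T"
    proof
      fix M assume "M \<in> f ` S"
      then obtain Z where Z: "Z \<in> S" "M = f Z" by blast
      have "set_mset Z \<subseteq> LLwords" using sub Z(1) by blast
      from iff[OF this] show "M \<in> ?T" using Z by (simp add: S_def)
    qed
    show "?T \<subseteq> f ` S"
    proof
      fix M assume M: "M \<in> ?T"
      have "M \<in> f ` {Z. set_mset Z \<subseteq> LLwords}" using bij_betw_imp_surj_on[OF bij] by simp
      then obtain Z where Z: "set_mset Z \<subseteq> LLwords" "M = f Z" by blast
      from iff[OF Z(1)] show "M \<in> f ` S" using M Z(2) by (simp add: S_def)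
    qed
  qed
  moreover have "inj_on f S" by (rule inj_on_subset[OF bij_betw_imp_inj_on[OF bij] sub])
  ultimately have "card S = card {M\<in>letters.msets \<alpha>. letters.mpw M = n + 2 * int (Q \<alpha>)}"
    using card_image by metis
  thus ?thesis unfolding words.mset_gf_nth letters.mset_gf_nth S_def by simp
qed

text \<open>For a fixed colour content the step from \<open>n\<close> to \<open>n + 2\<close> raises
  the grade by one, so \<open>card_LL_mono\<close> applies content by content.\<close>

lemma words_card_mono:
  "card {w\<in>VL. wwt w = \<beta> \<and> wpw w = n} \<le> card {w\<in>VL. wwt w = \<beta> \<and> wpw w = n + 2}"
proof -
  define A where "A = (\<lambda>n. {w\<in>VL. wwt w = \<beta> \<and> wpw w = n})"
  have fin: "finite (A n)" for n
    by (rule finite_subset[OF _ words.finite_weight[of \<beta> n]]) (auto simp: A_def)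
  define B where "B = (\<lambda>n \<gamma>. {w\<in>A n. wcont w = \<gamma>})"
  have finB: "finite (B n \<gamma>)" for n \<gamma> using fin by (simp add: B_def)
  have le: "card (B n \<gamma>) \<le> card (B (n + 2) \<gamma>)" if \<gamma>: "\<gamma> \<in> wcont ` A n" for \<gamma>
  proof -
    obtain w where w: "w \<in> A n" "\<gamma> = wcont w" using \<gamma> by blast
    define s where "s = wgrade w"
    have V: "set_mset \<gamma> \<subseteq> V" "(\<Sum>v\<in>#\<gamma>. wt v) = \<beta>" "n = 2 * (s + kks \<gamma>)" "\<gamma> \<noteq> {#}"
      using w wcont_nonempty by (auto simp: A_def VL_def wwt_def wpw_def s_def)
    have B: "B (2 * (t + kks \<gamma>)) \<gamma> = LL \<gamma> t" for t
      using V(1,2) by (auto simp: B_def A_def LL_def VL_def wwt_def wpw_def)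
    have n2: "n + 2 = 2 * (s + 1 + kks \<gamma>)" using V(3) by simp
    show ?thesis unfolding n2 unfolding V(3) B by (rule card_LL_mono[OF V(4)])
  qed
  have fI: "finite (wcont ` A n)" using fin by simp
  have "A n = (\<Union>\<gamma>\<in>wcont ` A n. B n \<gamma>)" by (auto simp: B_def)
  hence "card (A n) = card (\<Union>\<gamma>\<in>wcont ` A n. B n \<gamma>)" by simp
  also have "\<dots> = (\<Sum>\<gamma>\<in>wcont ` A n. card (B n \<gamma>))"
    by (rule card_UN_disjoint[OF fI]) (use finB in \<open>auto simp: B_def\<close>)
  also have "\<dots> \<le> (\<Sum>\<gamma>\<in>wcont ` A n. card (B (n + 2) \<gamma>))" by (rule sum_mono) (rule le)
  also have "\<dots> = card (\<Union>\<gamma>\<in>wcont ` A n. B (n + 2) \<gamma>)"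
    by (rule card_UN_disjoint[OF fI, symmetric]) (use finB in \<open>auto simp: B_def\<close>)
  also have "\<dots> \<le> card (A (n + 2))" by (rule card_mono[OF fin]) (auto simp: B_def)
  finally show ?thesis by (simp only: A_def)
qed

lemma words_obj_gf_odd: "odd n \<Longrightarrow> words.obj_gf \<beta> $$ n = 0"
proof -
  assume "odd n"
  hence "{w\<in>VL. wwt w = \<beta> \<and> wpw w = n} = {}" by (auto simp: wpw_def)
  thus ?thesis unfolding words.obj_gf_nth by (simp only: card.empty of_nat_0)
qed

lemma words_obj_gf_diff_obtain:
  obtains d where "words.obj_gf \<beta> $$ (n + 2) - words.obj_gf \<beta> $$ n = of_nat d"
proof -
  have "words.obj_gf \<beta> $$ (n + 2) - words.obj_gf \<beta> $$ n =
    of_nat (card {w\<in>VL. wwt w = \<beta> \<and> wpw w = n + 2} - card {w\<in>VL. wwt w = \<beta> \<and> wpw w = n})"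
    unfolding words.obj_gf_nth by (simp only: of_nat_diff[OF words_card_mono])
  thus ?thesis by (rule that)
qed

text \<open>Increasing the exponent injects the letters of power \<open>n\<close> into those of
  power \<open>n + 2\<close>; exactly the letters with exponent 0 are missed, one for each
  colour.\<close>

lemma letters_obj_gf_diff:
  "letters.obj_gf \<beta> $$ (n + 2) - letters.obj_gf \<beta> $$ n =
    of_nat (card {v\<in>V. wt v = \<beta> \<and> - 2 * int (kk v) = n})"
proof -
  define A where "A = (\<lambda>n. {x\<in>V \<times> (UNIV :: nat set). wt (fst x) = \<beta> \<and> lpw x = n})"
  define D where "D = {v\<in>V. wt v = \<beta> \<and> - 2 * int (kk v) = n}"
  have fin: "finite (A n)" for n
    by (rule finite_subset[OF _ letters.finite_weight[of \<beta> n]]) (auto simp: A_def)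
  have finD: "finite D" by (rule finite_subset[OF _ finite_wt[of \<beta>]]) (auto simp: D_def)
  have "A (n + 2) = apsnd Suc ` A n \<union> (\<lambda>v. (v, 0)) ` D"
  proof (intro equalityI subsetI)
    fix x assume x: "x \<in> A (n + 2)"
    obtain v e where ve: "x = (v, e)" by (cases x)
    show "x \<in> apsnd Suc ` A n \<union> (\<lambda>v. (v, 0)) ` D"
    proof (cases e)
      case 0
      hence "v \<in> D" using x by (auto simp: A_def D_def lpw_def ve)
      thus ?thesis by (simp add: ve 0)
    next
      case (Suc e')
      hence "(v, e') \<in> A n" using x by (auto simp: A_def lpw_def ve)
      thus ?thesis by (force simp: ve Suc)
    qed
  qed (auto simp: A_def D_def lpw_def)
  moreover have "apsnd Suc ` A n \<inter> (\<lambda>v. (v, 0)) ` D = {}" by auto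
  ultimately have "card (A (n + 2)) = card (apsnd Suc ` A n) + card ((\<lambda>v. (v, 0 :: nat)) ` D)"
    using fin finD by (simp add: card_Un_disjoint)
  moreover have "card (apsnd Suc ` A n) = card (A n)"
    by (rule card_image) (auto simp: inj_on_def apsnd_def map_prod_def split: prod.splits)
  moreover have "card ((\<lambda>v. (v, 0 :: nat)) ` D) = card D"
    by (rule card_image) (auto simp: inj_on_def)
  ultimately show ?thesis unfolding letters.obj_gf_nth by (simp add: A_def D_def)
qed

end

section \<open>Positivity\<close>

lemma expand_q_times_nth: "(expand (q ^ k) * f) $$ n = f $$ (n + 2 * int k)"
  by (simp only: expand_q_power fls_X_inv_power_times_conv_shift fls_shift_nth of_nat_mult of_nat_numeral)

lemma expand_divide_nth:
  "expand x $$ n = expand (x / (q - 1)) $$ (n + 2) - expand (x / (q - 1)) $$ n"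
proof -
  define y where "y = x / (q - 1)"
  have "q - 1 \<noteq> 0" using q_neq_1 by simp
  hence "(q - 1) * y = x" unfolding y_def times_divide_eq_right by (rule nonzero_mult_div_cancel_left)
  hence x: "x = q ^ 1 * y - y" unfolding left_diff_distrib power_one_right mult_1_left by (rule sym)
  have "expand x = expand (q ^ 1) * expand y - expand y"
    unfolding x expand_diff expand_mult ..
  thus ?thesis unfolding y_def[symmetric] by (simp only: fls_minus_nth expand_q_times_nth) simp
qed

text \<open>Two solutions of the difference equation differ by a series invariant under index shifts
  by 2, and a Laurent series vanishes far below.\<close>

lemma expand_divide_eqI:
  assumes "\<And>n. f $$ (n + 2) - f $$ n = expand x $$ n"
  shows "expand (x / (q - 1)) = f"
proof -
  define g where "g = expand (x / (q - 1)) - f"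
  have per: "g $$ (n + 2) = g $$ n" for n
    using expand_divide_nth[of x n] assms[of n] by (simp add: g_def)
  have shift: "g $$ (n - 2 * int k) = g $$ n" for n k
  proof (induction k)
    case (Suc k)
    have "g $$ (n - 2 * int (Suc k)) = g $$ (n - 2 * int (Suc k) + 2)" by (rule per[symmetric])
    thus ?case using Suc by (simp add: algebra_simps)
  qed simp
  have "g $$ n = 0" for n
  proof -
    define k where "k = nat (n - fls_subdegree g) + 1"
    have "n - 2 * int k < fls_subdegree g" by (simp add: k_def)
    hence "g $$ (n - 2 * int k) = 0" by simp
    thus ?thesis by (simp only: shift)
  qed
  hence "g = 0" by (intro fls_eqI) simp
  thus ?thesis by (simp add: g_def)
qed

lemma expand_nat_poly_nth:
  "expand (poly (map_poly of_nat p) q) $$ n =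
    (if n \<le> 0 \<and> even n then of_nat (coeff p (nat (- n) div 2)) else 0)"
proof (induction p arbitrary: n)
  case (pCons c p)
  have "poly (map_poly of_nat (pCons c p)) q = of_nat c + q ^ 1 * poly (map_poly of_nat p) q"
    by (simp add: map_poly_pCons)
  hence "expand (poly (map_poly of_nat (pCons c p)) q) $$ n =
      (of_nat c + expand (q ^ 1) * expand (poly (map_poly of_nat p) q)) $$ n"
    by (simp only: expand_add expand_mult expand_of_nat)
  also have "\<dots> = (if n = 0 then of_nat c else 0) + expand (poly (map_poly of_nat p) q) $$ (n + 2)"
    by (simp only: fls_plus_nth expand_q_times_nth) (simp add: fls_of_nat)
  also have "\<dots> = (if n \<le> 0 \<and> even n then of_nat (coeff (pCons c p) (nat (- n) div 2)) else 0)"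
  proof (cases "n < 0 \<and> even n")
    case True
    then obtain k where k: "n = 2 * k" "k < 0" by (auto elim!: evenE)
    define j where "j = nat (- k - 1)"
    have n: "n = - 2 * int (Suc j)" using k by (simp add: j_def)
    have 1: "nat (- n) div 2 = Suc j" "nat (- (n + 2)) div 2 = j" by (simp_all add: n nat_mult_distrib)
    show ?thesis using True unfolding pCons.IH 1 by (simp add: n)
  next
    case False
    hence "n = 0 \<or> \<not> (n + 2 \<le> 0 \<and> even (n + 2))" by auto
    thus ?thesis using False unfolding pCons.IH by auto
  qed
  finally show ?case .
qed (simp add: expand_0)

lemma nat_polys_qI:
  assumes "\<And>n. expand x $$ n = of_nat (c n)" "\<And>n. odd n \<or> n > 0 \<Longrightarrow> c n = 0"
  shows "x \<in> \<nat>[q]"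
proof -
  define P where "P = Abs_poly (\<lambda>k. c (- 2 * int k))"
  have P: "coeff P = (\<lambda>k. c (- 2 * int k))"
    unfolding P_def
  proof (rule coeff_Abs_poly)
    fix k assume "k > nat (- fls_subdegree (expand x))"
    hence "- 2 * int k < fls_subdegree (expand x)" by linarith
    hence "expand x $$ (- 2 * int k) = 0" by (rule fls_eq0_below_subdegree)
    thus "c (- 2 * int k) = 0" using assms(1) by simp
  qed
  have "expand (poly (map_poly of_nat P) q) = expand x"
  proof (rule fls_eqI)
    fix n
    show "expand (poly (map_poly of_nat P) q) $$ n = expand x $$ n"
    proof (cases "n \<le> 0 \<and> even n")
      case True
      then obtain k where k: "n = 2 * k" by (auto elim!: evenE)
      define j where "j = nat (- k)"
      have n: "n = - 2 * int j" using k True by (simp add: j_def)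
      have 1: "nat (- n) div 2 = j" by (simp add: n nat_mult_distrib)
      have "expand (poly (map_poly of_nat P) q) $$ n = of_nat (c (- 2 * int j))"
        using True unfolding expand_nat_poly_nth 1 P by simp
      thus ?thesis unfolding assms(1) n .
    next
      case False
      thus ?thesis using assms(2)[of n] by (auto simp: expand_nat_poly_nth assms(1))
    qed
  qed
  hence "x = poly (map_poly of_nat P) q" by (simp only: expand_inject)
  thus ?thesis unfolding nat_polys_q_def by blast
qed

text \<open>Since \<open>[l]\<^sub>q = 1 + q + \<dots> + q\<^sup>l\<^sup>-\<^sup>1\<close>, no cancellation can occur in the product
  \<open>[l]\<^sub>q x\<close> when the expansion of \<open>x\<close> in \<open>q\<^sup>-\<^sup>1\<close> has nonnegative coefficients.\<close>

lemma nat_polys_q_of_qint: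
  assumes "\<And>n. expand x $$ n = of_nat (c n)" "\<And>n. odd n \<Longrightarrow> c n = 0"
    and "qint l * x \<in> polyq" "l > 0"
  shows "x \<in> \<nat>[q]"
proof (rule nat_polys_qI[OF assms(1)])
  have nth_sum: "(\<Sum>j\<in>J. h j) $$ n = (\<Sum>j\<in>J. h j $$ n)" for J and h :: "nat \<Rightarrow> rat fls" and n
    by (induction J rule: infinite_finite_induct) auto
  have ex: "expand (qint l * x) $$ n = of_nat (\<Sum>j<l. c (n + 2 * int j))" for n
  proof -
    have "expand (qint l * x) $$ n = (\<Sum>j<l. expand (q ^ j) * expand x) $$ n"
      by (simp only: qint_eq_sum expand_mult expand_sum sum_distrib_right)
    also have "\<dots> = of_nat (\<Sum>j<l. c (n + 2 * int j))"
      unfolding nth_sum expand_q_times_nth assms(1) of_nat_sum ..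
    finally show ?thesis .
  qed
  fix n :: int assume n: "odd n \<or> n > 0"
  show "c n = 0"
  proof (cases "n > 0")
    case True
    hence "expand (qint l * x) $$ n = 0" using polyqD(1)[OF assms(3)] by fastforce
    hence "(\<Sum>j<l. c (n + 2 * int j)) = 0" unfolding ex by (simp only: of_nat_eq_0_iff)
    \<comment> \<open>A vanishing sum of natural numbers has vanishing terms; the term
      \<open>j = 0\<close> exists because \<open>l > 0\<close>.\<close>
    hence "c (n + 2 * int 0) = 0" using assms(4) by (simp only: sum_eq_0_iff finite_lessThan) blast
    thus ?thesis by simp
  qed (use n assms(2) in blast)
qed

lemma nat_polys_q_polyq: "x \<in> \<nat>[q] \<Longrightarrow> x \<in> polyq"
  by (rule polyqI) (auto simp: nat_polys_q_def expand_nat_poly_nth split: if_splits)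

lemma bil_form_sum_mset:
  "bil_form C (\<Sum>v\<in>#\<gamma>. wt v) (\<Sum>v\<in>#\<gamma>'. wt v) = (\<Sum>i\<in>#\<gamma>. \<Sum>j\<in>#\<gamma>'. bil_form C (wt i) (wt j))"
proof -
  have "bil_form C (wt i) (\<Sum>v\<in>#\<gamma>'. wt v) = (\<Sum>j\<in>#\<gamma>'. bil_form C (wt i) (wt j))" for i
    unfolding bil_form_sym[of C "wt i"]
    by (induction \<gamma>') (simp_all add: bil_form_add_left)
  thus ?thesis by (induction \<gamma>) (simp_all add: bil_form_add_left)
qed

lemma card_coded:
  fixes code :: "'x::zero \<times> nat \<times> nat \<Rightarrow> 'c"
  assumes inj: "inj code" and \<beta>: "\<beta> \<noteq> 0"
  shows "card {v \<in> code ` {(\<beta>, k, i). \<beta> \<noteq> 0 \<and> i < c \<beta> k}.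
    fst (inv code v) = \<beta> \<and> fst (snd (inv code v)) = k} = (c \<beta> k :: nat)"
proof -
  have "{v \<in> code ` {(\<beta>, k, i). \<beta> \<noteq> 0 \<and> i < c \<beta> k}.
      fst (inv code v) = \<beta> \<and> fst (snd (inv code v)) = k} = (\<lambda>i. code (\<beta>, k, i)) ` {..<c \<beta> k}"
    using \<beta> by (auto simp: inv_f_f[OF inj])
  moreover have "inj_on (\<lambda>i. code (\<beta>, k, i)) {..<c \<beta> k}"
    using inj by (auto simp: inj_def inj_on_def)
  ultimately show ?thesis by (simp only: card_image card_lessThan)
qed

theorem theorem4p3:
  fixes C :: "nat ^ 'r ^ ('r :: finite)"
    and a b :: "('r \<Rightarrow>\<^sub>0 nat) \<Rightarrow> qfield"
  assumes "\<And>\<alpha>. \<alpha> \<noteq> 0 \<Longrightarrow> a \<alpha> \<in> \<nat>[q]"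
    and "Exp (mscale (1 / (q - 1)) (series_without_const b)) =
           Tbar C (Exp (mscale (1 / (q - 1)) (series_without_const a)))"
  shows "\<forall>\<alpha>. \<alpha> \<noteq> 0 \<longrightarrow> b \<alpha> \<in> \<nat>[q]"
proof -
  have "\<exists>p :: nat poly. a \<alpha> = poly (map_poly of_nat p) q" if \<alpha>: "\<alpha> \<noteq> 0" for \<alpha>
    using assms(1)[OF \<alpha>] unfolding nat_polys_q_def by blast
  then obtain p :: "('r \<Rightarrow>\<^sub>0 nat) \<Rightarrow> nat poly"
    where p: "\<And>\<alpha>. \<alpha> \<noteq> 0 \<Longrightarrow> a \<alpha> = poly (map_poly of_nat (p \<alpha>)) q" by metis
  \<comment> \<open>A colour codes an exponent vector, a power of \<open>q\<close> and an index that
    separates the copies demanded by the coefficient. Coding by natural numbers supplies the linear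
    order on colours that \<open>link\<close> requires.\<close>
  define code :: "('r \<Rightarrow>\<^sub>0 nat) \<times> nat \<times> nat \<Rightarrow> nat"
    where "code = (\<lambda>(\<beta>, k, i). to_nat (lookup \<beta>, k, i))"
  have inj: "inj code"
    by (auto simp: inj_def code_def lookup_inject)
  define wt where "wt = (\<lambda>v. fst (inv code v))"
  define kk where "kk = (\<lambda>v. fst (snd (inv code v)))"
  have code [simp]: "wt (code (\<beta>, k, i)) = \<beta>" "kk (code (\<beta>, k, i)) = k" for \<beta> k i
    by (simp_all add: wt_def kk_def inv_f_f[OF inj])
  define V where "V = code ` {(\<beta>, k, i). \<beta> \<noteq> 0 \<and> i < coeff (p \<beta>) k}"
  define m where "m = (\<lambda>v w. bil_form C (wt v) (wt w))"
  define Qf where "Qf = (\<lambda>\<gamma>. int (quad_form C (\<Sum>v\<in>#\<gamma>. wt v)))"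
  have count: "of_nat (card {v\<in>V. wt v = \<beta> \<and> - 2 * int (kk v) = n}) = expand (a \<beta>) $$ n"
    if \<beta>: "\<beta> \<noteq> 0" for \<beta> n
  proof (cases "n \<le> 0 \<and> even n")
    case True
    then obtain j where j: "n = 2 * j" by blast
    define k where "k = nat (- j)"
    have n: "n = - 2 * int k" using j True by (simp add: k_def)
    have k: "nat (- n) div 2 = k" by (simp add: n nat_mult_distrib)
    have eq: "(- 2 * int l = - 2 * int k) = (l = k)" for l by simp
    have "card {v\<in>V. wt v = \<beta> \<and> - 2 * int (kk v) = n} = coeff (p \<beta>) k"
      unfolding n eq V_def wt_def kk_def
      by (rule card_coded[where c = "\<lambda>\<beta>. coeff (p \<beta>)", OF inj \<beta>])
    moreover have "expand (a \<beta>) $$ n = of_nat (coeff (p \<beta>) k)"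
      using True unfolding p[OF \<beta>] expand_nat_poly_nth k by (simp only: simp_thms if_True)
    ultimately show ?thesis by (simp only:)
  next
    case False
    have ne: "(- 2 * int k = n) = False" for k
    proof (rule iffI)
      assume h: "- 2 * int k = n"
      have "n \<le> 0 \<and> even n" unfolding h[symmetric] by simp
      with False show False by (rule notE)
    qed (rule FalseE)
    have "expand (a \<beta>) $$ n = 0"
      using False unfolding p[OF \<beta>] expand_nat_poly_nth by (simp only: simp_thms if_False)
    thus ?thesis unfolding ne by simp
  qed
  interpret L: coloured_link m Qf V wt kk "quad_form C"
  proof
    show "m i j = m j i" for i j unfolding m_def by (rule bil_form_sym)
    show "even (m i i)" for i by (simp add: m_def bil_form_self)
    show "Qf (\<gamma> + \<gamma>') = Qf \<gamma> + Qf \<gamma>' + int (\<Sum>i\<in>#\<gamma>. \<Sum>j\<in>#\<gamma>'. m i j)" for \<gamma> \<gamma>'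
      unfolding Qf_def m_def bil_form_sum_mset[symmetric]
      by (simp only: image_mset_union sum_mset.union quad_form_add of_nat_add)
    show "wt v \<noteq> 0" if "v \<in> V" for v using that by (auto simp: V_def)
    show "Qf \<gamma> = int (quad_form C (\<Sum>v\<in>#\<gamma>. wt v))" for \<gamma> by (simp only: Qf_def)
    fix \<beta>
    have "{v\<in>V. wt v = \<beta>} \<subseteq> code ` ({\<beta>} \<times> (SIGMA k : {..degree (p \<beta>)}. {..<coeff (p \<beta>) k}))"
    proof
      fix v assume "v \<in> {v\<in>V. wt v = \<beta>}"
      then obtain k i where v: "v = code (\<beta>, k, i)" "i < coeff (p \<beta>) k" by (auto simp: V_def)
      hence "k \<le> degree (p \<beta>)" by (intro le_degree) auto
      thus "v \<in> code ` ({\<beta>} \<times> (SIGMA k : {..degree (p \<beta>)}. {..<coeff (p \<beta>) k}))" using v by blast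
    qed
    moreover have "finite (code ` ({\<beta>} \<times> (SIGMA k : {..degree (p \<beta>)}. {..<coeff (p \<beta>) k})))"
      by (intro finite_imageI finite_cartesian_product finite_SigmaI) auto
    ultimately show "finite {v\<in>V. wt v = \<beta>}" by (rule finite_subset)
  qed
  let ?\<psi> = "\<lambda>k (f :: rat fls). fls_compose_power f k"
  define ser where "ser = (\<lambda>c :: ('r \<Rightarrow>\<^sub>0 nat) \<Rightarrow> qfield. mscale (1 / (q - 1)) (series_without_const c))"
  have ser: "mcoeff (ser c) \<beta> = (if \<beta> = 0 then 0 else c \<beta> / (q - 1))" for c \<beta>
    by (simp add: ser_def series_without_const_def)
  have pE: "pleth_exp ?\<psi> (\<lambda>\<beta>. expand (mcoeff (ser c) \<beta>)) (\<lambda>\<beta>. expand (mcoeff (Exp (ser c)) \<beta>))" for c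
  proof (rule pleth_exp_hom[OF pleth_exp_Exp])
    show "mcoeff (ser c) 0 = 0" by (simp add: ser)
  qed (simp_all add: expand_add expand_mult expand_0 expand_1 expand_adams)
  have letters: "expand (mcoeff (ser a) \<beta>) = L.letters.obj_gf \<beta>" if \<beta>: "\<beta> \<noteq> 0" for \<beta>
  proof -
    have "expand (a \<beta> / (q - 1)) = L.letters.obj_gf \<beta>"
    proof (rule expand_divide_eqI)
      fix n
      show "L.letters.obj_gf \<beta> $$ (n + 2) - L.letters.obj_gf \<beta> $$ n = expand (a \<beta>) $$ n"
        unfolding L.letters_obj_gf_diff by (rule count[OF \<beta>])
    qed
    thus ?thesis using \<beta> by (simp add: ser)
  qed
  have Fa: "expand (mcoeff (Exp (ser a)) \<alpha>) = L.letters.mset_gf \<alpha>" for \<alpha>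
    by (rule pleth_exp_unique[OF pE L.letters.pleth_exp_mset_gf letters])
  have Fb: "expand (mcoeff (Exp (ser b)) \<alpha>) = L.words.mset_gf \<alpha>" for \<alpha>
  proof (rule fls_eqI)
    fix n
    have "mcoeff (Exp (ser b)) \<alpha> = q ^ quad_form C \<alpha> * mcoeff (Exp (ser a)) \<alpha>"
      using assms(2) unfolding ser_def by (simp add: Tbar_def)
    thus "expand (mcoeff (Exp (ser b)) \<alpha>) $$ n = L.words.mset_gf \<alpha> $$ n"
      by (simp only: expand_mult expand_q_times_nth Fa L.mset_gf_shift)
  qed
  have pEb: "pleth_exp ?\<psi> (\<lambda>\<beta>. expand (mcoeff (ser b) \<beta>)) L.words.mset_gf"
    using pE[of b] unfolding Fb .
  have \<psi>1: "?\<psi> 1 f = f" for f by (rule fls_eqI) (simp add: fls_nth_compose_power)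
  show ?thesis
  proof (intro allI impI)
    fix \<alpha> :: "'r \<Rightarrow>\<^sub>0 nat" assume \<alpha>: "\<alpha> \<noteq> 0"
    then obtain i where i: "lookup \<alpha> i \<noteq> 0" by (meson nonzero_lookup_obtain)
    \<comment> \<open>Both sides have the same plethystic exponential: \<open>Tbar\<close> has
      become the passage from letters to Lyndon words in \<open>Fb\<close>, and the exponential is
      injective.\<close>
    have "expand (mcoeff (ser b) \<alpha>) = L.words.obj_gf \<alpha>"
      by (rule pleth_exp_inject[OF pEb L.words.pleth_exp_mset_gf \<psi>1 \<alpha>])
    hence obj: "expand (b \<alpha> / (q - 1)) = L.words.obj_gf \<alpha>" using \<alpha> by (simp add: ser)
    \<comment> \<open>Multiplying by \<open>q - 1\<close> takes differences of the word counts at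
      distance 2, which are natural numbers by \<open>words_card_mono\<close>.\<close>
    have "\<exists>d. expand (b \<alpha>) $$ n = of_nat d" for n
      unfolding expand_divide_nth[of "b \<alpha>"] obj by (meson L.words_obj_gf_diff_obtain)
    then obtain c :: "int \<Rightarrow> nat" where c: "\<And>n. expand (b \<alpha>) $$ n = of_nat (c n)" by metis
    have odd: "c n = 0" if n: "odd n" for n
    proof -
      have "expand (b \<alpha>) $$ n = 0"
        unfolding expand_divide_nth[of "b \<alpha>"] obj using n by (simp add: L.words_obj_gf_odd)
      thus ?thesis unfolding c by simp
    qed
    have "qint (lookup \<alpha> i) * b \<alpha> \<in> polyq"
      by (rule qint_polynomial[OF nat_polys_q_polyq[OF assms(1)] assms(2) \<alpha>])
    thus "b \<alpha> \<in> \<nat>[q]" using i by (intro nat_polys_q_of_qint[OF c odd]) auto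
  qed
qed

end
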